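(* Let $(X_t,\eta_t)_{t\ge0}$ be the unique solution (in the sense of the context) of the entropy-drifted rearranged stochastic heat equation $\mathrm dX_t=-\frac12D\big(\frac1{DX_t}\big)\mathrm dt+\Delta X_t\,\mathrm dt+\mathrm d\eta_t+\mathrm dW_t$ with initial condition $X_0$. Then, $\mathbb P$-almost surely, for almost every $t>0$, the law $\mu_t=\mathrm{Leb}_{\mathbb S}\circ X_t^{-1}$ of $x\in\mathbb S\mapsto X_t(x)$ (with $\mathbb S$ equipped with $\mathrm{Leb}_{\mathbb S}$) has a square integrable density $p_t$ on $\mathbb R$, and for all $T>0$, $$\mathbb E\int_0^T\int_{\mathbb R}|p_t(z)|^2\,\mathrm dz\,\mathrm dt<\infty.$$ Moreover, $\mathbb P$-almost surely and for almost every $t>0$, the density $p_t$ is supported by $[X_t(0),X_t(1/2)]$ and is almost everywhere positive on $(X_t(0),X_t(1/2))$. For Lebesgue-almost every $z\in\mathbb R$, $X_t$ is differentiable at $\frac12\tilde F_{\mu_t}(z)$, where $\tilde F_{\mu_t}$ is the cumulative distribution function of $\mu_t$, and for almost every $z\in(X_t(0),X_t(1/2))$, $$DX_t\big(\tfrac12\tilde F_{\mu_t}(z)\big)=\frac{2}{p_t(z)}.$$ In particular, for all $T>0$, $$\mathbb E\int_0^T\int_{\mathbb R}\mathbf 1_{(X_t(0),X_t(1/2))}(z)\frac1{p_t(z)}\,\mathrm dz\,\mathrm dt=\frac14\,\mathbb E\int_0^T\int_{\mathbb S}|DX_t(x)|^2\,\mathrm dx\,\mathrm dt<\infty.$$ Lastly,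 $\mathbb P$-almost surely and for almost every $t>0$, $X_t(\cdot/2)$ is a continuous one-to-one mapping from $(0,1)$ onto $(X_t(0),X_t(1/2))$, with $\tilde F_{\mu_t}$ as inverse.
   Context: Notation. $\mathbb S=\mathbb R/\mathbb Z$ with Lebesgue measure $\mathrm{Leb}_{\mathbb S}$; points are represented in $(-1/2,1/2]$. $\langle\cdot,\cdot\rangle,\|\cdot\|_2$: inner product and norm of $L^2(\mathbb S)$; $\mathcal U^2(\mathbb S)$: classes in $L^2(\mathbb S)$ containing an even function that is non-decreasing on $(0,1/2)$. $e_0=1$, $e_k(x)=\sqrt2\cos(2\pi kx)$ for $k\ge1$. For $\gamma\in\mathbb R$, $\mathcal H^\gamma_{\mathrm{Sym}}(\mathbb S)$ is the space of even functions or distributions $f$ with $\|f\|_{2,\gamma}^2=\sum_{k\ge0}(k\vee1)^{2\gamma}\langle f,e_k\rangle^2<\infty$; $\langle\cdot,\cdot\rangle$ also denotes duality. $D,\Delta$: first and second derivatives on $\mathbb S$; $e^{t\Delta}$: heat semigroup generated by $\Delta$. Elements of $\mathcal H^1_{\mathrm{Sym}}(\mathbb S)$ are identified with their continuous representatives. Probabilistic set-up: a filtered probability space $(\Omega,\mathfrak F,\mathbb F,\mathbb P)$ satisfying the usual conditions, with independent $\mathbb F$-Brownian motions $(B^k)_{k\ge0}$ and $W_t=\sum_{k\ge0}\lambda_kB^k_te_k$, $\lambda_0=1$, $\lambda_k=k^{-\lambda}$ for $k\ge1$, for a fixed $\lambda>1/2$. $X_0$ is $\mathfrak F_0$-measurable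 with values in $\mathcal U^2(\mathbb S)$ and $\mathbb E[\|X_0\|_2^p]<\infty$ for all $p\ge1$. Integral: if $z$ is a continuous process with values in $\mathcal H^4_{\mathrm{Sym}}(\mathbb S)$ and $\varsigma$ a continuous process with values in $\mathcal H^{-2}_{\mathrm{Sym}}(\mathbb S)$ such that $t\mapsto\langle\varsigma_t,\varphi\rangle$ is non-decreasing for all $\varphi\in\mathcal H^2_{\mathrm{Sym}}(\mathbb S)\cap\mathcal U^2(\mathbb S)$, then $\int_0^tz_s\cdot\mathrm d\varsigma_s=\lim_{N\to\infty}\sum_{k\in\mathbb N:\,k\le Nt}\langle z_{k/N},\varsigma_{t\wedge(k+1)/N}-\varsigma_{k/N}\rangle$. Definition (solution). $(X_t,\eta_t)_{t\ge0}$ is a solution initialized at $X_0$ if: (i) $X$ is continuous, $\mathbb F$-adapted, with values in $\mathcal U^2(\mathbb S)$ (with the $L^2$ topology), its paths belong a.s. to $L^2_{\mathrm{loc}}([0,\infty),\mathcal H^1_{\mathrm{Sym}}(\mathbb S))$, and for all $T>0$, $\mathbb E\int_0^T\|DX_t\|_2^2\mathrm dt<\infty$ and $\mathbb E\int_0^T\int_{\mathbb S}\frac1{|DX_t(x)|}\mathrm dx\,\mathrm dt<\infty$; (ii) $\eta$ is a continuous $\mathbb F$-adapted process with values in $\mathcal H^{-2}_{\mathrm{Sym}}(\mathbb S)$, $\eta_0=0$, such that with probability one, for any $\varphi\in\mathcal H^2_{\mathrm{Sym}}(\mathbb S)\cap\mathcal U^2(\mathbb S)$, $t\mapsto\langle\eta_t,\varphi\rangle$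 is non-decreasing; (iii) with probability one, for all $\varphi\in\mathcal H^2_{\mathrm{Sym}}(\mathbb S)$ and $t\ge0$, $\langle X_t,\varphi\rangle=\langle X_0,\varphi\rangle+\frac12\int_0^t\langle\frac1{DX_r},D\varphi\rangle\mathrm dr+\int_0^t\langle X_r,\Delta\varphi\rangle\mathrm dr+\langle\eta_t,\varphi\rangle+\langle W_t,\varphi\rangle$; (iv) for any $t\ge0$, $\lim_{\epsilon\searrow0}\mathbb E\int_0^te^{\epsilon\Delta}X_r\cdot\mathrm d\eta_r=0$ and $\lim_{\epsilon\searrow0}\mathbb E\big|\int_0^t\int_{\mathbb S}\frac{e^{\epsilon\Delta}DX_r(x)}{DX_r(x)}\mathrm dx\,\mathrm dr-t\big|=0$. It is known that there exists exactly one solution.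
   Formalization: The clause "for Lebesgue-almost every z, X_t is differentiable at ½F(z)" is asserted only where ½F(z) is not 0 or 1/2: at these fold points, reached for all z<X_t(0) or z>X_t(1/2), the even function X_t need not be differentiable (e.g. X_0=|x|/√2, large λ). *)

theory Defs
  imports "HOL-Probability.Probability"
begin

section \<open>Functions on the circle\<close>

text \<open>
  A class in $L^2$ of the circle is given by any of its Borel representatives on the fundamental
  domain $(-1/2,1/2]$; values outside of this interval are never used. Wherever pointwise values or
  classical derivatives on the circle matter, functions are 1-periodic functions on the real line.
\<close>

definition circ :: "real measure" where
  "circ = restrict_space lborel {-1/2<..1/2}"

definition L2 :: "(real \<Rightarrow> real) set" where
  "L2 = {f. f \<in> borel_measurable circ \<and> integrable circ (\<lambda>x. (f x)\<^sup>2)}"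

definition ip :: "(real \<Rightarrow> real) \<Rightarrow> (real \<Rightarrow> real) \<Rightarrow> real" where
  "ip f g = (LINT x|circ. f x * g x)"

definition l2norm :: "(real \<Rightarrow> real) \<Rightarrow> real" where
  "l2norm f = sqrt (ip f f)"

definition U2 :: "(real \<Rightarrow> real) set" where
  "U2 = {f \<in> L2. \<exists>g. (AE x in circ. f x = g x) \<and> (\<forall>x\<in>{-1/2<..<1/2}. g (- x) = g x) \<and>
                     mono_on {0<..<1/2} g}"

definition ecos :: "nat \<Rightarrow> real \<Rightarrow> real" where
  "ecos k x = (if k = 0 then 1 else sqrt 2 * cos (2 * pi * real k * x))"

definition coef :: "(real \<Rightarrow> real) \<Rightarrow> nat \<Rightarrow> real" where
  "coef f k = ip f (ecos k)"

definition smooth_periodic :: "(real \<Rightarrow> real) \<Rightarrow> bool" where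
  "smooth_periodic \<phi> \<longleftrightarrow> (\<forall>x. \<phi> (x + 1) = \<phi> x) \<and> (\<forall>n x. (deriv ^^ n) \<phi> differentiable (at x))"

text \<open>
  The weak derivative on the circle, an $L^2$ class. It is set to 0 when there is none in $L^2$,
  which for a solution only concerns a null set of times.
\<close>

definition has_weak_deriv :: "(real \<Rightarrow> real) \<Rightarrow> (real \<Rightarrow> real) \<Rightarrow> bool" where
  "has_weak_deriv f g \<longleftrightarrow> g \<in> L2 \<and> (\<forall>\<phi>. smooth_periodic \<phi> \<longrightarrow> ip f (deriv \<phi>) = - ip g \<phi>)"

definition wD :: "(real \<Rightarrow> real) \<Rightarrow> real \<Rightarrow> real" where
  "wD f = (if \<exists>g. has_weak_deriv f g then SOME g. has_weak_deriv f g else (\<lambda>_. 0))"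

text \<open>The continuous representative of a class, as a 1-periodic function on the real line.\<close>

definition crep :: "(real \<Rightarrow> real) \<Rightarrow> real \<Rightarrow> real" where
  "crep f = (SOME g. continuous_on UNIV g \<and> (\<forall>x. g (x + 1) = g x) \<and> (AE x in circ. g x = f x))"

text \<open>
  The heat semigroup on all of $L^2$ (it is also applied to odd functions), as convolution
  with the periodic heat kernel $1 + 2 \sum_{k \geq 1} e^{-4\pi^2k^2\epsilon} \cos(2\pi k x)$.
\<close>

definition heat :: "real \<Rightarrow> (real \<Rightarrow> real) \<Rightarrow> real \<Rightarrow> real" where
  "heat \<epsilon> f x = (LINT y|circ.
     (1 + 2 * (\<Sum>k. exp (- (2 * pi * real (Suc k))\<^sup>2 * \<epsilon>) * cos (2 * pi * real (Suc k) * (x - y)))) * f y)"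

definition law :: "(real \<Rightarrow> real) \<Rightarrow> real measure" where
  "law f = distr circ borel f"

text \<open>A real-valued version of the Lebesgue density of a law (meaningful if the law has one).\<close>

definition dens :: "real measure \<Rightarrow> real \<Rightarrow> real" where
  "dens \<mu> z = enn2real (RN_deriv lborel \<mu> z)"


section \<open>Symmetric Sobolev spaces\<close>

text \<open>The squared Sobolev norm of order \<open>\<gamma>\<close> in terms of the coefficients on the cosine basis.\<close>

definition hsq :: "real \<Rightarrow> (nat \<Rightarrow> real) \<Rightarrow> ennreal" where
  "hsq \<gamma> a = (\<Sum>k. ennreal (real (max k 1) powr (2 * \<gamma>) * (a k)\<^sup>2))"

text \<open>For non-negative order the elements are functions.\<close>

definition Hsym :: "real \<Rightarrow> (real \<Rightarrow> real) set" where
  "Hsym \<gamma> = {f \<in> L2. (AE x in circ. f (- x) = f x) \<and> hsq \<gamma> (coef f) < \<infinity>}"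

text \<open>
  For negative order the elements are distributions, i.e. continuous linear functionals on the
  smooth periodic functions; the value of the HOL function on other arguments is irrelevant.
\<close>

type_synonym distrib = "(real \<Rightarrow> real) \<Rightarrow> real"

definition distribution :: "distrib \<Rightarrow> bool" where
  "distribution S \<longleftrightarrow>
     (\<forall>\<phi> \<psi> a b. smooth_periodic \<phi> \<longrightarrow> smooth_periodic \<psi> \<longrightarrow>
        S (\<lambda>x. a * \<phi> x + b * \<psi> x) = a * S \<phi> + b * S \<psi>) \<and>
     (\<exists>C m. \<forall>\<phi>. smooth_periodic \<phi> \<longrightarrow> \<bar>S \<phi>\<bar> \<le> C * (\<Sum>j\<le>m. SUP x. \<bar>(deriv ^^ j) \<phi> x\<bar>))"

definition Hsym_dist :: "real \<Rightarrow> distrib set" where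
  "Hsym_dist \<gamma> = {S. distribution S \<and> (\<forall>\<phi>. smooth_periodic \<phi> \<longrightarrow> S (\<lambda>x. \<phi> (- x)) = S \<phi>) \<and>
                     hsq \<gamma> (\<lambda>k. S (ecos k)) < \<infinity>}"

text \<open>Duality between the spaces of order $-\gamma$ and $\gamma$.\<close>

definition dual :: "distrib \<Rightarrow> (real \<Rightarrow> real) \<Rightarrow> real" where
  "dual S \<phi> = (\<Sum>k. S (ecos k) * coef \<phi> k)"

text \<open>
  The integral of \<open>z\<close> against $\mathrm{d}\zeta$ as a limit of Riemann sums. The value at \<open>N = 0\<close> is
  immaterial for the limit.
\<close>

definition dint :: "(real \<Rightarrow> real \<Rightarrow> real) \<Rightarrow> (real \<Rightarrow> distrib) \<Rightarrow> real \<Rightarrow> real" where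
  "dint z \<zeta> t = lim (\<lambda>N. \<Sum>k | real k \<le> real N * t.
     dual (\<lambda>\<phi>. \<zeta> (min t (real (k + 1) / real N)) \<phi> - \<zeta> (real k / real N) \<phi>) (z (real k / real N)))"


section \<open>Probabilistic set-up\<close>

definition usual_conditions :: "'w measure \<Rightarrow> (real \<Rightarrow> 'w measure) \<Rightarrow> bool" where
  "usual_conditions M F \<longleftrightarrow>
     (\<forall>t\<ge>0. subalgebra M (F t)) \<and>
     (\<forall>s t. 0 \<le> s \<and> s \<le> t \<longrightarrow> sets (F s) \<subseteq> sets (F t)) \<and>
     (\<forall>t\<ge>0. sets (F t) = (\<Inter>s\<in>{t<..}. sets (F s))) \<and>
     (\<forall>N\<in>null_sets M. \<forall>A\<subseteq>N. A \<in> sets (F 0))"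

definition brownian :: "'w measure \<Rightarrow> (real \<Rightarrow> 'w measure) \<Rightarrow> (real \<Rightarrow> 'w \<Rightarrow> real) \<Rightarrow> bool" where
  "brownian M F b \<longleftrightarrow>
     (AE \<omega> in M. b 0 \<omega> = 0) \<and>
     (AE \<omega> in M. continuous_on {0..} (\<lambda>t. b t \<omega>)) \<and>
     (\<forall>t\<ge>0. b t \<in> borel_measurable (F t)) \<and>
     (\<forall>s t. 0 \<le> s \<and> s < t \<longrightarrow>
        distributed M lborel (\<lambda>\<omega>. b t \<omega> - b s \<omega>) (normal_density 0 (sqrt (t - s))) \<and>
        prob_space.indep_set M (sets (F s))
          (sets (vimage_algebra (space M) (\<lambda>\<omega>. b t \<omega> - b s \<omega>) borel)))"

definition independent_brownians ::
  "'w measure \<Rightarrow> (real \<Rightarrow> 'w measure) \<Rightarrow> (nat \<Rightarrow> real \<Rightarrow> 'w \<Rightarrow> real) \<Rightarrow> bool" where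
  "independent_brownians M F B \<longleftrightarrow>
     (\<forall>k. brownian M F (B k)) \<and>
     prob_space.indep_vars M (\<lambda>_. Pi\<^sub>M {0..} (\<lambda>_. borel)) (\<lambda>k \<omega>. \<lambda>t\<in>{0..}. B k t \<omega>) UNIV"

definition lamseq :: "real \<Rightarrow> nat \<Rightarrow> real" where
  "lamseq lam k = (if k = 0 then 1 else real k powr (- lam))"

text \<open>The pairing of $W_t = \sum_k \lambda_k B^k_t e_k$ (a series converging in $L^2$) with \<open>\<phi>\<close>.\<close>

definition noise_ip ::
  "real \<Rightarrow> (nat \<Rightarrow> real \<Rightarrow> 'w \<Rightarrow> real) \<Rightarrow> real \<Rightarrow> 'w \<Rightarrow> (real \<Rightarrow> real) \<Rightarrow> real" where
  "noise_ip lam B t \<omega> \<phi> = (\<Sum>k. lamseq lam k * B k t \<omega> * coef \<phi> k)"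

text \<open>
  Borel measurability of random elements of \<open>L2\<close> and \<open>Hsym_dist \<gamma>\<close>: these spaces are separable, so
  their Borel sigma-algebras are generated by the distances to fixed elements.
\<close>

definition L2_measurable :: "'w measure \<Rightarrow> ('w \<Rightarrow> real \<Rightarrow> real) \<Rightarrow> bool" where
  "L2_measurable A Y \<longleftrightarrow> (\<forall>h\<in>L2. (\<lambda>\<omega>. l2norm (\<lambda>x. Y \<omega> x - h x)) \<in> borel_measurable A)"

definition Hsym_dist_measurable :: "real \<Rightarrow> 'w measure \<Rightarrow> ('w \<Rightarrow> distrib) \<Rightarrow> bool" where
  "Hsym_dist_measurable \<gamma> A Y \<longleftrightarrow>
     (\<forall>h\<in>Hsym_dist \<gamma>. (\<lambda>\<omega>. hsq \<gamma> (\<lambda>k. Y \<omega> (ecos k) - h (ecos k))) \<in> borel_measurable A)"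

definition initial_condition ::
  "'w measure \<Rightarrow> (real \<Rightarrow> 'w measure) \<Rightarrow> ('w \<Rightarrow> real \<Rightarrow> real) \<Rightarrow> bool" where
  "initial_condition M F X0 \<longleftrightarrow>
     (\<forall>\<omega>\<in>space M. X0 \<omega> \<in> U2) \<and> L2_measurable (F 0) X0 \<and>
     (\<forall>p\<ge>1. (\<integral>\<^sup>+\<omega>. ennreal (l2norm (X0 \<omega>) powr p) \<partial>M) < \<infinity>)"


section \<open>Solutions of the entropy-drifted equation\<close>

text \<open>
  Quantities that can be infinite are \<open>ennreal\<close>-valued, where \<open>1 / 0 = \<infinity>\<close>; in particular
  \<open>sol_path\<close> forces the derivative to be non-zero almost everywhere.
\<close>

definition sol_path ::
  "'w measure \<Rightarrow> (real \<Rightarrow> 'w measure) \<Rightarrow> (real \<Rightarrow> 'w \<Rightarrow> real \<Rightarrow> real) \<Rightarrow> bool" where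
  "sol_path M F X \<longleftrightarrow>
     (\<forall>t\<ge>0. \<forall>\<omega>\<in>space M. X t \<omega> \<in> U2) \<and>
     (\<forall>t\<ge>0. \<forall>\<omega>\<in>space M.
        ((\<lambda>s. l2norm (\<lambda>x. X s \<omega> x - X t \<omega> x)) \<longlongrightarrow> 0) (at t within {0..})) \<and>
     (\<forall>t\<ge>0. L2_measurable (F t) (X t)) \<and>
     (AE \<omega> in M. \<forall>T>0. (\<integral>\<^sup>+t\<in>{0..T}. hsq 1 (coef (X t \<omega>)) \<partial>lborel) < \<infinity>) \<and>
     (\<forall>T>0. (\<integral>\<^sup>+\<omega>. (\<integral>\<^sup>+t\<in>{0..T}. (\<integral>\<^sup>+x. ennreal ((wD (X t \<omega>) x)\<^sup>2) \<partial>circ) \<partial>lborel) \<partial>M) < \<infinity>) \<and>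
     (\<forall>T>0. (\<integral>\<^sup>+\<omega>. (\<integral>\<^sup>+t\<in>{0..T}. (\<integral>\<^sup>+x. 1 / ennreal \<bar>wD (X t \<omega>) x\<bar> \<partial>circ) \<partial>lborel) \<partial>M) < \<infinity>)"

definition sol_reflection ::
  "'w measure \<Rightarrow> (real \<Rightarrow> 'w measure) \<Rightarrow> (real \<Rightarrow> 'w \<Rightarrow> distrib) \<Rightarrow> bool" where
  "sol_reflection M F \<eta> \<longleftrightarrow>
     (\<forall>t\<ge>0. \<forall>\<omega>\<in>space M. \<eta> t \<omega> \<in> Hsym_dist (-2)) \<and>
     (\<forall>t\<ge>0. \<forall>\<omega>\<in>space M.
        ((\<lambda>s. hsq (-2) (\<lambda>k. \<eta> s \<omega> (ecos k) - \<eta> t \<omega> (ecos k))) \<longlongrightarrow> 0) (at t within {0..})) \<and>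
     (\<forall>t\<ge>0. Hsym_dist_measurable (-2) (F t) (\<eta> t)) \<and>
     (\<forall>\<omega>\<in>space M. \<forall>\<phi>. smooth_periodic \<phi> \<longrightarrow> \<eta> 0 \<omega> \<phi> = 0) \<and>
     (AE \<omega> in M. \<forall>\<phi>\<in>Hsym 2 \<inter> U2. mono_on {0..} (\<lambda>t. dual (\<eta> t \<omega>) \<phi>))"

definition sol_equation ::
  "'w measure \<Rightarrow> real \<Rightarrow> (nat \<Rightarrow> real \<Rightarrow> 'w \<Rightarrow> real) \<Rightarrow> ('w \<Rightarrow> real \<Rightarrow> real) \<Rightarrow>
   (real \<Rightarrow> 'w \<Rightarrow> real \<Rightarrow> real) \<Rightarrow> (real \<Rightarrow> 'w \<Rightarrow> distrib) \<Rightarrow> bool" where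
  "sol_equation M lam B X0 X \<eta> \<longleftrightarrow>
     (AE \<omega> in M. \<forall>\<phi>\<in>Hsym 2. \<forall>t\<ge>0.
        ip (X t \<omega>) \<phi> =
          ip (X0 \<omega>) \<phi>
          + 1/2 * (LINT r:{0..t}|lborel. ip (\<lambda>x. 1 / wD (X r \<omega>) x) (wD \<phi>))
          + (LINT r:{0..t}|lborel. ip (X r \<omega>) (wD (wD \<phi>)))
          + dual (\<eta> t \<omega>) \<phi>
          + noise_ip lam B t \<omega> \<phi>)"

text \<open>
  In the first limit, the integral against \<open>\<eta>\<close> is non-negative almost surely (its integrand is
  valued in \<open>U2\<close>), so that its expectation is a non-negative integral.
\<close>

definition sol_orthogonality ::
  "'w measure \<Rightarrow> (real \<Rightarrow> 'w \<Rightarrow> real \<Rightarrow> real) \<Rightarrow> (real \<Rightarrow> 'w \<Rightarrow> distrib) \<Rightarrow> bool" where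
  "sol_orthogonality M X \<eta> \<longleftrightarrow>
     (\<forall>t\<ge>0.
        ((\<lambda>\<epsilon>. \<integral>\<^sup>+\<omega>. ennreal (dint (\<lambda>r. heat \<epsilon> (X r \<omega>)) (\<lambda>r. \<eta> r \<omega>) t) \<partial>M) \<longlongrightarrow> 0) (at_right 0) \<and>
        ((\<lambda>\<epsilon>. \<integral>\<^sup>+\<omega>. ennreal \<bar>(LINT r:{0..t}|lborel. LINT x|circ.
             heat \<epsilon> (wD (X r \<omega>)) x / wD (X r \<omega>) x) - t\<bar> \<partial>M) \<longlongrightarrow> 0) (at_right 0))"

definition is_solution ::
  "'w measure \<Rightarrow> (real \<Rightarrow> 'w measure) \<Rightarrow> real \<Rightarrow> (nat \<Rightarrow> real \<Rightarrow> 'w \<Rightarrow> real) \<Rightarrow>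
   ('w \<Rightarrow> real \<Rightarrow> real) \<Rightarrow> (real \<Rightarrow> 'w \<Rightarrow> real \<Rightarrow> real) \<Rightarrow> (real \<Rightarrow> 'w \<Rightarrow> distrib) \<Rightarrow> bool" where
  "is_solution M F lam B X0 X \<eta> \<longleftrightarrow>
     (AE \<omega> in M. AE x in circ. X 0 \<omega> x = X0 \<omega> x) \<and>
     sol_path M F X \<and> sol_reflection M F \<eta> \<and>
     sol_equation M lam B X0 X \<eta> \<and> sol_orthogonality M X \<eta>"

end

theory Submission
  imports Defs
begin

text \<open>
  Consider a path and a time at which \<open>f = X t \<omega>\<close> has a weak derivative \<open>v\<close> with \<open>1 / \<bar>v\<bar>\<close>
  integrable. Being even and non-decreasing on \<open>(0, 1/2)\<close>, \<open>f\<close> is of the form \<open>f x = G \<bar>x\<bar>\<close>, where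
  \<open>G\<close> is a primitive of \<open>w = \<bar>v\<bar>\<close> on \<open>(0, 1/2)\<close> (\<open>U2_profile\<close>). Integrability of \<open>1 / w\<close> makes \<open>w\<close>
  positive almost everywhere, so that \<open>G\<close> is a strictly increasing absolutely continuous bijection.
  All the pathwise claims then come from one change of variables: \<open>G\<close> transports the measure
  \<open>w x dx\<close> on \<open>(0, 1/2)\<close> to Lebesgue measure on \<open>(G 0, G (1/2))\<close> (\<open>distr_density_G\<close>). The law of \<open>f\<close> is
  the image of \<open>2 dx = (2 / w x) w x dx\<close>, hence its density is \<open>p = 2 / w\<close> composed with the inverse of
  \<open>G\<close>, and this inverse is half of the distribution function. Consequently the integral of \<open>p\<^sup>2\<close> is
  4 times the one of \<open>1 / w\<close> over \<open>(0, 1/2)\<close>, that is twice the one of \<open>1 / \<bar>v\<bar>\<close> over the circle, and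
  the integral of \<open>1 / p\<close> is half the one of \<open>w\<^sup>2\<close>, that is a quarter of the one of \<open>v\<^sup>2\<close>. The same
  transport carries the null set where \<open>G\<close> fails to have derivative \<open>w\<close> to a null set of levels
  \<open>z\<close>. These conclusions are gathered in \<open>regular_path_law\<close>.

  There remains to see that almost every path is of this kind at almost every time
  (\<open>solution_path_regular\<close>). The bound on the expected time integral of the inverse derivative does
  not give this at once: a non-negative integral is a supremum over measurable simple functions, so
  its finiteness controls an integrand only if that integrand is measurable, and the weak derivative
  is obtained from a choice. The integral of \<open>1 / \<bar>v\<bar>\<close> is therefore bounded below by the functionals
  \<open>inv_energy\<close>, Riemann sums of inverse difference quotients that only involve limits of inner products
  of \<open>f\<close> with fixed step functions and are thus jointly measurable along the path. By convexity of
  the inverse they lie below the integral (\<open>inv_energy_le\<close>); by Lebesgue differentiation and Fatou's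
  lemma their supremum is at least the integral over the half circle (\<open>le_inv_energy\<close>). The latter
  needs a weak derivative to exist, which follows from the finite first order Sobolev norm, a
  measurable functional of the path: the differentiated cosine series converges in \<open>L2\<close> by the
  Riesz-Fischer argument, and a cosine series determines an even function
  (\<open>has_weak_deriv_of_hsq\<close>).
\<close>

section \<open>Differentiation of primitives\<close>

definition primitive :: "(real \<Rightarrow> real) \<Rightarrow> real \<Rightarrow> real" where
  "primitive w y = (LINT s:{..y}|lborel. w s)"

lemma primitive_diff:
  fixes w :: "real \<Rightarrow> real"
  assumes "integrable lborel w" "a \<le> b"
  shows "primitive w b - primitive w a = (LINT s:{a<..b}|lborel. w s)"
proof -
  have si: "set_integrable lborel A w" if "A \<in> sets borel" for A
    unfolding set_integrable_def using assms(1) that by (intro integrable_mult_indicator) auto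
  have "{..b} = {..a} \<union> {a<..b}" using assms(2) by auto
  moreover have "(LINT s:{..a} \<union> {a<..b}|lborel. w s) = (LINT s:{..a}|lborel. w s) + (LINT s:{a<..b}|lborel. w s)"
    by (rule set_integral_Un) (auto intro!: si)
  ultimately show ?thesis by (simp add: primitive_def)
qed

lemma primitive_diff_integral:
  fixes w :: "real \<Rightarrow> real"
  assumes w: "integrable lborel w" and "a \<le> b"
  shows "primitive w b - primitive w a = integral {a..b} w"
proof -
  have si: "set_integrable lborel A w" if "A \<in> sets borel" for A
    unfolding set_integrable_def using w that by (intro integrable_mult_indicator) auto
  have "(LINT s:{a<..b}|lborel. w s) = (LINT s:{a..b}|lborel. w s)"
    unfolding set_lebesgue_integral_def
  proof (rule integral_cong_AE)
    show "AE x in lborel. indicator {a<..b} x *\<^sub>R w x = indicator {a..b} x *\<^sub>R w x"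
      using AE_lborel_singleton[of a] by eventually_elim (auto simp: indicator_def)
  qed (use w in auto)
  also have "\<dots> = integral {a..b} w"
    by (intro set_borel_integral_eq_integral(2) si) auto
  finally show ?thesis using primitive_diff[OF assms] by simp
qed

lemma one_sided_lebesgue_differentiation:
  fixes w :: "real \<Rightarrow> real"
  assumes w: "integrable lborel w"
  shows "AE x in lborel. \<forall>e>0. \<exists>d>0. \<forall>h. 0 < h \<and> h < d \<longrightarrow> \<bar>integral {x..x + h} w / h - w x\<bar> < e"
proof -
  have "w integrable_on cbox a b" for a b
    using integrable_on_lborel[OF w] by (rule integrable_on_subcbox) auto
  then obtain N where N: "negligible N"
    "\<And>x e. \<lbrakk>x \<notin> N; 0 < e\<rbrakk> \<Longrightarrow> \<exists>d>0. \<forall>h. 0 < h \<and> h < d \<longrightarrow>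
        norm (integral (cbox x (x + h *\<^sub>R One)) w /\<^sub>R h ^ DIM(real) - w x) < e"
    by (rule integrable_ccontinuous_explicit) (rule that)
  have "AE x in lebesgue. x \<notin> N"
    using N(1) by (simp add: AE_not_in negligible_iff_null_sets)
  then have "AE x in lborel. x \<notin> N" by (simp add: AE_completion_iff)
  then show ?thesis
  proof eventually_elim
    case (elim x)
    then show ?case using N(2)[of x] by (simp add: divide_inverse_commute)
  qed
qed

lemma AE_lborel_uminus:
  assumes "AE x in lborel. P (x::real)"
  shows "AE x in lborel. P (- x)"
proof -
  have "AE x in distr lborel borel uminus. P x"
    using assms unfolding lborel_distr_uminus .
  then show ?thesis by (rule AE_distrD[rotated]) simp
qed

text \<open>
  The one-sided statement applied to \<open>w\<close> and to its reflection gives the right and the left derivative.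
\<close>

lemma lebesgue_differentiation:
  fixes w :: "real \<Rightarrow> real"
  assumes w: "integrable lborel w"
  shows "AE x in lborel. (primitive w has_real_derivative w x) (at x)"
proof -
  let ?W = "primitive w"
  have w': "integrable lborel (\<lambda>x. w (- x))"
    using lborel_integrable_real_affine[OF w, of "-1" 0] by simp
  have refl: "integral {- x..- x + h} (\<lambda>x. w (- x)) = integral {x - h..x} w" for x h
    using Henstock_Kurzweil_Integration.integral_reflect_real[of x "x - h" w]
    by simp
  have 1: "AE x in lborel. \<forall>e>0. \<exists>d>0. \<forall>h. 0 < h \<and> h < d \<longrightarrow> \<bar>integral {x - h..x} w / h - w x\<bar> < e"
    using AE_lborel_uminus[OF one_sided_lebesgue_differentiation[OF w']] unfolding refl by simp
  show ?thesis
    using 1 one_sided_lebesgue_differentiation[OF w]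
  proof eventually_elim
    case (elim x)
    show ?case
      unfolding has_field_derivative_iff LIM_eq
    proof (intro allI impI)
      fix e :: real assume "e > 0"
      obtain d1 where d1: "d1 > 0" "\<And>h. 0 < h \<Longrightarrow> h < d1 \<Longrightarrow> \<bar>integral {x - h..x} w / h - w x\<bar> < e"
        using elim(1)[rule_format, OF \<open>e > 0\<close>] by blast
      obtain d2 where d2: "d2 > 0" "\<And>h. 0 < h \<Longrightarrow> h < d2 \<Longrightarrow> \<bar>integral {x..x + h} w / h - w x\<bar> < e"
        using elim(2)[rule_format, OF \<open>e > 0\<close>] by blast
      show "\<exists>s>0. \<forall>y. y \<noteq> x \<and> norm (y - x) < s \<longrightarrow> norm ((?W y - ?W x) / (y - x) - w x) < e"
      proof (intro exI[of _ "min d1 d2"] conjI allI impI)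
        fix y assume y: "y \<noteq> x \<and> norm (y - x) < min d1 d2"
        show "norm ((?W y - ?W x) / (y - x) - w x) < e"
        proof (cases "y > x")
          case True
          then have "?W y - ?W x = integral {x..x + (y - x)} w" using primitive_diff_integral[OF w, of x y] by simp
          then show ?thesis using d2(2)[of "y - x"] True y by simp
        next
          case False
          then have "y < x" using y by simp
          then have "?W x - ?W y = integral {x - (x - y)..x} w" using primitive_diff_integral[OF w, of y x] by simp
          moreover have "(?W y - ?W x) / (y - x) = (?W x - ?W y) / (x - y)"
            using minus_divide_divide[of "?W x - ?W y" "x - y"] by simp
          ultimately show ?thesis using d1(2)[of "x - y"] \<open>y < x\<close> y by simp
        qed
      qed (simp_all add: d1(1) d2(1))
    qed
  qed
qed

lemma continuous_primitive:
  fixes w :: "real \<Rightarrow> real"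
  assumes w: "integrable lborel w"
  shows "continuous_on A (primitive w)"
proof -
  have "isCont (primitive w) x" for x
  proof -
    have i: "w integrable_on {x - 1..x + 1}"
      using w by (metis integrable_on_lborel integrable_on_subinterval subset_UNIV)
    have "continuous_on {x - 1..x + 1} (\<lambda>y. integral {x - 1..y} w)"
      by (rule indefinite_integral_continuous_1[OF i])
    then have "continuous_on {x - 1<..<x + 1} (\<lambda>y. integral {x - 1..y} w + primitive w (x - 1))"
      by (intro continuous_intros) (auto elim: continuous_on_subset)
    then have "continuous_on {x - 1<..<x + 1} (primitive w)"
    proof (rule continuous_on_eq)
      fix y assume "y \<in> {x - 1<..<x + 1}"
      then show "integral {x - 1..y} w + primitive w (x - 1) = primitive w y"
        using primitive_diff_integral[OF w, of "x - 1" y] by simp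
    qed
    then show ?thesis by (rule continuous_on_interior) auto
  qed
  then show ?thesis by (simp add: continuous_at_imp_continuous_on)
qed

section \<open>Functions orthogonal to all cosines\<close>

lemma integrable_mult_continuous_half:
  fixes E f :: "real \<Rightarrow> real"
  assumes E: "integrable lborel E" "\<And>x. x \<notin> {0..1/2} \<Longrightarrow> E x = 0" and f: "continuous_on UNIV f"
  shows "integrable lborel (\<lambda>x. E x * f x)"
proof -
  have "compact (f ` {0..1/2})"
    using f by (intro compact_continuous_image) (auto elim: continuous_on_subset)
  then obtain C where C: "\<And>x. x \<in> {0..1/2} \<Longrightarrow> \<bar>f x\<bar> \<le> C"
    using compact_imp_bounded bounded_iff by (metis imageI real_norm_def)
  have [measurable]: "f \<in> borel_measurable borel"
    using f by (rule borel_measurable_continuous_onI)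
  show ?thesis
  proof (rule Bochner_Integration.integrable_bound[of _ "\<lambda>x. C * E x"])
    show "AE x in lborel. norm (E x * f x) \<le> norm (C * E x)"
    proof (rule AE_I2)
      fix x
      show "norm (E x * f x) \<le> norm (C * E x)"
      proof (cases "x \<in> {0..1/2}")
        case True
        then have "\<bar>f x\<bar> \<le> \<bar>C\<bar>" using C[OF True] by linarith
        then show ?thesis by (simp add: abs_mult mult.commute[of "\<bar>C\<bar>"] mult_left_mono)
      qed (use E(2) in auto)
    qed
  qed (use E in auto)
qed

abbreviation cosn :: "nat \<Rightarrow> real \<Rightarrow> real" where
  "cosn k x \<equiv> cos (2 * pi * real k * x)"

abbreviation sinn :: "nat \<Rightarrow> real \<Rightarrow> real" where
  "sinn k x \<equiv> sin (2 * pi * real k * x)"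

text \<open>
  Polynomials in \<open>cos (2 * pi * x)\<close> are dense in the continuous functions on \<open>[0, 1/2]\<close>, because this
  function separates the points there. So \<open>E\<close> is orthogonal to all continuous functions, hence to the
  indicators of half-lines; its primitive vanishes and so does \<open>E\<close>.
\<close>

lemma AE_zero_of_cosine_orthogonal:
  fixes E :: "real \<Rightarrow> real"
  assumes E: "integrable lborel E" "\<And>x. x \<notin> {0..1/2} \<Longrightarrow> E x = 0"
    and orth: "\<And>k::nat. (LINT x|lborel. E x * cosn k x) = 0"
  shows "AE x in lborel. E x = 0"
proof -
  \<comment> \<open>Multiplication by cos (2 pi x) preserves Z, so the multipliers P of Z form an algebra to which Stone-Weierstrass applies.\<close>
  define Z where "Z = {g. continuous_on UNIV g \<and>
    (\<forall>k::nat. (LINT x|lborel. E x * (g x * cosn k x)) = 0)}"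
  define P where "P f \<longleftrightarrow> continuous_on UNIV f \<and> (\<forall>g\<in>Z. (\<lambda>x. f x * g x) \<in> Z)" for f :: "real \<Rightarrow> real"
  have int: "integrable lborel (\<lambda>x. E x * f x)" if "continuous_on UNIV f" for f
    using integrable_mult_continuous_half[OF E that] .
  have ccos: "continuous_on UNIV (\<lambda>x. cosn k x)" for k
    by (intro continuous_intros)
  have one: "(\<lambda>x. 1) \<in> Z"
    using orth by (simp add: Z_def)
  have Pc: "P (\<lambda>x. c)" for c
  proof -
    have "(LINT x|lborel. E x * (c * g x * cosn k x)) = c * (LINT x|lborel. E x * (g x * cosn k x))" for k g
      by (simp only: integral_mult_right_zero[symmetric]) (simp add: algebra_simps)
    then show ?thesis
      by (auto simp: P_def Z_def intro!: continuous_intros)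
  qed
  have Padd: "P (\<lambda>x. f x + h x)" if "P f \<and> P h" for f h
  proof -
    have "(\<lambda>x. (f x + h x) * g x) \<in> Z" if g: "g \<in> Z" for g
    proof -
      have 1: "(\<lambda>x. f x * g x) \<in> Z" "(\<lambda>x. h x * g x) \<in> Z"
        using \<open>P f \<and> P h\<close> g by (auto simp: P_def)
      have c: "continuous_on UNIV f" "continuous_on UNIV h" "continuous_on UNIV g"
        using \<open>P f \<and> P h\<close> g by (auto simp: P_def Z_def)
      have 2: "(LINT x|lborel. E x * ((f x + h x) * g x * cosn k x)) = 0" for k
      proof -
        have "(LINT x|lborel. E x * ((f x + h x) * g x * cosn k x)) =
          (LINT x|lborel. E x * (f x * g x * cosn k x) + E x * (h x * g x * cosn k x))"
          by (simp add: algebra_simps)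
        also have "\<dots> = (LINT x|lborel. E x * (f x * g x * cosn k x)) + (LINT x|lborel. E x * (h x * g x * cosn k x))"
          by (intro Bochner_Integration.integral_add int continuous_on_mult c ccos)
        also have "\<dots> = 0" using 1 by (simp add: Z_def)
        finally show ?thesis .
      qed
      show ?thesis
        using 2 unfolding Z_def by (simp add: continuous_on_mult continuous_on_add c)
    qed
    then show ?thesis using that by (auto simp: P_def intro!: continuous_intros)
  qed
  have Pmult: "P (\<lambda>x. f x * h x)" if "P f \<and> P h" for f h
    using that by (auto simp: P_def mult.assoc intro!: continuous_intros)
  have Pcos: "P (\<lambda>x. cos (2 * pi * x))"
  proof -
    have "(LINT x|lborel. E x * (cos (2 * pi * x) * g x * cosn k x)) = 0" if g: "g \<in> Z" for g k
    proof (cases k)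
      case 0
      have "(LINT x|lborel. E x * (g x * cosn 1 x)) = 0" using g unfolding Z_def by blast
      then show ?thesis using 0 by (simp add: mult_ac)
    next
      case (Suc l)
      have cc: "cos (2 * pi * x) * cosn k x =
          (cosn (Suc k) x + cosn l x) / 2" for x
      proof -
        have "cos (2 * pi * real k * x + 2 * pi * x) + cos (2 * pi * real k * x - 2 * pi * x) =
          2 * (cos (2 * pi * x) * cosn k x)"
          unfolding cos_add cos_diff by simp
        moreover have "2 * pi * real k * x + 2 * pi * x = 2 * pi * real (Suc k) * x"
          "2 * pi * real k * x - 2 * pi * x = 2 * pi * real l * x"
          using Suc by (simp_all add: algebra_simps)
        ultimately show ?thesis by simp
      qed
      have cg: "continuous_on UNIV g" using g by (simp add: Z_def)
      have "(LINT x|lborel. E x * (cos (2 * pi * x) * g x * cosn k x)) =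
        (LINT x|lborel. 1/2 * (E x * (g x * cosn (Suc k) x)) + 1/2 * (E x * (g x * cosn l x)))"
      proof (rule Bochner_Integration.integral_cong[OF refl])
        fix x
        have "E x * (cos (2 * pi * x) * g x * cosn k x) = E x * g x * (cos (2 * pi * x) * cosn k x)"
          by (simp add: mult_ac)
        then show "E x * (cos (2 * pi * x) * g x * cosn k x) =
          1/2 * (E x * (g x * cosn (Suc k) x)) + 1/2 * (E x * (g x * cosn l x))"
          unfolding cc by (simp add: algebra_simps add_divide_distrib)
      qed
      also have "\<dots> = (LINT x|lborel. 1/2 * (E x * (g x * cosn (Suc k) x))) + (LINT x|lborel. 1/2 * (E x * (g x * cosn l x)))"
        by (intro Bochner_Integration.integral_add integrable_mult_right int continuous_intros ccos cg)
      also have "\<dots> = 0"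
      proof -
        have "(LINT x|lborel. E x * (g x * cosn m x)) = 0" for m
          using g unfolding Z_def by blast
        then show ?thesis by (simp del: of_nat_Suc)
      qed
      finally show ?thesis .
    qed
    then show ?thesis by (auto simp: P_def Z_def intro!: continuous_intros)
  qed
  have sep: "\<exists>f. P f \<and> f x \<noteq> f y" if "x \<in> {0..1/2::real} \<and> y \<in> {0..1/2} \<and> x \<noteq> y" for x y
  proof (intro exI conjI)
    have "2 * pi * x \<le> pi" "2 * pi * y \<le> pi" using that by (auto simp: field_simps)
    then have "cos (2 * pi * x) = cos (2 * pi * y) \<Longrightarrow> 2 * pi * x = 2 * pi * y"
      using that by (elim cos_inj_pi[rotated -1]) auto
    then show "cos (2 * pi * x) \<noteq> cos (2 * pi * y)" using that by auto
  qed (rule Pcos)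
  have zero: "(LINT x|lborel. E x * h x) = 0" if h: "continuous_on UNIV h" for h
  proof (rule ccontr)
    let ?I = "LINT x|lborel. \<bar>E x\<bar>"
    assume nz: "(LINT x|lborel. E x * h x) \<noteq> 0"
    have "?I \<ge> 0" by simp
    then have I0: "?I + 1 > 0" by linarith
    \<comment> \<open>The 1 keeps the quotient defined if E = 0 almost everywhere.\<close>
    define e where "e = \<bar>LINT x|lborel. E x * h x\<bar> / (?I + 1)"
    have e: "e > 0" using nz I0 unfolding e_def by (intro divide_pos_pos) simp_all
    have "\<exists>g. P g \<and> (\<forall>x\<in>{0..1/2}. \<bar>h x - g x\<bar> < e)"
    proof (rule Stone_Weierstrass_HOL[of "{0..1/2::real}" P])
      show "continuous_on {0..1/2} f" if "P f" for f
        using that by (auto simp: P_def elim: continuous_on_subset)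
      show "continuous_on {0..1/2} h" using h by (auto elim: continuous_on_subset)
    qed (use Pc Padd Pmult sep e in auto)
    then obtain g where g: "P g" "\<And>x. x \<in> {0..1/2} \<Longrightarrow> \<bar>h x - g x\<bar> < e" by blast
    have cg: "continuous_on UNIV g" using g(1) by (simp add: P_def)
    have gZ: "(\<lambda>x. g x * 1) \<in> Z" using g(1) unfolding P_def by (rule conjunct2[THEN bspec]) (rule one)
    have "(LINT x|lborel. E x * (g x * 1 * cosn 0 x)) = 0" using gZ unfolding Z_def by blast
    then have "(LINT x|lborel. E x * h x) = (LINT x|lborel. E x * h x) - (LINT x|lborel. E x * g x)" by simp
    also have "\<dots> = (LINT x|lborel. E x * (h x - g x))"
      using int[OF h] int[OF cg] by (simp add: right_diff_distrib)
    also have "\<bar>\<dots>\<bar> \<le> (LINT x|lborel. \<bar>E x\<bar> * e)"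
    proof (rule integral_abs_bound[THEN order_trans], rule integral_mono)
      show "integrable lborel (\<lambda>x. \<bar>E x * (h x - g x)\<bar>)"
        by (intro integrable_abs int continuous_intros h cg)
      show "integrable lborel (\<lambda>x. \<bar>E x\<bar> * e)" using E(1) by simp
      fix x
      show "\<bar>E x * (h x - g x)\<bar> \<le> \<bar>E x\<bar> * e"
        using g(2)[of x] E(2)[of x] by (cases "x \<in> {0..1/2}") (auto simp: abs_mult intro!: mult_left_mono)
    qed
    also have "\<dots> = ?I * e" by simp
    finally have "\<bar>LINT x|lborel. E x * h x\<bar> \<le> ?I * e" .
    moreover have "\<bar>LINT x|lborel. E x * h x\<bar> = (?I + 1) * e" using less_imp_neq[OF I0] unfolding e_def by simp
    ultimately show False using e by (simp add: algebra_simps)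
  qed
  have prim: "primitive E a = 0" for a
  proof -
    \<comment> \<open>Continuous approximations of the indicator of (-oo, a].\<close>
    define u where "u n x = max 0 (min 1 (1 - real n * (x - a)))" for n x
    have cu: "continuous_on UNIV (u n)" for n unfolding u_def by (intro continuous_intros)
    have "(\<lambda>n. LINT x|lborel. E x * u n x) \<longlonglongrightarrow> (LINT x|lborel. E x * indicator {..a} x)"
    proof (rule integral_dominated_convergence[where w = "\<lambda>x. \<bar>E x\<bar>"])
      show "(\<lambda>x. E x * u i x) \<in> borel_measurable lborel" for i
        using int[OF cu] by auto
      show "AE x in lborel. (\<lambda>i. E x * u i x) \<longlonglongrightarrow> E x * indicator {..a} x"
      proof (rule AE_I2, rule tendsto_mult_left)
        fix x
        show "(\<lambda>i. u i x) \<longlonglongrightarrow> indicator {..a} x"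
        proof (cases "x \<le> a")
          case True
          then have "real i * (x - a) \<le> 0" for i by (simp add: mult_nonneg_nonpos)
          then have "u i x = 1" for i by (simp add: u_def min_def)
          then show ?thesis using True by simp
        next
          case False
          obtain N where N: "real N * (x - a) \<ge> 1"
            by (metis False diff_gt_0_iff_gt ex_less_of_nat_mult less_eq_real_def not_le)
          have "\<forall>\<^sub>F i in sequentially. u i x = 0"
            using eventually_ge_at_top[of N]
          proof eventually_elim
            case (elim i)
            then have "real N * (x - a) \<le> real i * (x - a)" using False by (intro mult_right_mono) auto
            then show ?case using N by (simp add: u_def)
          qed
          then show ?thesis using False by (simp add: tendsto_eventually)
        qed
      qed
      show "AE x in lborel. norm (E x * u i x) \<le> \<bar>E x\<bar>" for i
        by (rule AE_I2) (auto simp: u_def abs_mult intro!: mult_left_le)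
    qed (use E in auto)
    then have "(LINT x|lborel. E x * indicator {..a} x) = 0"
      unfolding zero[OF cu] by (simp add: LIMSEQ_const_iff)
    then show ?thesis by (simp add: primitive_def set_lebesgue_integral_def mult.commute)
  qed
  show ?thesis
    using lebesgue_differentiation[OF E(1)]
  proof eventually_elim
    case (elim x)
    moreover have "primitive E = (\<lambda>y. 0)" using prim by auto
    ultimately have "((\<lambda>y. 0) has_real_derivative E x) (at x)" by simp
    then show ?case using DERIV_const DERIV_unique by blast
  qed
qed

section \<open>Integration on the circle\<close>

lemma space_circ: "space circ = {-1/2<..1/2}"
  by (simp add: circ_def space_restrict_space)

lemma prob_space_circ: "prob_space circ"
  by standard (simp add: circ_def space_restrict_space emeasure_restrict_space)

lemma integral_circ: "(LINT x|circ. f x) = (LINT x:{-1/2<..1/2}|lborel. f x)" for f :: "real \<Rightarrow> real"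
  by (simp add: circ_def integral_restrict_space set_lebesgue_integral_def)

lemma integrable_circ: "integrable circ f \<longleftrightarrow> set_integrable lborel {-1/2<..1/2} f" for f :: "real \<Rightarrow> real"
  by (simp add: circ_def integrable_restrict_space set_integrable_def)

lemma nn_integral_circ: "(\<integral>\<^sup>+x. f x \<partial>circ) = (\<integral>\<^sup>+x\<in>{-1/2<..1/2}. f x \<partial>lborel)"
  by (simp add: circ_def nn_integral_restrict_space)

lemma borel_measurable_circ: "f \<in> borel_measurable borel \<Longrightarrow> f \<in> borel_measurable circ"
  by (simp add: circ_def measurable_restrict_space1)

text \<open>
  The endpoint 1/2 is dropped to make the domain symmetric.
\<close>

lemma AE_circ_iff: "(AE x in circ. P x) \<longleftrightarrow> (AE x in lborel. x \<in> {-1/2<..<1/2} \<longrightarrow> P x)"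
proof -
  have "(AE x in circ. P x) \<longleftrightarrow> (AE x in lborel. x \<in> {-1/2<..1/2} \<longrightarrow> P x)"
    unfolding circ_def by (rule AE_restrict_space_iff) simp
  also have "\<dots> \<longleftrightarrow> (AE x in lborel. x \<in> {-1/2<..<1/2} \<longrightarrow> P x)"
  proof
    assume "AE x in lborel. x \<in> {-1/2<..<1/2} \<longrightarrow> P x"
    then show "AE x in lborel. x \<in> {-1/2<..1/2} \<longrightarrow> P x"
      using AE_lborel_singleton[of "1/2"] by eventually_elim auto
  next
    assume "AE x in lborel. x \<in> {-1/2<..1/2} \<longrightarrow> P x"
    then show "AE x in lborel. x \<in> {-1/2<..<1/2} \<longrightarrow> P x"
      by eventually_elim auto
  qed
  finally show ?thesis .
qed

lemma AE_circ_uminus: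
  assumes "AE x in circ. P x"
  shows "AE x in circ. P (- x)"
  using AE_lborel_uminus[OF assms[unfolded AE_circ_iff]] unfolding AE_circ_iff
  by eventually_elim auto

lemma L2_integrable_mult:
  assumes "f \<in> L2" "g \<in> L2"
  shows "integrable circ (\<lambda>x. f x * g x)"
proof (rule Bochner_Integration.integrable_bound)
  show "integrable circ (\<lambda>x. (f x)\<^sup>2 + (g x)\<^sup>2)"
    using assms by (auto simp: L2_def)
  show "(\<lambda>x. f x * g x) \<in> borel_measurable circ"
    using assms by (auto simp: L2_def)
  have "\<bar>a * b\<bar> \<le> a\<^sup>2 + b\<^sup>2" for a b :: real
  proof -
    have "2 * (\<bar>a\<bar> * \<bar>b\<bar>) \<le> a\<^sup>2 + b\<^sup>2" using sum_squares_bound[of "\<bar>a\<bar>" "\<bar>b\<bar>"] by simp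
    moreover have "0 \<le> \<bar>a\<bar> * \<bar>b\<bar>" by simp
    ultimately show ?thesis unfolding abs_mult by linarith
  qed
  then show "AE x in circ. norm (f x * g x) \<le> norm ((f x)\<^sup>2 + (g x)\<^sup>2)"
    by (intro AE_I2) (simp add: abs_of_nonneg)
qed

lemma continuous_L2:
  assumes "continuous_on UNIV f"
  shows "f \<in> L2"
proof -
  interpret circ: prob_space circ by (rule prob_space_circ)
  have [measurable]: "f \<in> borel_measurable circ"
    using assms by (intro borel_measurable_circ borel_measurable_continuous_onI)
  have "compact ((\<lambda>x. (f x)\<^sup>2) ` {-1/2..1/2})"
    using assms by (intro compact_continuous_image continuous_intros) (auto elim: continuous_on_subset)
  then obtain C where C: "\<And>x. x \<in> {-1/2..1/2} \<Longrightarrow> \<bar>(f x)\<^sup>2\<bar> \<le> C"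
    using compact_imp_bounded bounded_iff by (metis (no_types, lifting) imageI real_norm_def)
  have "integrable circ (\<lambda>x. (f x)\<^sup>2)"
    by (rule circ.integrable_const_bound[where B = C])
      (use C in \<open>auto simp: space_circ intro!: AE_I2\<close>)
  then show ?thesis by (simp add: L2_def)
qed

lemma L2_integrable: "f \<in> L2 \<Longrightarrow> integrable circ f"
  using L2_integrable_mult[of f "\<lambda>_. 1"] continuous_L2[of "\<lambda>_. 1"] by simp

lemma trig_differentiable:
  "((\<lambda>x. a * cos (c * x) + b * sin (c * x)) has_real_derivative (b * c) * cos (c * x) + (- a * c) * sin (c * x)) (at x)"
  by (auto intro!: derivative_eq_intros simp: algebra_simps)

text \<open>
  These are the only test functions needed to identify a function from its weak derivative.
\<close>

lemma smooth_periodic_trig: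
  "smooth_periodic (\<lambda>x. a * cosn k x + b * sinn k x)"
proof -
  let ?c = "2 * pi * real k"
  have trig: "\<exists>a' b'. (deriv ^^ n) (\<lambda>x. a * cos (?c * x) + b * sin (?c * x)) = (\<lambda>x. a' * cos (?c * x) + b' * sin (?c * x))" for n
  proof (induction n)
    case (Suc n)
    then obtain a' b' where "(deriv ^^ n) (\<lambda>x. a * cos (?c * x) + b * sin (?c * x)) = (\<lambda>x. a' * cos (?c * x) + b' * sin (?c * x))"
      by blast
    then have "(deriv ^^ Suc n) (\<lambda>x. a * cos (?c * x) + b * sin (?c * x)) = (\<lambda>x. (b' * ?c) * cos (?c * x) + (- a' * ?c) * sin (?c * x))"
      using ext[OF DERIV_imp_deriv[OF trig_differentiable[of a' ?c b']]] by simp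
    then show ?case by blast
  qed auto
  then have d: "(deriv ^^ n) (\<lambda>x. a * cos (?c * x) + b * sin (?c * x)) differentiable (at x)" for n x
  proof -
    obtain a' b' where "(deriv ^^ n) (\<lambda>x. a * cos (?c * x) + b * sin (?c * x)) = (\<lambda>x. a' * cos (?c * x) + b' * sin (?c * x))"
      using trig[of n] by blast
    then show ?thesis
      using trig_differentiable[of a' ?c b' x] unfolding real_differentiable_def by (intro exI) simp
  qed
  have "cos (?c * (x + 1)) = cos (?c * x)" "sin (?c * (x + 1)) = sin (?c * x)" for x
    using cos.plus_of_nat[of "?c * x" k] sin.plus_of_nat[of "?c * x" k] by (simp_all add: algebra_simps)
  with d show ?thesis unfolding smooth_periodic_def by simp
qed

lemma deriv_cos: "deriv (\<lambda>x. cosn k x) = (\<lambda>x. - (2 * pi * real k) * sinn k x)"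
  by (rule ext, rule DERIV_imp_deriv) (auto intro!: derivative_eq_intros)

lemma deriv_sin: "deriv (\<lambda>x. sinn k x) = (\<lambda>x. (2 * pi * real k) * cosn k x)"
  by (rule ext, rule DERIV_imp_deriv) (auto intro!: derivative_eq_intros)

lemma AE_circ_of_half:
  assumes "AE x in lborel. x \<in> {0<..<1/2} \<longrightarrow> P x \<and> P (- x)"
  shows "AE x in circ. P x"
  using assms AE_lborel_uminus[OF assms] AE_lborel_singleton[of 0] unfolding AE_circ_iff
proof eventually_elim
  case (elim x)
  then show ?case by (cases "x < 0") auto
qed

lemma AE_half_of_circ:
  assumes "AE x in circ. P x"
  shows "AE x in lborel. x \<in> {0<..<1/2} \<longrightarrow> P x \<and> P (- x)"
  using assms[unfolded AE_circ_iff] AE_lborel_uminus[OF assms[unfolded AE_circ_iff]]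
  by eventually_elim auto

lemma integral_circ_fold:
  fixes h :: "real \<Rightarrow> real"
  assumes h: "integrable circ h"
  shows "set_integrable lborel {0<..<1/2} (\<lambda>x. h x + h (- x))"
    and "(LINT x|circ. h x) = (LINT x:{0<..<1/2}|lborel. h x + h (- x))"
proof -
  define H where "H x = indicator {-1/2<..1/2} x * h x" for x
  have H: "integrable lborel H"
    using h unfolding integrable_circ set_integrable_def H_def by simp
  then have HS: "integrable lborel (\<lambda>x. indicator S x * H x)" if "S \<in> sets borel" for S
    using integrable_mult_indicator[of S lborel H] that by simp
  let ?p = "\<lambda>x. indicator {0<..<1/2} x * H x" and ?n = "\<lambda>x. indicator {-1/2<..<0} x * H x"
  have n: "integrable lborel (\<lambda>x. ?n (- x))"
    using lborel_integrable_real_affine[OF HS[of "{-1/2<..<0}"], of "-1" 0] by simp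
  have n2: "(LINT x|lborel. ?n (- x)) = (LINT x|lborel. ?n x)"
    using lborel_integral_real_affine[of "-1" ?n 0] by simp
  have eq: "indicator {0<..<1/2} x *\<^sub>R (h x + h (- x)) = ?p x + ?n (- x)" for x
    by (auto simp: indicator_def H_def)
  show "set_integrable lborel {0<..<1/2} (\<lambda>x. h x + h (- x))"
    unfolding set_integrable_def eq using HS[of "{0<..<1/2}"] n by simp
  have "(LINT x:{0<..<1/2}|lborel. h x + h (- x)) = (LINT x|lborel. ?p x) + (LINT x|lborel. ?n x)"
    unfolding set_lebesgue_integral_def eq using HS[of "{0<..<1/2}"] n n2 by simp
  also have "\<dots> = (LINT x|lborel. ?p x + ?n x)"
    using HS[of "{0<..<1/2}"] HS[of "{-1/2<..<0}"] by simp
  also have "\<dots> = (LINT x|lborel. H x)"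
  proof (rule integral_cong_AE)
    show "AE x in lborel. ?p x + ?n x = H x"
      using AE_lborel_singleton[of 0] AE_lborel_singleton[of "1/2"]
      by eventually_elim (auto simp: H_def indicator_def)
  qed (use H in auto)
  also have "\<dots> = (LINT x|circ. h x)"
    by (simp add: integral_circ set_lebesgue_integral_def H_def)
  finally show "(LINT x|circ. h x) = (LINT x:{0<..<1/2}|lborel. h x + h (- x))" by simp
qed

text \<open>
  Folding the circle at 0 turns the cosine coefficients of \<open>u\<close> into those of its even part on
  \<open>(0, 1/2)\<close>.
\<close>

lemma AE_odd_of_cosine_orthogonal:
  assumes u: "integrable circ u"
    and orth: "\<And>k::nat. (LINT x|circ. u x * cosn k x) = 0"
  shows "AE x in circ. u x + u (- x) = 0"
proof -
  define E where "E x = indicator {0<..<1/2} x * (u x + u (- x))" for x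
  have c: "integrable circ (\<lambda>x. u x * cosn k x)" for k
  proof (rule Bochner_Integration.integrable_bound[OF u])
    have "(\<lambda>x. cosn k x) \<in> borel_measurable circ"
      by (intro borel_measurable_circ) simp
    then show "(\<lambda>x. u x * cosn k x) \<in> borel_measurable circ"
      using u by auto
    show "AE x in circ. norm (u x * cosn k x) \<le> norm (u x)"
      by (intro AE_I2) (simp add: abs_mult mult_left_le)
  qed
  have "AE x in lborel. E x = 0"
  proof (rule AE_zero_of_cosine_orthogonal)
    show "integrable lborel E"
      using integral_circ_fold(1)[OF u] unfolding E_def set_integrable_def by simp
    show "(LINT x|lborel. E x * cosn k x) = 0" for k
      using integral_circ_fold(2)[OF c[of k]] orth[of k]
      by (simp add: E_def set_lebesgue_integral_def algebra_simps)
  qed (auto simp: E_def)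
  then have "AE x in lborel. x \<in> {0<..<1/2} \<longrightarrow> u x + u (- x) = 0 \<and> u (- x) + u (- (- x)) = 0"
    by eventually_elim (auto simp: E_def add.commute)
  then show ?thesis by (rule AE_circ_of_half)
qed

lemma integrable_half_indicator: "integrable lborel (indicator {0<..<1/2::real} :: real \<Rightarrow> real)"
proof -
  have "emeasure lborel {0<..<1/2::real} < \<infinity>"
    using ennreal_less_top[of "1/2"] by (subst emeasure_lborel_Ioo) (auto simp del: ennreal_less_top)
  then show ?thesis by (intro integrable_real_indicator) auto
qed

text \<open>
  Integration by parts for an absolutely continuous function, by Fubini's theorem on the triangle
  \<open>s \<le> y\<close>. The hypothesis on \<open>w\<close> makes the primitive vanish at 0, so that only the boundary term at 1/2 is left.
\<close>

lemma primitive_integral_deriv: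
  fixes \<phi> \<phi>' :: "real \<Rightarrow> real"
  assumes w: "integrable lborel w" "\<And>x. x \<notin> {0<..<1/2} \<Longrightarrow> w x = 0"
    and \<phi>: "\<And>x. (\<phi> has_real_derivative \<phi>' x) (at x)" "continuous_on UNIV \<phi>'"
  shows "(LINT y:{0<..<1/2}|lborel. primitive w y * \<phi>' y) = (LINT s|lborel. w s * (\<phi> (1/2) - \<phi> s))"
proof -
  have [measurable]: "w \<in> borel_measurable borel" "\<phi>' \<in> borel_measurable borel"
    using w(1) borel_measurable_continuous_onI[OF \<phi>(2)] by simp_all
  define I where "I y = indicator {0<..<1/2} y * \<phi>' y" for y :: real
  have I: "integrable lborel I"
    unfolding I_def by (rule integrable_mult_continuous_half[OF integrable_half_indicator _ \<phi>(2)]) auto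
  have [measurable]: "I \<in> borel_measurable borel" unfolding I_def by measurable
  have int: "integrable (lborel \<Otimes>\<^sub>M lborel) (\<lambda>(s, y). indicator {..y} s * w s * I y)"
  proof (rule Bochner_Integration.integrable_bound)
    show "integrable (lborel \<Otimes>\<^sub>M lborel) (\<lambda>(s, y). w s * I y)"
    proof (rule lborel_pair.Fubini_integrable)
      show "integrable lborel (\<lambda>s. LINT y|lborel. norm (case (s, y) of (s, y) \<Rightarrow> w s * I y))"
        using w(1) I by (simp add: abs_mult)
      show "AE s in lborel. integrable lborel (\<lambda>y. case (s, y) of (s, y) \<Rightarrow> w s * I y)"
        using I by simp
      show "(\<lambda>(s, y). w s * I y) \<in> borel_measurable (lborel \<Otimes>\<^sub>M lborel)"
        by simp
    qed
    have "(\<lambda>(s, y). (if s \<le> y then 1 else 0) * w s * I y) \<in> borel_measurable (lborel \<Otimes>\<^sub>M lborel)"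
      by measurable
    then show "(\<lambda>(s, y). indicator {..y} s * w s * I y) \<in> borel_measurable (lborel \<Otimes>\<^sub>M lborel)"
      by (simp add: indicator_def of_bool_def)
    show "AE x in lborel \<Otimes>\<^sub>M lborel. norm (case x of (s, y) \<Rightarrow> indicator {..y} s * w s * I y) \<le> norm (case x of (s, y) \<Rightarrow> w s * I y)"
      by (intro AE_I2) (auto simp: indicator_def)
  qed
  have "(LINT y:{0<..<1/2}|lborel. primitive w y * \<phi>' y) = (LINT y|lborel. LINT s|lborel. indicator {..y} s * w s * I y)"
  proof (unfold set_lebesgue_integral_def, rule Bochner_Integration.integral_cong[OF refl])
    fix y
    have "(LINT s|lborel. indicator {..y} s * w s * I y) = (LINT s|lborel. indicator {..y} s * w s) * I y"
      by (rule integral_mult_left_zero)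
    then show "indicator {0<..<1/2} y *\<^sub>R (primitive w y * \<phi>' y) = (LINT s|lborel. indicator {..y} s * w s * I y)"
      by (simp only: primitive_def set_lebesgue_integral_def I_def real_scaleR_def mult_ac)
  qed
  also have "\<dots> = (LINT s|lborel. LINT y|lborel. indicator {..y} s * w s * I y)"
    using lborel_pair.Fubini_integral[OF int] .
  also have "\<dots> = (LINT s|lborel. w s * (\<phi> (1/2) - \<phi> s))"
  proof (rule Bochner_Integration.integral_cong[OF refl])
    fix s
    show "(LINT y|lborel. indicator {..y} s * w s * I y) = w s * (\<phi> (1/2) - \<phi> s)"
    proof (cases "s \<in> {0<..<1/2}")
      case True
      have "(LINT y|lborel. indicator {..y} s * w s * I y) = w s * (LINT y|lborel. indicator {..y} s * I y)"
        using integral_mult_right_zero[of lborel "w s" "\<lambda>y. indicator {..y} s * I y"]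
        by (simp only: mult.assoc mult.left_commute)
      also have "(LINT y|lborel. indicator {..y} s * I y) = (LINT y|lborel. indicator {s..1/2} y *\<^sub>R \<phi>' y)"
      proof (rule integral_cong_AE)
        show "AE y in lborel. indicator {..y} s * I y = indicator {s..1/2} y *\<^sub>R \<phi>' y"
          using AE_lborel_singleton[of "1/2"] by eventually_elim (use True in \<open>auto simp: I_def indicator_def\<close>)
        have "(\<lambda>y. indicator {..y} s * I y) = (\<lambda>y. indicator {s..} y * I y)"
          by (auto simp: indicator_def)
        then show "(\<lambda>y. indicator {..y} s * I y) \<in> borel_measurable lborel" by simp
      qed simp
      also have "\<dots> = \<phi> (1/2) - \<phi> s"
      proof (rule integral_FTC_Icc)
        show "s \<le> 1/2" using True by simp
        show "(\<phi> has_vector_derivative \<phi>' x) (at x within {s..1/2})" for x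
          using has_vector_derivative_at_within[OF \<phi>(1)[of x, unfolded has_real_derivative_iff_has_vector_derivative]] .
        show "continuous_on {s..1/2} \<phi>'" by (rule continuous_on_subset[OF \<phi>(2)]) simp
      qed
      finally show ?thesis .
    next
      case False
      then have "w s = 0" by (rule w(2))
      then show ?thesis by simp
    qed
  qed
  finally show ?thesis .
qed

section \<open>Rearranged functions with a weak derivative\<close>

lemma AE_right_half_of_circ:
  assumes "AE x in circ. P x"
  shows "AE x in lborel. x \<in> {0<..<1/2} \<longrightarrow> P x"
  using AE_half_of_circ[OF assms] by eventually_elim simp

lemma AE_lborel_dense:
  assumes "AE x in lborel. P (x::real)" "a < b"
  obtains x where "a < x" "x < b" "P x"
proof -
  obtain N where N: "{x. \<not> P x} \<subseteq> N" "emeasure lborel N = 0" "N \<in> sets lborel"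
    using AE_E[OF assms(1)] by auto
  have "\<not> {a<..<b} \<subseteq> N"
  proof
    assume "{a<..<b} \<subseteq> N"
    then have "emeasure lborel {a<..<b} \<le> 0"
      using N emeasure_mono by metis
    then show False using assms(2) by simp
  qed
  then obtain x where "x \<in> {a<..<b}" "x \<notin> N" by blast
  moreover from \<open>x \<notin> N\<close> have "P x" using N(1) by blast
  ultimately show thesis using that by auto
qed

text \<open>
  The points of agreement are dense, and monotonicity passes to the limit along them.
\<close>

lemma mono_of_AE_mono:
  fixes W g :: "real \<Rightarrow> real"
  assumes W: "continuous_on UNIV W" and g: "mono_on {a<..<b} g"
    and ae: "AE x in lborel. x \<in> {a<..<b} \<longrightarrow> W x = g x"
    and xy: "a < x" "x < y" "y < b"
  shows "W x \<le> W y"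
proof -
  let ?e = "\<lambda>n. min (y - x) (b - y) / real (Suc n)"
  have e: "0 < ?e n" "?e n \<le> y - x" "?e n \<le> b - y" for n
  proof -
    have p: "0 < min (y - x) (b - y)" using xy by simp
    then show "0 < ?e n" by simp
    have "?e n \<le> min (y - x) (b - y) / 1"
      using p by (intro divide_left_mono) auto
    then show "?e n \<le> y - x" "?e n \<le> b - y" by auto
  qed
  have "\<exists>u. u \<in> {z<..<z + ?e n} \<and> (u \<in> {a<..<b} \<longrightarrow> W u = g u)" for z n
  proof -
    have "z < z + ?e n" using e(1)[of n] by simp
    from AE_lborel_dense[OF ae this] obtain u where "z < u" "u < z + ?e n" "u \<in> {a<..<b} \<longrightarrow> W u = g u" .
    then show ?thesis by (intro exI[of _ u]) simp
  qed
  then obtain u where u: "\<And>z n. u z n \<in> {z<..<z + ?e n}" "\<And>z n. u z n \<in> {a<..<b} \<Longrightarrow> W (u z n) = g (u z n)"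
    by metis
  have lim: "(\<lambda>n. u z n) \<longlonglongrightarrow> z" for z
  proof (rule tendsto_sandwich[of "\<lambda>_. z" _ _ "\<lambda>n. z + ?e n"])
    have "(\<lambda>n. z + ?e n) \<longlonglongrightarrow> z + 0"
      by (intro tendsto_add tendsto_const LIMSEQ_Suc[OF lim_const_over_n])
    then show "(\<lambda>n. z + ?e n) \<longlonglongrightarrow> z" by simp
  qed (use u in \<open>auto intro!: eventuallyI less_imp_le\<close>)
  have lim: "(\<lambda>n. W (u z n)) \<longlonglongrightarrow> W z" for z
    by (rule continuous_on_tendsto_compose[OF W lim]) auto
  have "W (u x n) \<le> W (u y n)" for n
  proof -
    have "u x n \<in> {a<..<b}" "u y n \<in> {a<..<b}" "u x n \<le> u y n"
      using u(1)[of x n] u(1)[of y n] e(2,3)[of n] xy by auto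
    then show ?thesis using u(2)[of x n] u(2)[of y n] monotone_onD[OF g, of "u x n" "u y n"] by simp
  qed
  then show ?thesis by (intro LIMSEQ_le[OF lim lim]) auto
qed

lemma cos_sin_L2: "(\<lambda>x. cos (c * x)) \<in> L2" "(\<lambda>x. sin (c * x)) \<in> L2"
  by (intro continuous_L2 continuous_intros)+

lemma ip_mult_right: "ip f (\<lambda>x. c * g x) = c * ip f g"
proof -
  have "ip f (\<lambda>x. c * g x) = (LINT x|circ. c * (f x * g x))"
    unfolding ip_def by (simp only: mult.left_commute)
  then show ?thesis by (simp add: ip_def)
qed

lemma ip_even_sin:
  assumes "f \<in> L2" "AE x in circ. f (- x) = f x"
  shows "ip f (\<lambda>x. sin (c * x)) = 0"
proof -
  have "(LINT x|lborel. indicator {0<..<1/2} x *\<^sub>R (f x * sin (c * x) + f (- x) * sin (c * - x))) = (LINT x|(lborel :: real measure). (0::real))"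
  proof (rule integral_cong_AE)
    show "AE x in lborel. indicator {0<..<1/2} x *\<^sub>R (f x * sin (c * x) + f (- x) * sin (c * - x)) = 0"
      using AE_right_half_of_circ[OF assms(2)] by eventually_elim (auto simp: indicator_def)
    show "(\<lambda>x. indicator {0<..<1/2} x *\<^sub>R (f x * sin (c * x) + f (- x) * sin (c * - x))) \<in> borel_measurable lborel"
      using integral_circ_fold(1)[OF L2_integrable_mult[OF assms(1) cos_sin_L2(2)[of c]]]
      unfolding set_integrable_def by (rule borel_measurable_integrable)
  qed simp
  then show ?thesis
    unfolding ip_def integral_circ_fold(2)[OF L2_integrable_mult[OF assms(1) cos_sin_L2(2)[of c]]]
      set_lebesgue_integral_def by simp
qed

lemma weak_deriv_trig: 
  assumes "has_weak_deriv f v"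
  shows "2 * pi * real k * ip f (\<lambda>x. sinn k x) = ip v (\<lambda>x. cosn k x)"
    "2 * pi * real k * ip f (\<lambda>x. cosn k x) = - ip v (\<lambda>x. sinn k x)"
proof -
  have s: "smooth_periodic (\<lambda>x. cosn k x)" "smooth_periodic (\<lambda>x. sinn k x)"
    using smooth_periodic_trig[of 1 k 0] smooth_periodic_trig[of 0 k 1] by simp_all
  have "ip f (deriv (\<lambda>x. cosn k x)) = - ip v (\<lambda>x. cosn k x)"
    using assms s(1) unfolding has_weak_deriv_def by blast
  then show "2 * pi * real k * ip f (\<lambda>x. sinn k x) = ip v (\<lambda>x. cosn k x)"
    unfolding deriv_cos ip_mult_right by simp
  have "ip f (deriv (\<lambda>x. sinn k x)) = - ip v (\<lambda>x. sinn k x)"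
    using assms s(2) unfolding has_weak_deriv_def by blast
  then show "2 * pi * real k * ip f (\<lambda>x. cosn k x) = - ip v (\<lambda>x. sinn k x)"
    unfolding deriv_sin ip_mult_right by simp
qed

text \<open>
  The test functions \<open>cos (2 * pi * k * x)\<close> have odd derivatives, against which an even function
  integrates to 0.
\<close>

lemma weak_deriv_odd:
  assumes "f \<in> L2" "AE x in circ. f (- x) = f x" "has_weak_deriv f v"
  shows "AE x in circ. v x + v (- x) = 0"
proof (rule AE_odd_of_cosine_orthogonal)
  show "integrable circ v" using assms(3) L2_integrable by (simp add: has_weak_deriv_def)
  show "(LINT x|circ. v x * cosn k x) = 0" for k
    using weak_deriv_trig(1)[OF assms(3), of k] ip_even_sin[OF assms(1,2), of "2 * pi * real k"]
    unfolding ip_def by simp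
qed

lemma set_integral_fold_even:
  fixes h :: "real \<Rightarrow> real"
  assumes h: "integrable circ h" and ev: "AE x in circ. h (- x) = h x"
  shows "set_integrable lborel {0<..<1/2} h" "(LINT x|circ. h x) = 2 * (LINT x:{0<..<1/2}|lborel. h x)"
proof -
  have "set_integrable lborel {-1/2<..1/2} h" using h by (simp add: integrable_circ)
  then show i: "set_integrable lborel {0<..<1/2} h"
    by (rule set_integrable_subset) auto
  have "(LINT x:{0<..<1/2}|lborel. h x + h (- x)) = (LINT x:{0<..<1/2}|lborel. 2 * h x)"
    unfolding set_lebesgue_integral_def
  proof (rule integral_cong_AE)
    show "AE x in lborel. indicator {0<..<1/2} x *\<^sub>R (h x + h (- x)) = indicator {0<..<1/2} x *\<^sub>R (2 * h x)"
      using AE_right_half_of_circ[OF ev] by eventually_elim (auto simp: indicator_def)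
    show "(\<lambda>x. indicator {0<..<1/2} x *\<^sub>R (h x + h (- x))) \<in> borel_measurable lborel"
      using integral_circ_fold(1)[OF h] unfolding set_integrable_def by (rule borel_measurable_integrable)
    have "set_integrable lborel {0<..<1/2} (\<lambda>x. 2 * h x)" using i by simp
    then show "(\<lambda>x. indicator {0<..<1/2} x *\<^sub>R (2 * h x)) \<in> borel_measurable lborel"
      unfolding set_integrable_def by (rule borel_measurable_integrable)
  qed
  then show "(LINT x|circ. h x) = 2 * (LINT x:{0<..<1/2}|lborel. h x)"
    using integral_circ_fold(2)[OF h] by simp
qed

lemma integral_half_cos:
  assumes "k > 0"
  shows "(LINT x|lborel. indicator {0<..<1/2} x * cosn k x) = 0"
proof -
  let ?c = "2 * pi * real k"
  have c: "?c > 0" using assms by simp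
  have "(LINT x|lborel. indicator {0<..<1/2} x * cos (?c * x)) = (LINT x|lborel. indicator {0..1/2} x *\<^sub>R cos (?c * x))"
  proof (rule integral_cong_AE)
    show "AE x in lborel. indicator {0<..<1/2} x * cos (?c * x) = indicator {0..1/2} x *\<^sub>R cos (?c * x)"
      using AE_lborel_singleton[of 0] AE_lborel_singleton[of "1/2"] by eventually_elim (auto simp: indicator_def)
  qed simp_all
  also have "\<dots> = sin (?c * (1/2)) / ?c - sin (?c * 0) / ?c"
  proof (rule integral_FTC_Icc)
    fix x
    have "((\<lambda>x. sin (?c * x) / ?c) has_real_derivative cos (?c * x)) (at x)"
      using assms by (auto intro!: derivative_eq_intros)
    then show "((\<lambda>x. sin (?c * x) / ?c) has_vector_derivative cos (?c * x)) (at x within {0..1/2})"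
      unfolding has_real_derivative_iff_has_vector_derivative by (rule has_vector_derivative_at_within)
  qed (auto intro!: continuous_intros)
  also have "?c * (1/2) = pi * real k" by simp
  also have "sin (pi * real k) = 0" using sin_npi[of k] by (simp add: mult.commute)
  finally show ?thesis by simp
qed

lemma U2_even: "f \<in> U2 \<Longrightarrow> AE x in circ. f (- x) = f x"
proof -
  assume "f \<in> U2"
  then obtain g where g: "AE x in circ. f x = g x" "\<forall>x\<in>{-1/2<..<1/2}. g (- x) = g x"
    by (auto simp: U2_def)
  have "AE x in circ. x \<in> {-1/2<..<1/2::real}" unfolding AE_circ_iff by simp
  then show ?thesis using g(1) AE_circ_uminus[OF g(1)]
  proof eventually_elim
    case (elim x)
    then show ?case using g(2) by simp
  qed
qed

text \<open>
  The du Bois-Reymond lemma. Both \<open>f\<close> and the primitive of \<open>v\<close> have the same cosine coefficients on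
  \<open>(0, 1/2)\<close> of every order \<open>k > 0\<close>: for \<open>f\<close> test with \<open>sin (2 * pi * k * x)\<close>, for the primitive integrate by
  parts, the boundary terms being zero. So they differ by a constant.
\<close>

lemma U2_half_profile:
  assumes f: "f \<in> U2" and v: "has_weak_deriv f v"
  shows "integrable lborel (\<lambda>x. indicator {0<..<1/2} x * v x)"
    and "\<exists>d. AE x in lborel. x \<in> {0<..<1/2} \<longrightarrow> f x = d + primitive (\<lambda>x. indicator {0<..<1/2} x * v x) x"
proof -
  have fL: "f \<in> L2" using f by (simp add: U2_def)
  have vL: "v \<in> L2" using v by (simp add: has_weak_deriv_def)
  note ev = U2_even[OF f]
  note odd = weak_deriv_odd[OF fL ev v]
  let ?H = "{0<..<1/2::real}"
  define w where "w x = indicator ?H x * v x" for x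
  have half: "set_integrable lborel ?H h" if "integrable circ h" for h :: "real \<Rightarrow> real"
  proof -
    have "set_integrable lborel {-1/2<..1/2} h" using that by (simp add: integrable_circ)
    then show ?thesis by (rule set_integrable_subset) auto
  qed
  have w: "integrable lborel w" "\<And>x. x \<notin> ?H \<Longrightarrow> w x = 0"
    using half[OF L2_integrable[OF vL]] unfolding w_def set_integrable_def by auto
  show "integrable lborel (\<lambda>x. indicator ?H x * v x)" using w(1) unfolding w_def .
  have If: "integrable lborel (\<lambda>x. indicator ?H x * f x)"
    using half[OF L2_integrable[OF fL]] unfolding set_integrable_def by simp
  have IW: "integrable lborel (\<lambda>x. indicator ?H x * primitive w x)"
    by (rule integrable_mult_continuous_half[OF integrable_half_indicator _ continuous_primitive[OF w(1)]]) auto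
  define F where "F x = indicator ?H x * f x - indicator ?H x * primitive w x" for x
  have IF: "integrable lborel F" unfolding F_def using If IW by simp
  \<comment> \<open>The mean of F over (0, 1/2), an interval of length 1/2.\<close>
  define d where "d = 2 * (LINT x|lborel. F x)"
  define E where "E x = F x - d * indicator ?H x" for x
  have IE: "integrable lborel E" unfolding E_def using IF integrable_half_indicator by simp
  have E0: "E x = 0" if "x \<notin> ?H" for x using that by (simp add: E_def F_def)
  have "AE x in lborel. E x = 0"
  proof (rule AE_zero_of_cosine_orthogonal[OF IE])
    show "E x = 0" if "x \<notin> {0..1/2}" for x by (rule E0) (use that in auto)
    fix k :: nat
    show "(LINT x|lborel. E x * cosn k x) = 0"
    proof (cases "k = 0")
      case True
      have "(LINT x|lborel. E x) = (LINT x|lborel. F x) - d * (LINT x|lborel. indicator ?H x)"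
        unfolding E_def using IF integrable_half_indicator by simp
      also have "(LINT x|lborel. indicator ?H x :: real) = 1/2" by simp
      finally show ?thesis using True by (simp add: d_def)
    next
      case False
      let ?c = "2 * pi * real k"
      have c: "?c > 0" using False by simp
      have ccos: "continuous_on UNIV (\<lambda>x. cos (?c * x))" by (intro continuous_intros)
      have IFc: "integrable lborel (\<lambda>x. F x * cos (?c * x))"
        by (rule integrable_mult_continuous_half[OF IF _ ccos]) (auto simp: F_def indicator_def)
      have Ihc: "integrable lborel (\<lambda>x. indicator ?H x * cos (?c * x))"
        by (rule integrable_mult_continuous_half[OF integrable_half_indicator _ ccos]) auto
      have 1: "(LINT x|lborel. E x * cos (?c * x)) = (LINT x|lborel. F x * cos (?c * x)) - d * (LINT x|lborel. indicator ?H x * cos (?c * x))"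
      proof -
        have "(LINT x|lborel. E x * cos (?c * x)) = (LINT x|lborel. F x * cos (?c * x) - d * (indicator ?H x * cos (?c * x)))"
          unfolding E_def by (simp add: algebra_simps)
        then show ?thesis using IFc Ihc by simp
      qed
      have "AE x in circ. f (- x) * cos (?c * - x) = f x * cos (?c * x)"
        using ev by eventually_elim simp
      then have 2: "ip f (\<lambda>x. cos (?c * x)) = 2 * (LINT x:?H|lborel. f x * cos (?c * x))"
        unfolding ip_def by (rule set_integral_fold_even(2)[OF L2_integrable_mult[OF fL cos_sin_L2(1)[of ?c]]])
      have "AE x in circ. v (- x) * sin (?c * - x) = v x * sin (?c * x)"
        using odd
      proof eventually_elim
        case (elim x)
        then have "v (- x) = - v x" by linarith
        then show ?case by simp
      qed
      then have 3: "ip v (\<lambda>x. sin (?c * x)) = 2 * (LINT x:?H|lborel. v x * sin (?c * x))"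
        unfolding ip_def by (rule set_integral_fold_even(2)[OF L2_integrable_mult[OF vL cos_sin_L2(2)[of ?c]]])
      have 4: "(LINT y:?H|lborel. primitive w y * (?c * cos (?c * y))) = (LINT s|lborel. w s * (sin (?c * (1/2)) - sin (?c * s)))"
        by (rule primitive_integral_deriv[OF w]) (auto intro!: derivative_eq_intros continuous_intros)
      have "sin (?c * (1/2)) = 0" using sin_npi[of k] by (simp add: mult.commute)
      then have "(LINT s|lborel. w s * (sin (?c * (1/2)) - sin (?c * s))) = (LINT s|lborel. - (indicator ?H s *\<^sub>R (v s * sin (?c * s))))"
        by (simp add: w_def mult.assoc)
      then have 5: "(LINT s|lborel. w s * (sin (?c * (1/2)) - sin (?c * s))) = - (LINT x:?H|lborel. v x * sin (?c * x))"
        by (simp add: set_lebesgue_integral_def)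
      have 6: "(LINT y:?H|lborel. primitive w y * (?c * cos (?c * y))) = ?c * (LINT y|lborel. indicator ?H y * primitive w y * cos (?c * y))"
      proof -
        have "(LINT y:?H|lborel. primitive w y * (?c * cos (?c * y))) = (LINT y|lborel. ?c * (indicator ?H y * primitive w y * cos (?c * y)))"
          unfolding set_lebesgue_integral_def by (intro Bochner_Integration.integral_cong) (simp_all only: real_scaleR_def mult_ac)
        then show ?thesis by (simp only: integral_mult_right_zero)
      qed
      have 7: "(LINT x|lborel. F x * cos (?c * x)) = (LINT x:?H|lborel. f x * cos (?c * x)) - (LINT y|lborel. indicator ?H y * primitive w y * cos (?c * y))"
      proof -
        have a: "integrable lborel (\<lambda>x. indicator ?H x * f x * cos (?c * x))"
          by (rule integrable_mult_continuous_half[OF If _ ccos]) auto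
        have b: "integrable lborel (\<lambda>x. indicator ?H x * primitive w x * cos (?c * x))"
          by (rule integrable_mult_continuous_half[OF IW _ ccos]) auto
        show ?thesis
          unfolding F_def set_lebesgue_integral_def left_diff_distrib Bochner_Integration.integral_diff[OF a b]
          by (simp add: mult.assoc)
      qed
      have "?c * (LINT x|lborel. F x * cos (?c * x)) = 0"
      proof -
        have "?c * (2 * (LINT x:?H|lborel. f x * cos (?c * x))) = - (2 * (LINT x:?H|lborel. v x * sin (?c * x)))"
          using weak_deriv_trig(2)[OF v, of k] unfolding 2 3 .
        moreover have "?c * (LINT y|lborel. indicator ?H y * primitive w y * cos (?c * y)) = - (LINT x:?H|lborel. v x * sin (?c * x))"
          using 4 5 6 by metis
        ultimately show ?thesis unfolding 7 by (simp only: right_diff_distrib)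
      qed
      then show ?thesis unfolding 1 using integral_half_cos[of k] False by simp
    qed
  qed
  then have "AE x in lborel. x \<in> ?H \<longrightarrow> f x = d + primitive w x"
    by eventually_elim (auto simp: E_def F_def)
  then show "\<exists>d. AE x in lborel. x \<in> ?H \<longrightarrow> f x = d + primitive (\<lambda>x. indicator ?H x * v x) x"
    unfolding w_def by blast
qed

lemma primitive_cong_AE:
  assumes "integrable lborel w" "integrable lborel w'" "AE x in lborel. w x = w' x"
  shows "primitive w = primitive w'"
proof
  fix y
  show "primitive w y = primitive w' y"
    unfolding primitive_def set_lebesgue_integral_def
  proof (rule integral_cong_AE)
    show "AE x in lborel. indicator {..y} x *\<^sub>R w x = indicator {..y} x *\<^sub>R w' x"
      using assms(3) by eventually_elim simp
  qed (use assms(1,2) in simp_all)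
qed

text \<open>
  Normal form of a rearranged function with a weak derivative. The primitive is continuous and equal
  almost everywhere to a monotone function, so it is monotone itself, and \<open>w\<close> may be taken non-negative.
\<close>

lemma U2_profile:
  assumes f: "f \<in> U2" and v: "has_weak_deriv f v"
  obtains w d where "integrable lborel w" "\<And>x. x \<notin> {0<..<1/2} \<Longrightarrow> w x = 0" "\<And>x. 0 \<le> w x"
    "AE x in circ. \<bar>v x\<bar> = w \<bar>x\<bar>" "AE x in circ. f x = d + primitive w \<bar>x\<bar>"
proof -
  let ?H = "{0<..<1/2::real}"
  define w0 where "w0 x = indicator ?H x * v x" for x
  obtain d where d: "AE x in lborel. x \<in> ?H \<longrightarrow> f x = d + primitive w0 x"
    using U2_half_profile(2)[OF f v] unfolding w0_def[abs_def] by blast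
  have w0: "integrable lborel w0" using U2_half_profile(1)[OF f v] unfolding w0_def[abs_def] .
  obtain g where g: "AE x in circ. f x = g x" "mono_on ?H g" using f by (auto simp: U2_def)
  have ev: "AE x in circ. f (- x) = f x" by (rule U2_even[OF f])
  have odd: "AE x in circ. v x + v (- x) = 0"
    using weak_deriv_odd[OF _ ev v] f by (simp add: U2_def)
  have "mono_on ?H (\<lambda>x. g x - d)" using g(2) by (auto simp: mono_on_def)
  moreover have "AE x in lborel. x \<in> ?H \<longrightarrow> primitive w0 x = g x - d"
    using d AE_right_half_of_circ[OF g(1)] by eventually_elim auto
  ultimately have mono: "primitive w0 x \<le> primitive w0 y" if "0 < x" "x < y" "y < 1/2" for x y
    using that by (rule mono_of_AE_mono[OF continuous_primitive[OF w0]])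
  have pos: "AE x in lborel. 0 \<le> w0 x"
    using lebesgue_differentiation[OF w0]
  proof eventually_elim
    case (elim x)
    show ?case
    proof (rule ccontr)
      assume n: "\<not> 0 \<le> w0 x"
      then have x: "x \<in> ?H" by (cases "x \<in> ?H") (simp_all add: w0_def)
      obtain e where e: "e > 0" "\<And>h. 0 < h \<Longrightarrow> h < e \<Longrightarrow> primitive w0 (x + h) < primitive w0 x"
        using DERIV_neg_dec_right[OF elim] n by auto
      define h where "h = min e (1/2 - x) / 2"
      have "h \<le> e / 2" "h \<le> (1/2 - x) / 2" "0 < h"
        using e(1) x unfolding h_def by (simp_all add: divide_right_mono)
      then have h: "0 < h" "h < e" "x + h < 1/2" using e(1) x by auto
      have "primitive w0 (x + h) < primitive w0 x" using e(2) h by blast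
      moreover have "primitive w0 x \<le> primitive w0 (x + h)" using mono[of x "x + h"] x h by simp
      ultimately show False by simp
    qed
  qed
  define w where "w x = max 0 (w0 x)" for x
  have w: "integrable lborel w"
  proof (rule Bochner_Integration.integrable_bound[OF w0])
    show "w \<in> borel_measurable lborel" unfolding w_def using w0 by simp
    show "AE x in lborel. norm (w x) \<le> norm (w0 x)" by (intro AE_I2) (simp add: w_def)
  qed
  have ww: "AE x in lborel. w x = w0 x" using pos by eventually_elim (simp add: w_def)
  have pw: "primitive w = primitive w0" by (rule primitive_cong_AE[OF w w0 ww])
  have "AE x in lborel. x \<in> ?H \<longrightarrow> \<bar>v x\<bar> = w \<bar>x\<bar> \<and> \<bar>v (- x)\<bar> = w \<bar>- x\<bar>"
    using AE_right_half_of_circ[OF odd] pos ww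
  proof eventually_elim
    case (elim x)
    show ?case
    proof
      assume x: "x \<in> ?H"
      then have "w0 x = v x" "\<bar>x\<bar> = x" by (auto simp: w0_def)
      moreover have "v (- x) = - v x" using elim(1) x by linarith
      ultimately show "\<bar>v x\<bar> = w \<bar>x\<bar> \<and> \<bar>v (- x)\<bar> = w \<bar>- x\<bar>" using elim by simp
    qed
  qed
  then have 1: "AE x in circ. \<bar>v x\<bar> = w \<bar>x\<bar>" by (rule AE_circ_of_half)
  have "AE x in lborel. x \<in> ?H \<longrightarrow> f x = d + primitive w \<bar>x\<bar> \<and> f (- x) = d + primitive w \<bar>- x\<bar>"
    using AE_right_half_of_circ[OF ev] d unfolding pw by eventually_elim auto
  then have 2: "AE x in circ. f x = d + primitive w \<bar>x\<bar>" by (rule AE_circ_of_half)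
  show thesis
  proof (rule that[of w d])
    show "w x = 0" if "x \<notin> ?H" for x using that by (simp add: w_def w0_def)
    show "0 \<le> w x" for x by (simp add: w_def)
  qed (fact w, fact 1, fact 2)
qed

section \<open>Change of variables along a profile\<close>

lemma nn_integral_circ_even:
  fixes h :: "real \<Rightarrow> ennreal"
  assumes [measurable]: "h \<in> borel_measurable borel"
  shows "(\<integral>\<^sup>+x. h \<bar>x\<bar> \<partial>circ) = 2 * (\<integral>\<^sup>+x\<in>{0<..<1/2}. h x \<partial>lborel)"
proof -
  let ?p = "\<lambda>x. h x * indicator {0<..<1/2} x" and ?n = "\<lambda>x. h (- x) * indicator {-1/2<..<0} x"
  have "(\<integral>\<^sup>+x. h \<bar>x\<bar> \<partial>circ) = (\<integral>\<^sup>+x. ?p x + ?n x \<partial>lborel)"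
    unfolding nn_integral_circ
  proof (rule nn_integral_cong_AE)
    show "AE x in lborel. h \<bar>x\<bar> * indicator {-1/2<..1/2} x = ?p x + ?n x"
      using AE_lborel_singleton[of 0] AE_lborel_singleton[of "1/2"]
    proof eventually_elim
      case (elim x)
      then show ?case by (cases "x > 0") (auto simp: indicator_def)
    qed
  qed
  also have "\<dots> = (\<integral>\<^sup>+x. ?p x \<partial>lborel) + (\<integral>\<^sup>+x. ?n x \<partial>lborel)"
    by (rule nn_integral_add) simp_all
  also have "(\<integral>\<^sup>+x. ?n x \<partial>lborel) = (\<integral>\<^sup>+x. ?n (- x) \<partial>lborel)"
    using nn_integral_real_affine[of ?n "-1" 0] by simp
  also have "(\<lambda>x. ?n (- x)) = ?p"
    by (auto simp: indicator_def fun_eq_iff)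
  finally show ?thesis by (simp add: mult_2)
qed

lemma continuous_zero_of_AE:
  fixes u :: "real \<Rightarrow> real"
  assumes u: "continuous_on UNIV u" and ae: "AE x in lborel. x \<in> {a<..<b} \<longrightarrow> u x = 0"
    and z: "z \<in> {a..b}" "a < b"
  shows "u z = 0"
proof -
  have "closed {x. u x = 0}"
    using continuous_closed_preimage_constant[OF u closed_UNIV, of 0] by simp
  moreover have "z \<in> closure {x. u x = 0}"
    unfolding closure_approachable
  proof (intro allI impI)
    fix e :: real assume e: "e > 0"
    have "\<exists>c d. c < d \<and> {c<..<d} \<subseteq> {a<..<b} \<inter> {z - e<..<z + e}"
    proof (cases "z < b")
      case True
      then show ?thesis using z e by (intro exI[of _ z] exI[of _ "min b (z + e)"]) auto
    next
      case False
      then show ?thesis using z e by (intro exI[of _ "max a (z - e)"] exI[of _ z]) auto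
    qed
    then obtain c d where cd: "c < d" "{c<..<d} \<subseteq> {a<..<b} \<inter> {z - e<..<z + e}" by blast
    obtain y where y: "c < y" "y < d" "y \<in> {a<..<b} \<longrightarrow> u y = 0"
      by (rule AE_lborel_dense[OF ae cd(1)])
    then have "y \<in> {a<..<b} \<inter> {z - e<..<z + e}" using cd(2) by auto
    then show "\<exists>y\<in>{x. u x = 0}. dist y z < e"
      using y(3) by (intro bexI[of _ y]) (auto simp: dist_real_def)
  qed
  ultimately show ?thesis by simp
qed

text \<open>
  The normal form in \<open>U2_profile\<close>. Extending \<open>w\<close> by 0 makes \<open>G\<close> monotone on the whole line and
  constant outside of \<open>[0, 1/2]\<close>, so that no restriction to intervals is needed below.
\<close>

locale profile =
  fixes w :: "real \<Rightarrow> real" and d :: real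
  assumes w_int: "integrable lborel w"
    and w_zero: "\<And>x. x \<notin> {0<..<1/2} \<Longrightarrow> w x = 0"
    and w_nonneg: "\<And>x. 0 \<le> w x"
begin

definition G :: "real \<Rightarrow> real" where "G y = d + primitive w y"

lemma w_measurable [measurable]: "w \<in> borel_measurable borel"
  using w_int by simp

lemma continuous_G: "continuous_on A G"
  unfolding G_def by (intro continuous_intros continuous_primitive[OF w_int])

lemma G_measurable [measurable]: "G \<in> borel_measurable borel"
  by (rule borel_measurable_continuous_onI[OF continuous_G])

lemma G_diff: "a \<le> b \<Longrightarrow> G b - G a = (LINT s:{a<..b}|lborel. w s)"
  using primitive_diff[OF w_int, of a b] by (simp add: G_def)

lemma mono_G: "a \<le> b \<Longrightarrow> G a \<le> G b"
proof -
  assume "a \<le> b"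
  have "0 \<le> (LINT s:{a<..b}|lborel. w s)"
    unfolding set_lebesgue_integral_def by (intro Bochner_Integration.integral_nonneg) (simp add: w_nonneg)
  then show ?thesis using G_diff[OF \<open>a \<le> b\<close>] by simp
qed

lemma nn_integral_w: "a \<le> b \<Longrightarrow> (\<integral>\<^sup>+s\<in>{a<..b}. ennreal (w s) \<partial>lborel) = ennreal (G b - G a)"
proof -
  assume "a \<le> b"
  have "integrable lborel (\<lambda>s. indicator {a<..b} s *\<^sub>R w s)"
    using w_int by (intro integrable_mult_indicator) auto
  then have "(\<integral>\<^sup>+s. ennreal (indicator {a<..b} s *\<^sub>R w s) \<partial>lborel) = ennreal (G b - G a)"
    unfolding G_diff[OF \<open>a \<le> b\<close>] set_lebesgue_integral_def
    by (rule nn_integral_eq_integral) (simp add: w_nonneg)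
  moreover have "ennreal (indicator {a<..b} s *\<^sub>R w s) = ennreal (w s) * indicator {a<..b} s" for s
    by (simp add: indicator_def)
  ultimately show ?thesis by simp
qed

lemma G_derivative: "AE x in lborel. (G has_real_derivative w x) (at x)"
  using lebesgue_differentiation[OF w_int]
proof eventually_elim
  case (elim x)
  then show ?case unfolding G_def[abs_def] using DERIV_add[OF DERIV_const elim] by simp
qed

lemma G_right: "1/2 \<le> y \<Longrightarrow> G y = G (1/2)"
proof -
  assume y: "1/2 \<le> y"
  have "indicator {1/2<..y} s *\<^sub>R w s = 0" for s
    using w_zero[of s] by (auto simp: indicator_def)
  then have "(LINT s:{1/2<..y}|lborel. w s) = 0" by (simp only: set_lebesgue_integral_def integral_zero)
  then show ?thesis using G_diff[OF y] by simp
qed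

end

locale positive_profile = profile +
  assumes w_pos: "AE x in lborel. x \<in> {0<..<1/2} \<longrightarrow> 0 < w x"
begin

lemma strict_G: 
  assumes "0 \<le> a" "a < b" "a < 1/2"
  shows "G a < G b"
proof -
  define c where "c = min b (1/2)"
  have c: "a < c" "c \<le> 1/2" "c \<le> b" using assms by (auto simp: c_def)
  have "0 < (LINT s:{a<..c}|lborel. w s)"
  proof -
    have i: "integrable lborel (\<lambda>s. indicator {a<..c} s *\<^sub>R w s)"
      using w_int by (intro integrable_mult_indicator) auto
    have "(LINT s:{a<..c}|lborel. w s) \<noteq> 0"
    proof
      assume "(LINT s:{a<..c}|lborel. w s) = 0"
      then have "AE s in lborel. indicator {a<..c} s *\<^sub>R w s = 0"
        using integral_nonneg_eq_0_iff_AE[OF i] by (simp add: set_lebesgue_integral_def w_nonneg)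
      with w_pos have ae: "AE s in lborel. s \<in> {a<..<c} \<longrightarrow> False"
        by eventually_elim (use assms c in \<open>auto simp: indicator_def\<close>)
      obtain s where "a < s" "s < c" "s \<in> {a<..<c} \<longrightarrow> False"
        by (rule AE_lborel_dense[OF ae c(1)])
      then show False by simp
    qed
    moreover have "0 \<le> (LINT s:{a<..c}|lborel. w s)"
      unfolding set_lebesgue_integral_def by (intro Bochner_Integration.integral_nonneg) (simp add: w_nonneg)
    ultimately show ?thesis by simp
  qed
  then have "G a < G c" using G_diff[of a c] c by simp
  also have "G c \<le> G b" by (rule mono_G[OF c(3)])
  finally show ?thesis .
qed

lemma G_less_iff: "y \<in> {0..<1/2} \<Longrightarrow> G y < G x \<longleftrightarrow> y < x"
  using strict_G[of y x] mono_G[of x y] by (cases "y < x") auto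

lemma G_le_iff: "y \<in> {0..<1/2} \<Longrightarrow> G x \<le> G y \<longleftrightarrow> x \<le> y"
  using G_less_iff[of y x] by (simp add: not_less[symmetric])

abbreviation "J \<equiv> {G 0<..<G (1/2)}"

lemma G_surj:
  assumes "z \<in> {G 0..<G (1/2)}"
  obtains y where "y \<in> {0..<1/2}" "G y = z"
proof -
  obtain y where "0 \<le> y" "y \<le> 1/2" "G y = z"
    using IVT'[of G 0 z "1/2"] assms continuous_G by auto
  moreover have "y \<noteq> 1/2"
  proof
    assume y: "y = 1/2"
    have "G (1/2) = z" using \<open>G y = z\<close> unfolding y .
    then show False using assms by simp
  qed
  ultimately show thesis using that[of y] by simp
qed

lemma G_in_J: "x \<in> {0<..<1/2} \<Longrightarrow> G x \<in> J"
  using strict_G[of 0 x] strict_G[of x "1/2"] by auto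

text \<open>
  It suffices to compare the masses of half-lines. If \<open>z = G y\<close>, the set where \<open>G > z\<close> is \<open>(y, \<infinity>)\<close> by strict
  monotonicity, and \<open>w\<close> has mass \<open>G (1/2) - G y\<close> there.
\<close>

lemma distr_density_G: "distr (density lborel (\<lambda>x. ennreal (w x))) borel G = density lborel (indicator J)"
proof (rule measure_eqI_lessThan)
  let ?D = "distr (density lborel (\<lambda>x. ennreal (w x))) borel G"
  fix z
  let ?I = "\<integral>\<^sup>+x. ennreal (w x) * indicator {z<..} (G x) \<partial>lborel"
  have e: "emeasure ?D {z<..} = ?I"
  proof -
    have "emeasure ?D {z<..} = (\<integral>\<^sup>+x. ennreal (w x) * indicator (G -` {z<..}) x \<partial>lborel)"
      using measurable_sets_borel[OF G_measurable, of "{z<..}"] by (simp add: emeasure_distr emeasure_density)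
    then show ?thesis by (simp add: indicator_vimage)
  qed
  have r: "emeasure (density lborel (indicator J)) {z<..} = emeasure lborel (J \<inter> {z<..})"
    by (simp add: emeasure_density indicator_inter_arith[symmetric])
  have w': "ennreal (w x) = ennreal (w x) * indicator {0<..1/2} x" for x
    using w_zero[of x] by (auto simp: indicator_def)
  have "emeasure ?D {z<..} = emeasure lborel (J \<inter> {z<..}) \<and> emeasure lborel (J \<inter> {z<..}) < \<infinity>"
  proof (cases "z < G 0")
    case True
    have "?I = (\<integral>\<^sup>+x\<in>{0<..1/2}. ennreal (w x) \<partial>lborel)"
    proof (rule nn_integral_cong)
      fix x
      show "ennreal (w x) * indicator {z<..} (G x) = ennreal (w x) * indicator {0<..1/2} x"
        using True mono_G[of 0 x] w_zero[of x] by (cases "x \<in> {0<..<1/2}") (auto simp: indicator_def)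
    qed
    moreover have "J \<inter> {z<..} = J" using True by auto
    ultimately show ?thesis using e nn_integral_w[of 0 "1/2"] mono_G[of 0 "1/2"] by simp
  next
    case F: False
    show ?thesis
    proof (cases "z < G (1/2)")
      case True
      with F obtain y where y: "y \<in> {0..<1/2}" "G y = z" using G_surj[of z] by auto
      have "?I = (\<integral>\<^sup>+x\<in>{y<..1/2}. ennreal (w x) \<partial>lborel)"
      proof (rule nn_integral_cong)
        fix x
        show "ennreal (w x) * indicator {z<..} (G x) = ennreal (w x) * indicator {y<..1/2} x"
          using G_less_iff[OF y(1), of x] w_zero[of x] y(2) by (cases "x \<in> {0<..<1/2}") (auto simp: indicator_def)
      qed
      moreover have "J \<inter> {z<..} = {z<..<G (1/2)}" using F by auto
      ultimately show ?thesis using e nn_integral_w[of y "1/2"] y True by simp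
    next
      case False
      have "G x \<le> z" for x
        using False mono_G[of x "1/2"] G_right[of x] by (cases "x \<le> 1/2") auto
      then have "\<And>x. indicator {z<..} (G x) = (0 :: ennreal)" by (simp add: indicator_def not_less)
      then have "?I = 0" by simp
      moreover have "J \<inter> {z<..} = {}" using False by auto
      ultimately show ?thesis using e by simp
    qed
  qed
  then show "emeasure ?D {z<..} = emeasure (density lborel (indicator J)) {z<..}"
    "emeasure ?D {z<..} < \<infinity>"
    unfolding r by auto
qed auto

lemma nn_integral_change_of_variables:
  assumes [measurable]: "h \<in> borel_measurable borel"
  shows "(\<integral>\<^sup>+z\<in>J. h z \<partial>lborel) = (\<integral>\<^sup>+x. ennreal (w x) * h (G x) \<partial>lborel)"
proof -
  have "(\<integral>\<^sup>+z\<in>J. h z \<partial>lborel) = (\<integral>\<^sup>+z. h z \<partial>density lborel (indicator J))"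
    by (simp add: nn_integral_density mult.commute)
  also have "\<dots> = (\<integral>\<^sup>+x. h (G x) \<partial>density lborel (\<lambda>x. ennreal (w x)))"
    unfolding distr_density_G[symmetric] by (simp add: nn_integral_distr)
  also have "\<dots> = (\<integral>\<^sup>+x. ennreal (w x) * h (G x) \<partial>lborel)"
    by (simp add: nn_integral_density)
  finally show ?thesis .
qed

end

section \<open>The law of a profile\<close>

locale profile_of = positive_profile +
  fixes f :: "real \<Rightarrow> real"
  assumes f_L2: "f \<in> L2" and f_G: "AE x in circ. f x = G \<bar>x\<bar>"
begin

lemma f_measurable [measurable]: "f \<in> borel_measurable circ"
  using f_L2 by (simp add: L2_def)

lemma real_distribution_law: "real_distribution (law f)"
proof -
  interpret circ: prob_space circ by (rule prob_space_circ)
  show ?thesis unfolding law_def by (rule circ.real_distribution_distr) simp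
qed

lemma nn_integral_law:
  assumes [measurable]: "h \<in> borel_measurable borel"
  shows "(\<integral>\<^sup>+z. h z \<partial>law f) = 2 * (\<integral>\<^sup>+x\<in>{0<..<1/2}. h (G x) \<partial>lborel)"
proof -
  have "(\<integral>\<^sup>+z. h z \<partial>law f) = (\<integral>\<^sup>+x. h (f x) \<partial>circ)"
    by (simp add: law_def nn_integral_distr)
  also have "\<dots> = (\<integral>\<^sup>+x. h (G \<bar>x\<bar>) \<partial>circ)"
    by (rule nn_integral_cong_AE) (use f_G in eventually_elim, simp)
  also have "\<dots> = 2 * (\<integral>\<^sup>+x\<in>{0<..<1/2}. h (G x) \<partial>lborel)"
    by (rule nn_integral_circ_even) simp
  finally show ?thesis .
qed

text \<open>
  The inverse of \<open>G\<close> on \<open>J\<close>. Defining it from the distribution function gives its measurability from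
  monotonicity.
\<close>

definition half_cdf :: "real \<Rightarrow> real" where "half_cdf z = cdf (law f) z / 2"

lemma half_cdf_G: 
  assumes y: "y \<in> {0..1/2}"
  shows "half_cdf (G y) = y"
proof -
  have "emeasure (law f) {..G y} = (\<integral>\<^sup>+z. indicator {..G y} z \<partial>law f)"
    by (simp add: law_def)
  also have "\<dots> = 2 * (\<integral>\<^sup>+x\<in>{0<..<1/2}. indicator {..G y} (G x) \<partial>lborel)"
    by (rule nn_integral_law) simp
  also have "(\<integral>\<^sup>+x\<in>{0<..<1/2}. indicator {..G y} (G x) \<partial>lborel) = (\<integral>\<^sup>+x. indicator {0<..y} x \<partial>lborel)"
  proof (rule nn_integral_cong_AE)
    show "AE x in lborel. indicator {..G y} (G x) * indicator {0<..<1/2} x = (indicator {0<..y} x :: ennreal)"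
      using AE_lborel_singleton[of "1/2"]
    proof eventually_elim
      case (elim x)
      show ?case
      proof (cases "y = 1/2")
        case True
        then show ?thesis using mono_G[of x y] elim by (auto simp: indicator_def)
      next
        case False
        then show ?thesis using G_le_iff[of y x] y elim by (auto simp: indicator_def)
      qed
    qed
  qed
  also have "\<dots> = ennreal y" using y by simp
  also have "2 * ennreal y = ennreal (2 * y)" using y by (simp add: ennreal_mult)
  finally have "measure (law f) {..G y} = 2 * y" using y by (simp add: measure_def)
  then show ?thesis by (simp add: half_cdf_def cdf_def)
qed

lemma half_cdf_in:
  assumes "z \<in> J" shows "half_cdf z \<in> {0<..<1/2}" "G (half_cdf z) = z"
proof -
  obtain y where y: "y \<in> {0..<1/2}" "G y = z" using G_surj[of z] assms by auto
  have "half_cdf z = y" using half_cdf_G[of y] y by auto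
  moreover have "y \<noteq> 0" using y assms by auto
  ultimately show "half_cdf z \<in> {0<..<1/2}" "G (half_cdf z) = z" using y by auto
qed

lemma half_cdf_measurable [measurable]: "half_cdf \<in> borel_measurable borel"
proof (rule borel_measurable_mono, rule monoI)
  interpret real_distribution "law f" by (rule real_distribution_law)
  show "half_cdf x \<le> half_cdf y" if "x \<le> y" for x y
    using cdf_nondecreasing[OF that] by (simp add: half_cdf_def)
qed

text \<open>
  Null sets of positions become null sets of levels, since the transported measure has a density with
  respect to Lebesgue measure.
\<close>

lemma AE_J_of_AE_half:
  assumes "AE x in lborel. x \<in> {0<..<1/2} \<longrightarrow> P x"
  shows "AE z in lborel. z \<in> J \<longrightarrow> P (half_cdf z)"
proof -
  obtain N where N: "{x. \<not> (x \<in> {0<..<1/2} \<longrightarrow> P x)} \<subseteq> N" "emeasure lborel N = 0" "N \<in> sets lborel"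
    using AE_E[OF assms] by auto
  have [measurable]: "N \<in> sets borel" using N(3) by simp
  have "(\<integral>\<^sup>+z\<in>J. indicator N (half_cdf z) \<partial>lborel) = (\<integral>\<^sup>+x. ennreal (w x) * indicator N (half_cdf (G x)) \<partial>lborel)"
    by (rule nn_integral_change_of_variables) simp
  also have "\<dots> = (\<integral>\<^sup>+x. 0 \<partial>(lborel :: real measure))"
  proof (rule nn_integral_cong_AE)
    have "AE x in lborel. x \<notin> N" using N by (intro AE_not_in) (simp add: null_sets_def)
    then show "AE x in lborel. ennreal (w x) * indicator N (half_cdf (G x)) = 0"
    proof eventually_elim
      case (elim x)
      show ?case using w_zero[of x] half_cdf_G[of x] elim by (cases "x \<in> {0<..<1/2}") auto
    qed
  qed
  finally have "(\<integral>\<^sup>+z\<in>J. indicator N (half_cdf z) \<partial>lborel) = 0" by simp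
  then have "AE z in lborel. indicator N (half_cdf z) * indicator J z = (0 :: ennreal)"
    by (subst (asm) nn_integral_0_iff_AE) simp_all
  then show ?thesis
  proof eventually_elim
    case (elim z)
    then show ?case using N(1) half_cdf_in(1)[of z] by (auto simp: indicator_def split: if_splits)
  qed
qed

definition q :: "real \<Rightarrow> real" where "q z = indicator J z * (2 / w (half_cdf z))"

lemma q_measurable [measurable]: "q \<in> borel_measurable borel"
  unfolding q_def by measurable

lemma q_nonneg: "0 \<le> q z"
  by (simp add: q_def w_nonneg)

lemma nn_integral_half_density:
  fixes h :: "real \<Rightarrow> ennreal"
  assumes [measurable]: "h \<in> borel_measurable borel"
  shows "(\<integral>\<^sup>+z\<in>J. h (half_cdf z) \<partial>lborel) = (\<integral>\<^sup>+x\<in>{0<..<1/2}. ennreal (w x) * h x \<partial>lborel)"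
proof -
  have "(\<integral>\<^sup>+z\<in>J. h (half_cdf z) \<partial>lborel) = (\<integral>\<^sup>+x. ennreal (w x) * h (half_cdf (G x)) \<partial>lborel)"
    by (rule nn_integral_change_of_variables) simp
  also have "\<dots> = (\<integral>\<^sup>+x\<in>{0<..<1/2}. ennreal (w x) * h x \<partial>lborel)"
  proof (rule nn_integral_cong)
    fix x
    show "ennreal (w x) * h (half_cdf (G x)) = ennreal (w x) * h x * indicator {0<..<1/2} x"
      using w_zero[of x] half_cdf_G[of x] by (cases "x \<in> {0<..<1/2}") auto
  qed
  finally show ?thesis .
qed

text \<open>
  The law is the image of \<open>2 dx\<close> on \<open>(0, 1/2)\<close>, and \<open>2 dx = q (G x) * w x dx\<close>.
\<close>

lemma law_eq_density: "law f = density lborel (\<lambda>z. ennreal (q z))"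
proof (rule measure_eqI)
  show "sets (law f) = sets (density lborel (\<lambda>z. ennreal (q z)))" by (simp add: law_def)
  fix A assume "A \<in> sets (law f)"
  then have [measurable]: "A \<in> sets borel" by (simp add: law_def)
  have "emeasure (law f) A = (\<integral>\<^sup>+z. indicator A z \<partial>law f)" by (simp add: law_def)
  also have "\<dots> = 2 * (\<integral>\<^sup>+x\<in>{0<..<1/2}. indicator A (G x) \<partial>lborel)"
    by (rule nn_integral_law) simp
  also have "\<dots> = (\<integral>\<^sup>+x\<in>{0<..<1/2}. 2 * indicator A (G x) \<partial>lborel)"
    by (simp add: nn_integral_cmult[symmetric] mult.assoc)
  also have "\<dots> = (\<integral>\<^sup>+x. ennreal (w x) * (ennreal (q (G x)) * indicator A (G x)) \<partial>lborel)"
  proof (rule nn_integral_cong_AE)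
    show "AE x in lborel. 2 * indicator A (G x) * indicator {0<..<1/2} x = ennreal (w x) * (ennreal (q (G x)) * indicator A (G x))"
      using w_pos
    proof eventually_elim
      case (elim x)
      show ?case
      proof (cases "x \<in> {0<..<1/2}")
        case True
        then have "w x > 0" "half_cdf (G x) = x" "G x \<in> J" using elim half_cdf_G[of x] G_in_J[of x] by auto
        then have "ennreal (w x) * ennreal (q (G x)) = 2"
          by (simp add: q_def ennreal_mult[symmetric])
        then show ?thesis using True by (simp add: mult.assoc[symmetric])
      qed (simp add: w_zero)
    qed
  qed
  also have "\<dots> = (\<integral>\<^sup>+z\<in>J. ennreal (q z) * indicator A z \<partial>lborel)"
    by (rule nn_integral_change_of_variables[symmetric]) simp
  also have "\<dots> = (\<integral>\<^sup>+z. ennreal (q z) * indicator A z \<partial>lborel)"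
    by (rule nn_integral_cong) (auto simp: q_def indicator_def)
  also have "\<dots> = emeasure (density lborel (\<lambda>z. ennreal (q z))) A"
    by (simp add: emeasure_density)
  finally show "emeasure (law f) A = emeasure (density lborel (\<lambda>z. ennreal (q z))) A" .
qed

lemma dens_law: "AE z in lborel. dens (law f) z = q z"
proof -
  have "AE z in lborel. ennreal (q z) = RN_deriv lborel (law f) z"
    by (rule sigma_finite_measure.RN_deriv_unique[OF sigma_finite_lborel]) (auto simp: law_eq_density)
  then show ?thesis
  proof eventually_elim
    case (elim z)
    then show ?case unfolding dens_def elim[symmetric] by (simp add: q_nonneg)
  qed
qed

lemma dens_measurable [measurable]: "dens (law f) \<in> borel_measurable borel"
  unfolding dens_def[abs_def] by measurable

lemma law_density_dens: "law f = density lborel (\<lambda>z. ennreal (dens (law f) z))"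
proof -
  have "density lborel (\<lambda>z. ennreal (q z)) = density lborel (\<lambda>z. ennreal (dens (law f) z))"
    by (rule density_cong) (use dens_law in \<open>auto elim: eventually_mono\<close>)
  then show ?thesis using law_eq_density by simp
qed

lemma w_half_cdf_pos: "AE z in lborel. z \<in> J \<longrightarrow> 0 < w (half_cdf z)"
  by (rule AE_J_of_AE_half[OF w_pos])

lemma nn_integral_dens_sq:
  "(\<integral>\<^sup>+z. ennreal ((dens (law f) z)\<^sup>2) \<partial>lborel) = 4 * (\<integral>\<^sup>+x\<in>{0<..<1/2}. 1 / ennreal (w x) \<partial>lborel)"
proof -
  have "(\<integral>\<^sup>+z. ennreal ((dens (law f) z)\<^sup>2) \<partial>lborel) = (\<integral>\<^sup>+z\<in>J. ennreal ((2 / w (half_cdf z))\<^sup>2) \<partial>lborel)"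
    by (rule nn_integral_cong_AE) (use dens_law in eventually_elim, auto simp: q_def indicator_def)
  also have "\<dots> = (\<integral>\<^sup>+x\<in>{0<..<1/2}. ennreal (w x) * ennreal ((2 / w x)\<^sup>2) \<partial>lborel)"
    by (rule nn_integral_half_density) simp
  also have "\<dots> = (\<integral>\<^sup>+x. 4 * (1 / ennreal (w x) * indicator {0<..<1/2} x) \<partial>lborel)"
  proof (rule nn_integral_cong_AE)
    show "AE x in lborel. ennreal (w x) * ennreal ((2 / w x)\<^sup>2) * indicator {0<..<1/2} x = 4 * (1 / ennreal (w x) * indicator {0<..<1/2} x)"
      using w_pos
    proof eventually_elim
      case (elim x)
      show ?case
      proof (cases "x \<in> {0<..<1/2}")
        case True
        then have w: "w x > 0" using elim by simp
        have "ennreal (w x) * ennreal ((2 / w x)\<^sup>2) = ennreal (4 * (1 / w x))"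
          using w by (simp add: ennreal_mult[symmetric] power2_eq_square)
        also have "\<dots> = 4 * (1 / ennreal (w x))"
          using w by (simp add: ennreal_times_divide divide_ennreal[symmetric])
        finally show ?thesis using True by simp
      qed simp
    qed
  qed
  also have "\<dots> = 4 * (\<integral>\<^sup>+x\<in>{0<..<1/2}. 1 / ennreal (w x) \<partial>lborel)"
    by (rule nn_integral_cmult) simp
  finally show ?thesis .
qed

lemma nn_integral_inverse_dens:
  "(\<integral>\<^sup>+z\<in>J. 1 / ennreal (dens (law f) z) \<partial>lborel) = 1/2 * (\<integral>\<^sup>+x\<in>{0<..<1/2}. ennreal ((w x)\<^sup>2) \<partial>lborel)"
proof -
  have "(\<integral>\<^sup>+z\<in>J. 1 / ennreal (dens (law f) z) \<partial>lborel) = (\<integral>\<^sup>+z\<in>J. ennreal (w (half_cdf z) / 2) \<partial>lborel)"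
  proof (rule nn_integral_cong_AE)
    show "AE z in lborel. 1 / ennreal (dens (law f) z) * indicator J z = ennreal (w (half_cdf z) / 2) * indicator J z"
      using dens_law w_half_cdf_pos
    proof eventually_elim
      case (elim z)
      show ?case
      proof (cases "z \<in> J")
        case True
        then have "w (half_cdf z) > 0" "dens (law f) z = 2 / w (half_cdf z)" using elim by (auto simp: q_def)
        then have "1 / ennreal (dens (law f) z) = ennreal (w (half_cdf z) / 2)"
          using divide_ennreal[of 1 "2 / w (half_cdf z)"] by simp
        then show ?thesis by simp
      qed simp
    qed
  qed
  also have "\<dots> = (\<integral>\<^sup>+x\<in>{0<..<1/2}. ennreal (w x) * ennreal (w x / 2) \<partial>lborel)"
    by (rule nn_integral_half_density) simp
  also have "\<dots> = (\<integral>\<^sup>+x. 1/2 * (ennreal ((w x)\<^sup>2) * indicator {0<..<1/2} x) \<partial>lborel)"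
  proof (rule nn_integral_cong)
    fix x
    have "ennreal (w x) * ennreal (w x / 2) = ennreal (1/2 * (w x)\<^sup>2)"
      by (simp add: ennreal_mult[symmetric] w_nonneg power2_eq_square)
    also have "\<dots> = 1/2 * ennreal ((w x)\<^sup>2)"
      using divide_ennreal[of 1 2] by (subst ennreal_mult) simp_all
    finally show "ennreal (w x) * ennreal (w x / 2) * indicator {0<..<1/2} x = 1/2 * (ennreal ((w x)\<^sup>2) * indicator {0<..<1/2} x)"
      by (simp add: mult.assoc)
  qed
  also have "\<dots> = 1/2 * (\<integral>\<^sup>+x\<in>{0<..<1/2}. ennreal ((w x)\<^sup>2) \<partial>lborel)"
    by (rule nn_integral_cmult) simp
  finally show ?thesis .
qed

text \<open>
  A continuous periodic representative exists because \<open>arccos (cos (2 * pi * y)) / (2 * pi)\<close> is the distance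
  of \<open>y\<close> to the nearest integer; it is unique because continuous functions that agree almost everywhere
  agree.
\<close>

lemma crep_eq: 
  assumes "\<bar>y\<bar> \<le> 1/2"
  shows "crep f y = G \<bar>y\<bar>"
    and "continuous_on UNIV (crep f)"
proof -
  define Q where "Q h \<longleftrightarrow> continuous_on UNIV h \<and> (\<forall>x. h (x + 1) = h x) \<and> (AE x in circ. h x = f x)" for h
  define g where "g y = G (arccos (cos (2 * pi * y)) / (2 * pi))" for y
  have "continuous_on UNIV g"
    unfolding g_def by (rule continuous_on_compose2[OF continuous_G[of UNIV]]) (auto intro!: continuous_intros)
  moreover have "g (y + 1) = g y" for y
  proof -
    have "cos (2 * pi * (y + 1)) = cos (2 * pi * y)"
      using cos_periodic[of "2 * pi * y"] by (simp add: distrib_left)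
    then show ?thesis by (simp add: g_def)
  qed
  moreover have gabs: "g y = G \<bar>y\<bar>" if "\<bar>y\<bar> \<le> 1/2" for y
  proof -
    have "cos (2 * pi * y) = cos (2 * pi * \<bar>y\<bar>)"
      by (cases "y \<ge> 0") (simp_all add: abs_if)
    moreover have "arccos (cos (2 * pi * \<bar>y\<bar>)) = 2 * pi * \<bar>y\<bar>"
      using mult_left_mono[of "2 * \<bar>y\<bar>" 1 pi] that by (intro arccos_cos) simp_all
    ultimately show ?thesis by (simp add: g_def)
  qed
  moreover have "AE y in circ. g y = f y"
  proof -
    have "AE y in circ. \<bar>y\<bar> \<le> 1/2" unfolding AE_circ_iff by (intro AE_I2) auto
    then show ?thesis using f_G by eventually_elim (simp add: gabs)
  qed
  ultimately have "Q g" by (simp add: Q_def)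
  then have "Q (crep f)"
    unfolding crep_def Q_def[symmetric] by (rule someI[of Q g])
  then have c: "continuous_on UNIV (crep f)" "AE x in circ. crep f x = f x" by (auto simp: Q_def)
  show "continuous_on UNIV (crep f)" by (rule c(1))
  have "crep f y - G \<bar>y\<bar> = 0"
  proof (rule continuous_zero_of_AE[where u = "\<lambda>y. crep f y - G \<bar>y\<bar>" and a = "-1/2" and b = "1/2"])
    show "continuous_on UNIV (\<lambda>y. crep f y - G \<bar>y\<bar>)"
      by (rule continuous_on_diff[OF c(1)], rule continuous_on_compose2[OF continuous_G[of UNIV]])
         (auto intro!: continuous_intros)
    have "AE x in circ. crep f x - G \<bar>x\<bar> = 0"
      using c(2) f_G by eventually_elim simp
    then show "AE x in lborel. x \<in> {-1/2<..<1/2} \<longrightarrow> crep f x - G \<bar>x\<bar> = 0"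
      unfolding AE_circ_iff .
  qed (use assms in auto)
  then show "crep f y = G \<bar>y\<bar>" by simp
qed

lemma crep_derivative:
  "AE z in lborel. z \<in> J \<longrightarrow> (crep f has_real_derivative w (half_cdf z)) (at (half_cdf z))"
proof (rule AE_J_of_AE_half)
  show "AE x in lborel. x \<in> {0<..<1/2} \<longrightarrow> (crep f has_real_derivative w x) (at x)"
    using G_derivative
  proof eventually_elim
    case (elim x)
    show ?case
    proof
      assume x: "x \<in> {0<..<1/2}"
      show "(crep f has_real_derivative w x) (at x)"
        by (rule has_field_derivative_transform_within_open[OF elim, of "{0<..<1/2}"])
          (use x crep_eq(1) in simp_all)
    qed
  qed
qed

end

section \<open>The law at a regular time\<close>

lemma nn_integral_circ_profile:
  fixes h :: "real \<Rightarrow> ennreal"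
  assumes [measurable]: "h \<in> borel_measurable borel" "w \<in> borel_measurable borel"
    and "AE x in circ. \<bar>v x\<bar> = w \<bar>x\<bar>"
  shows "(\<integral>\<^sup>+x. h \<bar>v x\<bar> \<partial>circ) = 2 * (\<integral>\<^sup>+x\<in>{0<..<1/2}. h (w x) \<partial>lborel)"
proof -
  have "(\<integral>\<^sup>+x. h \<bar>v x\<bar> \<partial>circ) = (\<integral>\<^sup>+x. h (w \<bar>x\<bar>) \<partial>circ)"
    by (rule nn_integral_cong_AE) (use assms(3) in eventually_elim, simp)
  also have "\<dots> = 2 * (\<integral>\<^sup>+x\<in>{0<..<1/2}. h (w x) \<partial>lborel)"
    by (rule nn_integral_circ_even) simp
  finally show ?thesis .
qed

lemma has_weak_deriv_wD: "has_weak_deriv f g \<Longrightarrow> has_weak_deriv f (wD f)"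
  unfolding wD_def by (auto intro: someI[of "has_weak_deriv f" g])

text \<open>
  Without a weak derivative in \<open>L2\<close>, \<open>wD f\<close> is the zero function and \<open>1 / 0 = \<infinity>\<close>. So a finite integral also
  certifies that the weak derivative exists.
\<close>

lemma no_weak_deriv_infinite:
  assumes "\<nexists>g. has_weak_deriv f g"
  shows "(\<integral>\<^sup>+x. 1 / ennreal \<bar>wD f x\<bar> \<partial>circ) = \<infinity>"
proof -
  interpret circ: prob_space circ by (rule prob_space_circ)
  have "wD f = (\<lambda>_. 0)" unfolding wD_def using assms by (simp only: if_False)
  then have "(\<integral>\<^sup>+x. 1 / ennreal \<bar>wD f x\<bar> \<partial>circ) = (\<integral>\<^sup>+x. \<infinity> \<partial>circ)" by simp
  then show ?thesis by (simp add: circ.emeasure_space_1)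
qed

abbreviation inv_deriv :: "(real \<Rightarrow> real) \<Rightarrow> ennreal" where
  "inv_deriv f \<equiv> \<integral>\<^sup>+x. 1 / ennreal \<bar>wD f x\<bar> \<partial>circ"

abbreviation inv_half :: "(real \<Rightarrow> real) \<Rightarrow> ennreal" where
  "inv_half w \<equiv> \<integral>\<^sup>+x\<in>{0<..<1/2}. 1 / ennreal (w x) \<partial>lborel"

lemma weak_deriv_profile:
  assumes f: "f \<in> U2" and ex: "\<exists>g. has_weak_deriv f g"
  obtains w d where "profile w" "AE x in circ. f x = profile.G w d \<bar>x\<bar>" "inv_deriv f = 2 * inv_half w"
    "(\<integral>\<^sup>+x. ennreal ((wD f x)\<^sup>2) \<partial>circ) = 2 * (\<integral>\<^sup>+x\<in>{0<..<1/2}. ennreal ((w x)\<^sup>2) \<partial>lborel)"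
proof -
  have v: "has_weak_deriv f (wD f)" using ex has_weak_deriv_wD by blast
  obtain w d where w: "integrable lborel w" "\<And>x. x \<notin> {0<..<1/2} \<Longrightarrow> w x = 0"
    "\<And>x. 0 \<le> w x" "AE x in circ. \<bar>wD f x\<bar> = w \<bar>x\<bar>" "AE x in circ. f x = d + primitive w \<bar>x\<bar>"
    by (rule U2_profile[OF f v]) (rule that)
  interpret p: profile w d by unfold_locales (use w in auto)
  show thesis
  proof (rule that[of w d])
    show "profile w" by unfold_locales
    show "AE x in circ. f x = p.G \<bar>x\<bar>" using w(5) by (simp add: p.G_def)
    show "inv_deriv f = 2 * inv_half w"
      using nn_integral_circ_profile[of "\<lambda>y. 1 / ennreal y" w "wD f"] w(4) by simp
    show "(\<integral>\<^sup>+x. ennreal ((wD f x)\<^sup>2) \<partial>circ) = 2 * (\<integral>\<^sup>+x\<in>{0<..<1/2}. ennreal ((w x)\<^sup>2) \<partial>lborel)"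
      using nn_integral_circ_profile[of "\<lambda>y. ennreal (y\<^sup>2)" w "wD f"] w(4) by simp
  qed
qed

lemma regular_profile:
  assumes f: "f \<in> U2" and fin: "inv_deriv f < \<infinity>"
  obtains w d where "profile_of w d f" "inv_deriv f = 2 * inv_half w"
    "(\<integral>\<^sup>+x. ennreal ((wD f x)\<^sup>2) \<partial>circ) = 2 * (\<integral>\<^sup>+x\<in>{0<..<1/2}. ennreal ((w x)\<^sup>2) \<partial>lborel)"
proof -
  have ex: "\<exists>g. has_weak_deriv f g" using no_weak_deriv_infinite[of f] fin
    by (cases "\<exists>g. has_weak_deriv f g") simp_all
  obtain w d where w: "profile w" "AE x in circ. f x = profile.G w d \<bar>x\<bar>" "inv_deriv f = 2 * inv_half w"
    "(\<integral>\<^sup>+x. ennreal ((wD f x)\<^sup>2) \<partial>circ) = 2 * (\<integral>\<^sup>+x\<in>{0<..<1/2}. ennreal ((w x)\<^sup>2) \<partial>lborel)"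
    by (rule weak_deriv_profile[OF f ex]) (rule that)
  interpret p: profile w d by (rule w(1))
  have "inv_half w \<noteq> \<infinity>"
  proof
    assume "inv_half w = \<infinity>"
    then show False using fin unfolding w(3) by (simp add: ennreal_mult_top)
  qed
  then have "AE x in lborel. 1 / ennreal (w x) * indicator {0<..<1/2} x \<noteq> \<infinity>"
    by (intro nn_integral_noteq_infinite) simp_all
  then have pos: "AE x in lborel. x \<in> {0<..<1/2} \<longrightarrow> 0 < w x"
  proof eventually_elim
    case (elim x)
    then have "w x \<noteq> 0" if "x \<in> {0<..<1/2}" using that by (intro notI) simp
    then show ?case using p.w_nonneg[of x] by fastforce
  qed
  have "profile_of w d f"
    by unfold_locales (use pos f w(2) in \<open>simp_all add: U2_def\<close>)
  from that[OF this w(3,4)] show thesis .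
qed

context profile_of
begin

lemma crep_ends: "crep f 0 = G 0" "crep f (1/2) = G (1/2)"
  using crep_eq(1)[of 0] crep_eq(1)[of "1/2"] by simp_all

text \<open>
  Outside of \<open>J\<close> the distribution function is 0 or 1, so the derivative formula on \<open>J\<close> covers every level
  whose position lies strictly between 0 and 1/2.
\<close>

lemma half_cdf_outside:
  assumes "z \<notin> J"
  shows "half_cdf z \<in> {0, 1/2}"
proof -
  interpret real_distribution "law f" by (rule real_distribution_law)
  have m: "half_cdf x \<le> half_cdf y" if "x \<le> y" for x y
    using cdf_nondecreasing[OF that] by (simp add: half_cdf_def)
  have b: "0 \<le> half_cdf z" "half_cdf z \<le> 1/2" using cdf_nonneg[of z] cdf_bounded_prob[of z] by (simp_all add: half_cdf_def)
  show ?thesis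
  proof (cases "z \<le> G 0")
    case True
    then have "half_cdf z \<le> 0" using m[of z "G 0"] half_cdf_G[of 0] by simp
    then show ?thesis using b by simp
  next
    case False
    then have "G (1/2) \<le> z" using assms by auto
    then have "1/2 \<le> half_cdf z" using m[of "G (1/2)" z] half_cdf_G[of "1/2"] by simp
    then show ?thesis using b by simp
  qed
qed

lemma dens_outside: "AE z in lborel. z \<notin> J \<longrightarrow> dens (law f) z = 0"
  using dens_law by eventually_elim (simp add: q_def)

lemma dens_inside: "AE z in lborel. z \<in> J \<longrightarrow> 0 < dens (law f) z \<and> w (half_cdf z) = 2 / dens (law f) z"
  using dens_law w_half_cdf_pos by eventually_elim (auto simp: q_def)

lemma crep_differentiable:
  "AE z in lborel. half_cdf z \<notin> {0, 1/2} \<longrightarrow> crep f differentiable (at (half_cdf z))"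
  using crep_derivative
proof eventually_elim
  case (elim z)
  then show ?case using half_cdf_outside[of z] real_differentiable_def by blast
qed

lemma cdf_crep: "u \<in> {0<..<1} \<Longrightarrow> cdf (law f) (crep f (u / 2)) = u"
  using crep_eq(1)[of "u / 2"] half_cdf_G[of "u / 2"] by (simp add: half_cdf_def)

lemma crep_half_cdf: "z \<in> J \<Longrightarrow> crep f (half_cdf z) = z"
  using crep_eq(1)[of "half_cdf z"] half_cdf_in[of z] by simp

lemma crep_in_J: "u \<in> {0<..<1} \<Longrightarrow> crep f (u / 2) \<in> J"
  using crep_eq(1)[of "u / 2"] G_in_J[of "u / 2"] by simp

lemma bij_betw_crep: "bij_betw (\<lambda>u. crep f (u / 2)) {0<..<1} J"
proof (rule bij_betwI[where g = "\<lambda>z. cdf (law f) z"])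
  show "(\<lambda>u. crep f (u / 2)) \<in> {0<..<1} \<rightarrow> J" using crep_in_J by auto
  show "cdf (law f) \<in> J \<rightarrow> {0<..<1}" using half_cdf_in(1) by (force simp: half_cdf_def)
  show "cdf (law f) (crep f (u / 2)) = u" if "u \<in> {0<..<1}" for u by (rule cdf_crep[OF that])
  show "crep f (cdf (law f) z / 2) = z" if "z \<in> J" for z using crep_half_cdf[OF that] by (simp add: half_cdf_def)
qed

end

lemma ennreal_quarter_double: "1/4 * (2 * a) = 1/2 * (a :: ennreal)"
proof -
  have "1/4 * 2 = (1/2 :: ennreal)"
    using divide_ennreal[of 1 4] divide_ennreal[of 1 2] ennreal_mult[of "1/4" 2] by simp
  then show ?thesis by (simp add: mult.assoc[symmetric])
qed

lemma regular_path_law: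
  assumes f: "f \<in> U2" and fin: "inv_deriv f < \<infinity>"
  defines "p \<equiv> dens (law f)" and "x \<equiv> crep f"
  shows "law f = density lborel (\<lambda>z. ennreal (p z))"
    and "(\<integral>\<^sup>+z. ennreal ((p z)\<^sup>2) \<partial>lborel) = 2 * inv_deriv f"
    and "AE z in lborel. z \<notin> {x 0..x (1/2)} \<longrightarrow> p z = 0"
    and "AE z in lborel. z \<in> {x 0<..<x (1/2)} \<longrightarrow> p z > 0"
    and "AE z in lborel. 1/2 * cdf (law f) z \<notin> {0, 1/2} \<longrightarrow> x differentiable (at (1/2 * cdf (law f) z))"
    and "AE z in lborel. z \<in> {x 0<..<x (1/2)} \<longrightarrow> (x has_real_derivative 2 / p z) (at (1/2 * cdf (law f) z))"
    and "(\<integral>\<^sup>+z\<in>{x 0<..<x (1/2)}. 1 / ennreal (p z) \<partial>lborel) = 1/4 * (\<integral>\<^sup>+y. ennreal ((wD f y)\<^sup>2) \<partial>circ)"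
    and "continuous_on {0<..<1} (\<lambda>u. x (u / 2))"
    and "bij_betw (\<lambda>u. x (u / 2)) {0<..<1} {x 0<..<x (1/2)}"
    and "\<forall>u\<in>{0<..<1}. cdf (law f) (x (u / 2)) = u"
    and "\<forall>z\<in>{x 0<..<x (1/2)}. x (cdf (law f) z / 2) = z"
proof -
  obtain w d where 1: "profile_of w d f"
    "inv_deriv f = 2 * inv_half w"
    "(\<integral>\<^sup>+x. ennreal ((wD f x)\<^sup>2) \<partial>circ) = 2 * (\<integral>\<^sup>+x\<in>{0<..<1/2}. ennreal ((w x)\<^sup>2) \<partial>lborel)"
    by (rule regular_profile[OF f fin])
  interpret profile_of w d f by (rule 1(1))
  have hc: "1/2 * cdf (law f) z = half_cdf z" "cdf (law f) z / 2 = half_cdf z" for z by (simp_all add: half_cdf_def)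
  show "law f = density lborel (\<lambda>z. ennreal (p z))" unfolding p_def by (rule law_density_dens)
  show "(\<integral>\<^sup>+z. ennreal ((p z)\<^sup>2) \<partial>lborel) = 2 * inv_deriv f"
    unfolding p_def nn_integral_dens_sq 1(2) by (simp add: mult.assoc[symmetric])
  show "AE z in lborel. z \<notin> {x 0..x (1/2)} \<longrightarrow> p z = 0"
    unfolding p_def x_def crep_ends using dens_outside by eventually_elim auto
  show "AE z in lborel. z \<in> {x 0<..<x (1/2)} \<longrightarrow> p z > 0"
    unfolding p_def x_def crep_ends using dens_inside by eventually_elim auto
  show "AE z in lborel. 1/2 * cdf (law f) z \<notin> {0, 1/2} \<longrightarrow> x differentiable (at (1/2 * cdf (law f) z))"
    unfolding x_def hc by (rule crep_differentiable)
  show "AE z in lborel. z \<in> {x 0<..<x (1/2)} \<longrightarrow> (x has_real_derivative 2 / p z) (at (1/2 * cdf (law f) z))"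
    unfolding p_def x_def crep_ends hc using dens_inside crep_derivative by eventually_elim auto
  show "(\<integral>\<^sup>+z\<in>{x 0<..<x (1/2)}. 1 / ennreal (p z) \<partial>lborel) = 1/4 * (\<integral>\<^sup>+y. ennreal ((wD f y)\<^sup>2) \<partial>circ)"
    unfolding p_def x_def crep_ends 1(3) ennreal_quarter_double by (rule nn_integral_inverse_dens)
  show "continuous_on {0<..<1} (\<lambda>u. x (u / 2))"
    unfolding x_def by (rule continuous_on_compose2[OF crep_eq(2)[of 0]]) (auto intro!: continuous_intros)
  show "bij_betw (\<lambda>u. x (u / 2)) {0<..<1} {x 0<..<x (1/2)}"
    unfolding x_def crep_ends by (rule bij_betw_crep)
  show "\<forall>u\<in>{0<..<1}. cdf (law f) (x (u / 2)) = u"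
    unfolding x_def using cdf_crep by blast
  show "\<forall>z\<in>{x 0<..<x (1/2)}. x (cdf (law f) z / 2) = z"
    unfolding x_def crep_ends hc using crep_half_cdf by blast
qed

section \<open>Measurable lower bounds for the inverse energy\<close>

definition left_mean :: "(real \<Rightarrow> real) \<Rightarrow> real \<Rightarrow> nat \<Rightarrow> real" where
  "left_mean f b n = ip f (\<lambda>x. real (Suc n) * indicator {b - 1 / real (Suc n)<..b} x)"

text \<open>
  The value at \<open>b\<close> of the continuous representative, recovered from inner products so that it depends
  measurably on the class of \<open>f\<close>. Means over short intervals to the left of \<open>b\<close> stay inside the fundamental
  domain for every \<open>b\<close> in \<open>[0, 1/2]\<close>.
\<close>

definition endpoint :: "(real \<Rightarrow> real) \<Rightarrow> real \<Rightarrow> real" where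
  "endpoint f b = lim (left_mean f b)"

definition mesh :: "nat \<Rightarrow> real" where
  "mesh m = 1 / (2 * real (Suc m))"

definition node :: "nat \<Rightarrow> nat \<Rightarrow> real" where
  "node m j = real j * mesh m"

text \<open>
  The difference quotient of \<open>f\<close> over a cell. The extra term, which vanishes in the limit, keeps it positive
  on cells where \<open>f\<close> is constant.
\<close>

definition slope :: "nat \<Rightarrow> (real \<Rightarrow> real) \<Rightarrow> nat \<Rightarrow> real" where
  "slope m f j = \<bar>endpoint f (node m (Suc j)) - endpoint f (node m j)\<bar> / mesh m + 1 / real (Suc m)"

text \<open>
  Riemann sum, over the cells of a partition of \<open>[0, 1/2]\<close>, for the integral of \<open>1 / \<bar>Df\<bar>\<close>.
\<close>

definition inv_energy :: "nat \<Rightarrow> (real \<Rightarrow> real) \<Rightarrow> ennreal" where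
  "inv_energy m f = (\<Sum>j<Suc m. ennreal (mesh m / slope m f j))"

lemma mesh_pos: "0 < mesh m" by (simp add: mesh_def)

lemma node_less: "node m j < node m (Suc j)"
  using mesh_pos[of m] by (simp add: node_def algebra_simps)

lemma node_diff: "node m (Suc j) - node m j = mesh m"
  by (simp add: node_def algebra_simps)

lemma node_0: "node m 0 = 0" by (simp add: node_def)

lemma node_last: "node m (Suc m) = 1/2" by (simp add: node_def mesh_def)

lemma node_range: "j \<le> Suc m \<Longrightarrow> node m j \<in> {0..1/2}"
  unfolding node_last[of m, symmetric] node_def using mesh_pos[of m] by (auto intro!: mult_right_mono)

lemma slope_pos: "0 < slope m f j"
  using mesh_pos[of m] by (auto simp: slope_def intro!: add_nonneg_pos)

lemma indicator_L2: "(\<lambda>x. c * indicator {a<..b} x) \<in> L2"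
proof -
  interpret circ: prob_space circ by (rule prob_space_circ)
  have m: "(\<lambda>x. c * indicator {a<..b} x) \<in> borel_measurable circ" by (intro borel_measurable_circ) simp
  have "integrable circ (\<lambda>x. (c * indicator {a<..b} x)\<^sup>2)"
    by (rule circ.integrable_const_bound[where B = "c\<^sup>2"]) (use m in \<open>auto simp: indicator_def\<close>)
  then show ?thesis using m by (simp add: L2_def)
qed

lemma (in profile) endpoint_eq:
  assumes f: "f \<in> L2" "AE x in circ. f x = G \<bar>x\<bar>" and b: "b \<in> {0..1/2}"
  shows "endpoint f b = G b"
proof -
  have "left_mean f b \<longlonglongrightarrow> G b"
  proof (rule LIMSEQ_I)
    fix e :: real assume "e > 0"
    then have e: "e / 2 > 0" by simp
    have "continuous_on UNIV (\<lambda>x. G \<bar>x\<bar>)"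
      by (rule continuous_on_compose2[OF continuous_G[of UNIV]]) (auto intro!: continuous_intros)
    then obtain r where r: "r > 0" "\<And>x. dist x b < r \<Longrightarrow> dist (G \<bar>x\<bar>) (G \<bar>b\<bar>) < e / 2"
      unfolding continuous_on_iff using e by (metis UNIV_I)
    obtain N where N: "1 / real (Suc N) < r" using r(1) nat_approx_posE by metis
    show "\<exists>no. \<forall>n\<ge>no. norm (left_mean f b n - G b) < e"
    proof (intro exI[of _ "max N 1"] allI impI)
      fix n assume n: "max N 1 \<le> n"
      let ?h = "1 / real (Suc n)"
      let ?K = "\<lambda>x. real (Suc n) * indicator {b - ?h<..b} x :: real"
      have "?h \<le> 1 / real (Suc N)" using n by (intro divide_left_mono) auto
      then have hr: "?h < r" using N by simp
      have "?h \<le> 1 / real (Suc 1)" using n by (intro divide_left_mono) auto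
      then have h2: "?h \<le> 1/2" by simp
      have KL: "?K \<in> L2" by (rule indicator_L2)
      have i1: "integrable circ (\<lambda>x. f x * ?K x)" by (rule L2_integrable_mult[OF f(1) KL])
      have i2: "integrable circ ?K" by (rule L2_integrable[OF KL])
      have "(LINT x|circ. ?K x) = (LINT x|lborel. real (Suc n) * indicator {b - ?h<..b} x)"
        unfolding integral_circ set_lebesgue_integral_def
      proof (rule Bochner_Integration.integral_cong[OF refl])
        fix x show "indicator {-1/2<..1/2} x *\<^sub>R ?K x = ?K x"
        proof (cases "x \<in> {b - ?h<..b}")
          case True
          then have "-1/2 < x" "x \<le> 1/2" using b h2 unfolding greaterThanAtMost_iff atLeastAtMost_iff by linarith+
          then show ?thesis by simp
        qed simp
      qed
      also have "\<dots> = real (Suc n) * measure lborel {b - ?h<..b}" by simp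
      also have "\<dots> = 1" by simp
      finally have K1: "(LINT x|circ. ?K x) = 1" .
      have "left_mean f b n - G b = (LINT x|circ. f x * ?K x) - G b * (LINT x|circ. ?K x)"
        unfolding K1 by (simp add: left_mean_def ip_def)
      also have "\<dots> = (LINT x|circ. f x * ?K x - G b * ?K x)"
        using i1 i2 by simp
      finally have "\<bar>left_mean f b n - G b\<bar> \<le> (LINT x|circ. \<bar>f x * ?K x - G b * ?K x\<bar>)"
        by (metis integral_abs_bound)
      also have "\<dots> \<le> (LINT x|circ. e / 2 * ?K x)"
      proof (rule integral_mono_AE)
        show "integrable circ (\<lambda>x. \<bar>f x * ?K x - G b * ?K x\<bar>)"
          by (intro integrable_abs Bochner_Integration.integrable_diff integrable_mult_right i1 i2)
        show "integrable circ (\<lambda>x. e / 2 * ?K x)" by (intro integrable_mult_right i2)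
        show "AE x in circ. \<bar>f x * ?K x - G b * ?K x\<bar> \<le> e / 2 * ?K x"
          using f(2)
        proof eventually_elim
          case (elim x)
          show ?case
          proof (cases "x \<in> {b - ?h<..b}")
            case True
            then have "dist x b < r" using hr by (auto simp: dist_real_def)
            then have "\<bar>f x - G b\<bar> \<le> e / 2" using r(2)[of x] b elim by (simp add: dist_real_def)
            then have "\<bar>f x - G b\<bar> * real (Suc n) \<le> e / 2 * real (Suc n)" by (intro mult_right_mono) auto
            then show ?thesis using True by (simp add: left_diff_distrib[symmetric] abs_mult)
          qed simp
        qed
      qed
      also have "\<dots> = e / 2 * (LINT x|circ. ?K x)" by (rule integral_mult_right_zero)
      also have "\<dots> < e" unfolding K1 using e by simp
      finally show "norm (left_mean f b n - G b) < e" by simp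
    qed
  qed
  then show ?thesis unfolding endpoint_def by (rule limI)
qed

context profile
begin

lemma slope_eq:
  assumes "f \<in> L2" "AE x in circ. f x = G \<bar>x\<bar>" "j < Suc m"
  shows "slope m f j = (G (node m (Suc j)) - G (node m j)) / mesh m + 1 / real (Suc m)"
  unfolding slope_def
  using endpoint_eq[OF assms(1,2) node_range[of j m]] endpoint_eq[OF assms(1,2) node_range[of "Suc j" m]]
    assms(3) mono_G[OF less_imp_le[OF node_less[of m j]]] by simp

text \<open>
  Jensen's inequality for \<open>y \<mapsto> 1 / (y + r)\<close>, obtained by integrating its tangent \<open>t\<close> at the mean of \<open>w\<close>;
  the increment of \<open>G\<close> is the integral of \<open>w\<close> over the cell.
\<close>

lemma tangent_bound:
  assumes ab: "a < b" and r: "0 < r"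
  shows "ennreal ((b - a) / ((G b - G a) / (b - a) + r)) \<le> (\<integral>\<^sup>+x\<in>{a<..b}. 1 / ennreal (w x) \<partial>lborel)"
proof -
  define L where "L = b - a"
  define c where "c = (G b - G a) / L + r"
  have L: "L > 0" using ab by (simp add: L_def)
  have c: "c > 0" using mono_G[of a b] ab L r by (auto simp: c_def intro!: add_nonneg_pos)
  define t where "t y = 2 / c - (y + r) / c\<^sup>2" for y
  have tan: "ennreal (t y) \<le> 1 / ennreal y" if "0 \<le> y" for y
  proof (cases "y = 0")
    case False
    then have y: "y > 0" using that by simp
    have "t y \<le> 1 / (y + r)"
    proof -
      have "0 \<le> (y + r - c)\<^sup>2 / (c\<^sup>2 * (y + r))" using y r by simp
      also have "\<dots> = 1 / (y + r) - t y"
        using y r c by (simp add: t_def field_simps power2_eq_square)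
      finally show ?thesis by simp
    qed
    also have "\<dots> \<le> 1 / y" using y r by (simp add: divide_left_mono)
    finally have "ennreal (t y) \<le> ennreal (1 / y)" by (rule ennreal_leI)
    then show ?thesis using divide_ennreal[of 1 y] y by simp
  qed simp
  let ?i = "\<lambda>x. indicator {a<..b} x :: real"
  have wi: "integrable lborel (\<lambda>x. ?i x * w x)"
    using integrable_mult_indicator[of "{a<..b}" lborel w] w_int by simp
  have ii: "integrable lborel ?i"
    by (intro integrable_real_indicator) (use ab in simp_all)
  have ti: "?i x * t (w x) = (2 / c - r / c\<^sup>2) * ?i x - 1 / c\<^sup>2 * (?i x * w x)" for x
    by (simp add: t_def algebra_simps add_divide_distrib)
  have int: "integrable lborel (\<lambda>x. ?i x * t (w x))"
    unfolding ti by (intro Bochner_Integration.integrable_diff integrable_mult_right wi ii)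
  have "(LINT x|lborel. ?i x * t (w x)) = (2 / c - r / c\<^sup>2) * (LINT x|lborel. ?i x) - 1 / c\<^sup>2 * (LINT x|lborel. ?i x * w x)"
    unfolding ti using wi ii by simp
  also have "(LINT x|lborel. ?i x) = L" using ab by (simp add: L_def)
  also have "(LINT x|lborel. ?i x * w x) = G b - G a"
    using G_diff[of a b] ab by (simp add: set_lebesgue_integral_def)
  also have "G b - G a = L * (c - r)" using L by (simp add: c_def)
  also have "(2 / c - r / c\<^sup>2) * L - 1 / c\<^sup>2 * (L * (c - r)) = L / c"
    using c by (simp add: field_simps power2_eq_square)
  finally have "ennreal (L / c) = ennreal (LINT x|lborel. ?i x * t (w x))" by simp
  also have "\<dots> \<le> ennreal (LINT x|lborel. max 0 (?i x * t (w x)))"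
    using int by (intro ennreal_leI integral_mono) auto
  also have "\<dots> = (\<integral>\<^sup>+x. ennreal (max 0 (?i x * t (w x))) \<partial>lborel)"
    using int by (intro nn_integral_eq_integral[symmetric]) auto
  also have "\<dots> \<le> (\<integral>\<^sup>+x\<in>{a<..b}. 1 / ennreal (w x) \<partial>lborel)"
  proof (rule nn_integral_mono)
    fix x
    show "ennreal (max 0 (?i x * t (w x))) \<le> 1 / ennreal (w x) * indicator {a<..b} x"
      using tan[OF w_nonneg[of x]] by (cases "x \<in> {a<..b}") (simp_all add: max_def ennreal_neg)
  qed
  finally show ?thesis by (simp add: L_def c_def)
qed

lemma nn_integral_nodes:
  fixes h :: "real \<Rightarrow> ennreal"
  assumes [measurable]: "h \<in> borel_measurable borel"
  shows "(\<Sum>j<n. \<integral>\<^sup>+x\<in>{node m j<..node m (Suc j)}. h x \<partial>lborel) = (\<integral>\<^sup>+x\<in>{0<..node m n}. h x \<partial>lborel)"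
proof (induction n)
  case 0
  then show ?case by (simp add: node_0)
next
  case (Suc n)
  have n0: "0 \<le> node m n" using mesh_pos[of m] by (simp add: node_def)
  have "(\<integral>\<^sup>+x\<in>{0<..node m (Suc n)}. h x \<partial>lborel)
    = (\<integral>\<^sup>+x. h x * indicator {0<..node m n} x + h x * indicator {node m n<..node m (Suc n)} x \<partial>lborel)"
  proof (rule nn_integral_cong)
    fix x
    show "h x * indicator {0<..node m (Suc n)} x = h x * indicator {0<..node m n} x + h x * indicator {node m n<..node m (Suc n)} x"
      using n0 node_less[of m n] by (auto simp: indicator_def)
  qed
  also have "\<dots> = (\<integral>\<^sup>+x\<in>{0<..node m n}. h x \<partial>lborel) + (\<integral>\<^sup>+x\<in>{node m n<..node m (Suc n)}. h x \<partial>lborel)"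
    by (rule nn_integral_add) simp_all
  finally show ?case using Suc by simp
qed

lemma nn_integral_half_closed: "(\<integral>\<^sup>+x\<in>{0<..1/2}. h x \<partial>lborel) = (\<integral>\<^sup>+x\<in>{0<..<1/2::real}. h x \<partial>lborel)"
proof (rule nn_integral_cong_AE)
  show "AE x in lborel. h x * indicator {0<..1/2} x = h x * indicator {0<..<1/2} x"
    using AE_lborel_singleton[of "1/2"] by eventually_elim (auto simp: indicator_def)
qed

lemma inv_energy_le:
  assumes "f \<in> L2" "AE x in circ. f x = G \<bar>x\<bar>"
  shows "inv_energy m f \<le> inv_half w"
proof -
  have "inv_energy m f \<le> (\<Sum>j<Suc m. \<integral>\<^sup>+x\<in>{node m j<..node m (Suc j)}. 1 / ennreal (w x) \<partial>lborel)"
    unfolding inv_energy_def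
  proof (rule sum_mono)
    fix j assume "j \<in> {..<Suc m}"
    then have j: "j < Suc m" by simp
    show "ennreal (mesh m / slope m f j) \<le> (\<integral>\<^sup>+x\<in>{node m j<..node m (Suc j)}. 1 / ennreal (w x) \<partial>lborel)"
      unfolding slope_eq[OF assms j]
      using tangent_bound[OF node_less[of m j], of "1 / real (Suc m)"] by (simp add: node_diff)
  qed
  also have "\<dots> = (\<integral>\<^sup>+x\<in>{0<..1/2}. 1 / ennreal (w x) \<partial>lborel)"
    by (subst nn_integral_nodes) (simp_all only: node_last, measurable)
  finally show ?thesis unfolding nn_integral_half_closed .
qed

text \<open>
  Both endpoints may move, but the increments are measured from \<open>x\<close> on its two sides, so the errors add
  up to a fraction of the length \<open>b m - a m\<close>.
\<close>

lemma straddle_derivative: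
  assumes D: "(G has_real_derivative l) (at x)" and ab: "\<And>m. a m < x" "\<And>m. x \<le> b m" "(\<lambda>m. b m - a m) \<longlonglongrightarrow> 0"
  shows "(\<lambda>m. (G (b m) - G (a m)) / (b m - a m)) \<longlonglongrightarrow> l"
proof (rule LIMSEQ_I)
  fix e :: real assume e: "e > 0"
  have "(G has_derivative (\<lambda>h. l * h)) (at x)" using D by (simp add: has_field_derivative_def)
  then obtain r where r: "r > 0" "\<And>y. norm (y - x) < r \<Longrightarrow> norm (G y - G x - l * (y - x)) \<le> e / 2 * norm (y - x)"
    using e unfolding has_derivative_at_alt by (metis half_gt_zero)
  obtain N where N: "\<And>m. m \<ge> N \<Longrightarrow> norm (b m - a m - 0) < r" using LIMSEQ_D[OF ab(3) r(1)] by blast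
  show "\<exists>no. \<forall>m\<ge>no. norm ((G (b m) - G (a m)) / (b m - a m) - l) < e"
  proof (intro exI[of _ N] allI impI)
    fix m assume "N \<le> m"
    then have s: "b m - a m < r" using N[of m] by simp
    have p: "0 < b m - a m" using ab(1)[of m] ab(2)[of m] by simp
    have 1: "\<bar>G (b m) - G x - l * (b m - x)\<bar> \<le> e / 2 * (b m - x)" using r(2)[of "b m"] s ab(1)[of m] ab(2)[of m] by simp
    have 2: "\<bar>G (a m) - G x - l * (a m - x)\<bar> \<le> e / 2 * (x - a m)" using r(2)[of "a m"] s ab(1)[of m] ab(2)[of m] by simp
    have "(G (b m) - G (a m)) - l * (b m - a m) = (G (b m) - G x - l * (b m - x)) - (G (a m) - G x - l * (a m - x))"
      by (simp add: algebra_simps)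
    also have "\<bar>\<dots>\<bar> \<le> e / 2 * (b m - x) + e / 2 * (x - a m)" using 1 2 by linarith
    also have "\<dots> = e / 2 * (b m - a m)" unfolding distrib_left[symmetric] by simp
    finally have "\<bar>(G (b m) - G (a m)) - l * (b m - a m)\<bar> / (b m - a m) \<le> e / 2" using p by (simp add: divide_le_eq)
    moreover have "(G (b m) - G (a m)) / (b m - a m) - l = ((G (b m) - G (a m)) - l * (b m - a m)) / (b m - a m)"
      using p by (simp add: field_simps)
    ultimately have "\<bar>(G (b m) - G (a m)) / (b m - a m) - l\<bar> \<le> e / 2" using p by (simp add: abs_divide)
    then show "norm ((G (b m) - G (a m)) / (b m - a m) - l) < e" using e by simp
  qed
qed

lemma node_straddle:
  assumes x: "x \<in> {0<..<1/2}"
  obtains j where "j < Suc m" "node m j < x" "x \<le> node m (Suc j)"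
proof -
  define k where "k = (LEAST k. x \<le> node m k)"
  have ex: "x \<le> node m (Suc m)" using x by (simp add: node_last)
  then have k: "x \<le> node m k" "k \<le> Suc m" unfolding k_def by (auto intro: LeastI Least_le)
  have "k \<noteq> 0"
  proof
    assume "k = 0"
    then show False using k(1) x by (simp add: node_0)
  qed
  then obtain j where j: "k = Suc j" by (cases k) auto
  then have "\<not> x \<le> node m j" unfolding k_def using not_less_Least[of j "\<lambda>k. x \<le> node m k"] by simp
  then show thesis using that[of j] k j by simp
qed

text \<open>
  The Riemann sums are integrals of the step functions \<open>s m\<close>, which tend to \<open>1 / w\<close> at each point where \<open>G\<close>
  has derivative \<open>w\<close>. Fatou's lemma concludes.
\<close>

lemma le_inv_energy:
  assumes f: "f \<in> L2" "AE x in circ. f x = G \<bar>x\<bar>"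
  shows "inv_half w \<le> (SUP m. inv_energy m f)"
proof -
  define s where "s m x = (\<Sum>j<Suc m. ennreal (1 / slope m f j) * indicator {node m j<..node m (Suc j)} x)" for m and x :: real
  have s_meas: "s m \<in> borel_measurable lborel" for m unfolding s_def by measurable
  have s_int: "(\<integral>\<^sup>+x. s m x \<partial>lborel) = inv_energy m f" for m
  proof -
    have "(\<integral>\<^sup>+x. s m x \<partial>lborel) = (\<Sum>j<Suc m. ennreal (1 / slope m f j) * emeasure lborel {node m j<..node m (Suc j)})"
      unfolding s_def by (subst nn_integral_sum) (simp_all add: nn_integral_cmult_indicator)
    also have "\<dots> = inv_energy m f"
      unfolding inv_energy_def
    proof (rule sum.cong[OF refl])
      fix j
      have "emeasure lborel {node m j<..node m (Suc j)} = ennreal (mesh m)"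
        using node_less[of m j] by (simp add: node_diff)
      then show "ennreal (1 / slope m f j) * emeasure lborel {node m j<..node m (Suc j)} = ennreal (mesh m / slope m f j)"
        using slope_pos[of m f j] mesh_pos[of m] by (simp add: ennreal_mult[symmetric])
    qed
    finally show ?thesis .
  qed
  have lim: "AE x in lborel. 1 / ennreal (w x) * indicator {0<..<1/2} x \<le> liminf (\<lambda>m. s m x)"
    using G_derivative
  proof eventually_elim
    case (elim x)
    show ?case
    proof (cases "x \<in> {0<..<1/2}")
      case True
      have "\<exists>j. j < Suc m \<and> node m j < x \<and> x \<le> node m (Suc j)" for m
        using node_straddle[OF True, of m] by metis
      then obtain j where j: "\<And>m. j m < Suc m" "\<And>m. node m (j m) < x" "\<And>m. x \<le> node m (Suc (j m))" by metis
      have mesh0: "mesh \<longlonglongrightarrow> 0"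
      proof -
        have "(\<lambda>m. 1/2 * (1 / real (Suc m))) \<longlonglongrightarrow> 1/2 * 0"
          by (intro tendsto_mult tendsto_const LIMSEQ_Suc[OF lim_const_over_n])
        then show ?thesis by (simp add: mesh_def[abs_def])
      qed
      have "(\<lambda>m. (G (node m (Suc (j m))) - G (node m (j m))) / (node m (Suc (j m)) - node m (j m))) \<longlonglongrightarrow> w x"
        by (rule straddle_derivative[OF elim]) (use j mesh0 in \<open>simp_all add: node_diff\<close>)
      then have "(\<lambda>m. (G (node m (Suc (j m))) - G (node m (j m))) / mesh m + 1 / real (Suc m)) \<longlonglongrightarrow> w x + 0"
        unfolding node_diff by (intro tendsto_add LIMSEQ_Suc[OF lim_const_over_n])
      then have "(\<lambda>m. slope m f (j m)) \<longlonglongrightarrow> w x"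
        by (simp add: slope_eq[OF f j(1)])
      then have "(\<lambda>m. inverse (ennreal (slope m f (j m)))) \<longlonglongrightarrow> inverse (ennreal (w x))"
        by (intro continuous_on_tendsto_compose[OF continuous_on_inverse_ennreal[OF continuous_on_id, of UNIV]] tendsto_ennrealI) simp_all
      moreover have "s m x = inverse (ennreal (slope m f (j m)))" for m
      proof -
        have "s m x = (\<Sum>i<Suc m. if i = j m then ennreal (1 / slope m f i) else 0)"
          unfolding s_def
        proof (rule sum.cong[OF refl])
          fix i
          show "ennreal (1 / slope m f i) * indicator {node m i<..node m (Suc i)} x = (if i = j m then ennreal (1 / slope m f i) else 0)"
          proof (cases "i = j m")
            case False
            have "x \<notin> {node m i<..node m (Suc i)}"
            proof
              assume x: "x \<in> {node m i<..node m (Suc i)}"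
              have "node m i < node m (Suc (j m))" "node m (j m) < node m (Suc i)"
                using x j(2)[of m] j(3)[of m] by auto
              then have "i < Suc (j m)" "j m < Suc i"
                using mesh_pos[of m] by (simp_all only: node_def mult_less_cancel_right_pos of_nat_less_iff)
              then show False using False by simp
            qed
            then show ?thesis using False by simp
          qed (use j in simp)
        qed
        also have "\<dots> = ennreal (1 / slope m f (j m))" using j(1)[of m] by simp
        also have "\<dots> = inverse (ennreal (slope m f (j m)))"
          using inverse_ennreal[OF slope_pos[of m f "j m"]] by (simp add: inverse_eq_divide)
        finally show ?thesis .
      qed
      ultimately have "(\<lambda>m. s m x) \<longlonglongrightarrow> inverse (ennreal (w x))" by simp
      then have "liminf (\<lambda>m. s m x) = inverse (ennreal (w x))" by (intro lim_imp_Liminf) auto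
      then show ?thesis using True by (simp add: divide_ennreal_def)
    qed simp
  qed
  have "inv_half w \<le> (\<integral>\<^sup>+x. liminf (\<lambda>m. s m x) \<partial>lborel)"
    using lim by (rule nn_integral_mono_AE)
  also have "\<dots> \<le> liminf (\<lambda>m. \<integral>\<^sup>+x. s m x \<partial>lborel)"
    by (rule nn_integral_liminf) (rule s_meas)
  also have "\<dots> = liminf (\<lambda>m. inv_energy m f)" unfolding s_int ..
  also have "\<dots> \<le> (SUP m. inv_energy m f)"
    unfolding liminf_SUP_INF by (intro SUP_mono) (auto intro: INF_lower)
  finally show ?thesis .
qed

end

section \<open>From Sobolev regularity to weak derivatives\<close>

abbreviation ip_self :: "(real \<Rightarrow> real) \<Rightarrow> real" where
  "ip_self f \<equiv> ip f f"

lemma ip_commute: "ip f g = ip g f"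
  unfolding ip_def by (simp only: mult.commute)

lemma ip_self_nonneg: "0 \<le> ip f f"
  unfolding ip_def by simp

lemma L2_lincomb:
  assumes "f \<in> L2" "g \<in> L2"
  shows "(\<lambda>x. a * f x + b * g x) \<in> L2"
proof -
  have fg: "integrable circ (\<lambda>x. (f x)\<^sup>2)" "integrable circ (\<lambda>x. (g x)\<^sup>2)"
    and m [measurable]: "f \<in> borel_measurable circ" "g \<in> borel_measurable circ"
    using assms by (auto simp: L2_def)
  have e: "(a * f x + b * g x)\<^sup>2 = a\<^sup>2 * (f x)\<^sup>2 + 2 * a * b * (f x * g x) + b\<^sup>2 * (g x)\<^sup>2" for x
    by (simp add: power2_eq_square algebra_simps)
  have "integrable circ (\<lambda>x. (a * f x + b * g x)\<^sup>2)"
    unfolding e using fg L2_integrable_mult[OF assms] by simp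
  then show ?thesis by (simp add: L2_def)
qed

lemma ip_lincomb:
  assumes "f \<in> L2" "g \<in> L2" "h \<in> L2"
  shows "ip (\<lambda>x. a * f x + b * g x) h = a * ip f h + b * ip g h"
proof -
  have "ip (\<lambda>x. a * f x + b * g x) h = (LINT x|circ. a * (f x * h x) + b * (g x * h x))"
    unfolding ip_def by (simp add: algebra_simps)
  then show ?thesis
    using L2_integrable_mult[OF assms(1,3)] L2_integrable_mult[OF assms(2,3)] by (simp add: ip_def)
qed

lemma ip_diff:
  assumes "f \<in> L2" "g \<in> L2" "h \<in> L2"
  shows "ip (\<lambda>x. f x - g x) h = ip f h - ip g h"
  using ip_lincomb[OF assms, of 1 "-1"] by simp

lemma L2_diff: "f \<in> L2 \<Longrightarrow> g \<in> L2 \<Longrightarrow> (\<lambda>x. f x - g x) \<in> L2"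
  using L2_lincomb[of f g 1 "-1"] by simp

lemma ip_diff_self:
  assumes "f \<in> L2" "g \<in> L2"
  shows "ip_self (\<lambda>x. f x - g x) = ip f f - 2 * ip f g + ip g g"
  using ip_diff[OF assms L2_diff[OF assms]] ip_diff[OF assms assms(1)] ip_diff[OF assms assms(2)]
    ip_commute[of f "\<lambda>x. f x - g x"] ip_commute[of g "\<lambda>x. f x - g x"] ip_commute[of g f] by simp

text \<open>
  The quadratic polynomial \<open>c \<mapsto> ip_self (\<lambda>x. f x - c * g x)\<close> is non-negative; take \<open>c\<close> at its minimum.
\<close>

lemma ip_Cauchy_Schwarz:
  assumes "f \<in> L2" "g \<in> L2"
  shows "(ip f g)\<^sup>2 \<le> ip f f * ip g g"
proof -
  have q: "0 \<le> ip f f - 2 * c * ip f g + c\<^sup>2 * ip g g" for c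
  proof -
    have cg: "(\<lambda>x. c * g x) \<in> L2" using L2_lincomb[OF assms(2,2), of c 0] by simp
    have "ip f (\<lambda>x. c * g x) = c * ip f g" by (rule ip_mult_right)
    moreover have "ip_self (\<lambda>x. c * g x) = c\<^sup>2 * ip g g"
      by (simp add: ip_mult_right ip_commute[of "\<lambda>x. c * g x"] power2_eq_square)
    ultimately show ?thesis
      using ip_diff_self[OF assms(1) cg] ip_self_nonneg[of "\<lambda>x. f x - c * g x"] by simp
  qed
  show ?thesis
  proof (cases "ip g g = 0")
    case True
    have "ip f g = 0"
    proof (rule ccontr)
      \<comment> \<open>If g has norm 0 the polynomial is affine, and this c makes it negative.\<close>
      assume n: "ip f g \<noteq> 0"
      have "2 * ((ip f f + 1) / (2 * ip f g)) * ip f g = ip f f + 1" using n by simp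
      then show False using q[of "(ip f f + 1) / (2 * ip f g)"] True by simp
    qed
    then show ?thesis using True by simp
  next
    case False
    then have p: "ip g g > 0" using ip_self_nonneg[of g] by simp
    have "0 \<le> ip f f - (ip f g)\<^sup>2 / ip g g"
      using q[of "ip f g / ip g g"] p by (simp add: field_simps power2_eq_square)
    then show ?thesis using p by (simp add: field_simps)
  qed
qed

lemma smooth_periodic_C1:
  assumes "smooth_periodic \<phi>"
  shows "(\<phi> has_real_derivative deriv \<phi> x) (at x)" "continuous_on UNIV \<phi>" "continuous_on UNIV (deriv \<phi>)" "\<phi> (1/2) = \<phi> (-1/2)"
proof -
  have d: "(deriv ^^ n) \<phi> differentiable (at x)" for n x using assms by (simp add: smooth_periodic_def)
  have d0: "\<phi> differentiable (at x)" for x using d[of 0] by simp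
  have d1: "deriv \<phi> differentiable (at x)" for x using d[of 1] by simp
  show "(\<phi> has_real_derivative deriv \<phi> x) (at x)"
    using d0[of x] by (simp add: DERIV_deriv_iff_real_differentiable)
  show "continuous_on UNIV \<phi>" "continuous_on UNIV (deriv \<phi>)"
    using d0 d1 by (auto intro!: continuous_at_imp_continuous_on differentiable_imp_continuous_within)
  have "\<phi> (- (1/2) + 1) = \<phi> (- (1/2))" using assms unfolding smooth_periodic_def by blast
  then show "\<phi> (1/2) = \<phi> (-1/2)" by simp
qed

lemma integral_circ_derivative:
  fixes g :: "real \<Rightarrow> real"
  assumes "\<And>x. (g has_real_derivative g' x) (at x)" "continuous_on UNIV g'"
  shows "(LINT x|circ. g' x) = g (1/2) - g (-1/2)"
proof -
  have [measurable]: "g' \<in> borel_measurable borel" using assms(2) by (rule borel_measurable_continuous_onI)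
  have "(LINT x|circ. g' x) = (LINT x|lborel. indicator {-1/2..1/2} x *\<^sub>R g' x)"
    unfolding integral_circ set_lebesgue_integral_def
  proof (rule integral_cong_AE)
    show "AE x in lborel. indicator {-1/2<..1/2} x *\<^sub>R g' x = indicator {-1/2..1/2} x *\<^sub>R g' x"
      using AE_lborel_singleton[of "-1/2"] by eventually_elim (auto simp: indicator_def)
  qed simp_all
  also have "\<dots> = g (1/2) - g (-1/2)"
  proof (rule integral_FTC_Icc)
    show "(g has_vector_derivative g' x) (at x within {-1/2..1/2})" for x
      using has_vector_derivative_at_within[OF assms(1)[of x, unfolded has_real_derivative_iff_has_vector_derivative]] .
    show "continuous_on {-1/2..1/2} g'" by (rule continuous_on_subset[OF assms(2)]) simp
  qed simp
  finally show ?thesis .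
qed

lemma integration_by_parts_circ:
  fixes g \<phi> :: "real \<Rightarrow> real"
  assumes g: "\<And>x. (g has_real_derivative g' x) (at x)" "continuous_on UNIV g'" "g (1/2) = g (-1/2)"
    and p: "\<And>x. (\<phi> has_real_derivative \<phi>' x) (at x)" "continuous_on UNIV \<phi>'" "\<phi> (1/2) = \<phi> (-1/2)"
  shows "ip g' \<phi> = - ip g \<phi>'"
proof -
  have c: "continuous_on UNIV g" "continuous_on UNIV \<phi>"
    using DERIV_isCont[OF g(1)] DERIV_isCont[OF p(1)] by (auto intro: continuous_at_imp_continuous_on)
  have "(LINT x|circ. g' x * \<phi> x + g x * \<phi>' x) = g (1/2) * \<phi> (1/2) - g (-1/2) * \<phi> (-1/2)"
  proof (rule integral_circ_derivative)
    show "((\<lambda>x. g x * \<phi> x) has_real_derivative g' x * \<phi> x + g x * \<phi>' x) (at x)" for x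
      using DERIV_mult[OF g(1)[of x] p(1)[of x]] by (simp add: mult.commute)
    show "continuous_on UNIV (\<lambda>x. g' x * \<phi> x + g x * \<phi>' x)"
      by (intro continuous_on_add continuous_on_mult c g(2) p(2))
  qed
  then have "(LINT x|circ. g' x * \<phi> x + g x * \<phi>' x) = 0" using g(3) p(3) by simp
  moreover have "integrable circ (\<lambda>x. g' x * \<phi> x)" "integrable circ (\<lambda>x. g x * \<phi>' x)"
    by (intro L2_integrable_mult continuous_L2 c g(2) p(2))+
  ultimately show ?thesis by (simp add: ip_def)
qed

lemma integral_circ_cos: "(LINT x|circ. cosn n x) = (if n = 0 then 1 else 0)"
proof (cases "n = 0")
  case True
  interpret circ: prob_space circ by (rule prob_space_circ)
  show ?thesis using True circ.prob_space by simp
next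
  case False
  let ?c = "2 * pi * real n"
  have "(LINT x|circ. cos (?c * x)) = sin (?c * (1/2)) / ?c - sin (?c * (-1/2)) / ?c"
    by (rule integral_circ_derivative) (use False in \<open>auto intro!: derivative_eq_intros continuous_intros\<close>)
  moreover have "sin (?c * (1/2)) = 0" "sin (?c * (-1/2)) = 0"
    using sin_npi[of n] by (simp_all add: mult.commute)
  ultimately show ?thesis using False by simp
qed

lemma continuous_ecos: "continuous_on A (ecos k)"
  unfolding ecos_def[abs_def] by (cases "k = 0") (auto intro!: continuous_intros)

lemma ecos_L2: "ecos k \<in> L2"
  by (rule continuous_L2[OF continuous_ecos])

lemma ip_ecos: "ip (ecos k) (ecos l) = (if k = l then 1 else 0)"
proof -
  have *: "(LINT x|circ. cosn k x * cosn l x) =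
    ((if k + l = 0 then 1 else 0) + (if k = l then 1 else 0)) / 2" if "l \<le> k" for k l
  proof -
    have e: "cosn k x * cosn l x =
        1/2 * cosn (k + l) x + 1/2 * cosn (k - l) x" for x
    proof -
      have "2 * pi * real (k + l) * x = 2 * pi * real k * x + 2 * pi * real l * x"
        "2 * pi * real (k - l) * x = 2 * pi * real k * x - 2 * pi * real l * x"
        using that by (simp_all add: algebra_simps of_nat_diff)
      then show ?thesis by (simp only: cos_add cos_diff) (simp add: field_simps)
    qed
    have i: "integrable circ (\<lambda>x. cosn n x)" for n
      by (rule L2_integrable[OF cos_sin_L2(1)])
    have "(LINT x|circ. cosn k x * cosn l x) =
      1/2 * (LINT x|circ. cosn (k + l) x) + 1/2 * (LINT x|circ. cosn (k - l) x)"
      unfolding e using i[of "k + l"] i[of "k - l"] by (simp del: of_nat_add)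
    then show ?thesis using that unfolding integral_circ_cos by auto
  qed
  have **: "(LINT x|circ. cosn k x * cosn l x) =
    ((if k + l = 0 then 1 else 0) + (if k = l then 1 else 0)) / 2"
    using *[of l k] *[of k l] by (cases "l \<le> k") (auto simp: mult.commute)
  define r where "r k = (if k = 0 then 1 else sqrt 2 :: real)" for k :: nat
  have ec: "ecos k x = r k * cosn k x" for k x by (simp add: ecos_def r_def)
  have "ip (ecos k) (ecos l) = (LINT x|circ. r k * r l * (cosn k x * cosn l x))"
    unfolding ip_def ec by (simp add: mult_ac)
  also have "\<dots> = r k * r l * (((if k + l = 0 then 1 else 0) + (if k = l then 1 else 0)) / 2)"
    unfolding integral_mult_right_zero ** ..
  finally show ?thesis by (cases "k = l"; cases "k = 0") (simp_all add: r_def)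
qed

lemma L2_sum: "finite A \<Longrightarrow> (\<And>k. k \<in> A \<Longrightarrow> u k \<in> L2) \<Longrightarrow> (\<lambda>x. \<Sum>k\<in>A. c k * u k x) \<in> L2"
proof (induction A rule: finite_induct)
  case empty
  then show ?case using continuous_L2[of "\<lambda>_. 0"] by simp
next
  case (insert k A)
  then have "(\<lambda>x. c k * u k x + 1 * (\<Sum>k\<in>A. c k * u k x)) \<in> L2" by (intro L2_lincomb) auto
  then show ?case using insert by simp
qed

lemma ip_sum:
  assumes "finite A" "\<And>k. k \<in> A \<Longrightarrow> u k \<in> L2" "h \<in> L2"
  shows "ip (\<lambda>x. \<Sum>k\<in>A. c k * u k x) h = (\<Sum>k\<in>A. c k * ip (u k) h)"
  using assms(1,2)
proof (induction A rule: finite_induct)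
  case empty
  then show ?case by (simp add: ip_def)
next
  case (insert k A)
  then have "ip (\<lambda>x. c k * u k x + 1 * (\<Sum>k\<in>A. c k * u k x)) h = c k * ip (u k) h + 1 * ip (\<lambda>x. \<Sum>k\<in>A. c k * u k x) h"
    by (intro ip_lincomb L2_sum assms(3)) auto
  then show ?case using insert by simp
qed

abbreviation dist_sq :: "(real \<Rightarrow> real) \<Rightarrow> (real \<Rightarrow> real) \<Rightarrow> real" where
  "dist_sq f g \<equiv> ip_self (\<lambda>x. f x - g x)"

text \<open>
  A subsequence with geometrically decreasing increments converges almost everywhere; Fatou's lemma
  bounds the distance of \<open>S n\<close> to the limit by the Cauchy modulus.
\<close>

lemma Riesz_Fischer:
  fixes S :: "nat \<Rightarrow> real \<Rightarrow> real"
  assumes S: "\<And>n. S n \<in> L2"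
    and cauchy: "\<And>e. 0 < e \<Longrightarrow> \<exists>N. \<forall>m\<ge>N. \<forall>n\<ge>N. dist_sq (S m) (S n) \<le> e"
  obtains v where "v \<in> L2" "(\<lambda>n. dist_sq (S n) v) \<longlonglongrightarrow> 0"
proof -
  interpret circ: prob_space circ by (rule prob_space_circ)
  have [measurable]: "S n \<in> borel_measurable circ" for n using S by (simp add: L2_def)
  have sq: "(\<integral>\<^sup>+x. ennreal ((f x)\<^sup>2) \<partial>circ) = ennreal (ip f f)" if "f \<in> L2" for f
  proof -
    have "(\<integral>\<^sup>+x. ennreal ((f x)\<^sup>2) \<partial>circ) = ennreal (LINT x|circ. (f x)\<^sup>2)"
      using that by (intro nn_integral_eq_integral) (auto simp: L2_def)
    then show ?thesis by (simp add: ip_def power2_eq_square)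
  qed
  have "\<exists>N. \<forall>m\<ge>N. \<forall>n\<ge>N. dist_sq (S m) (S n) \<le> (1/4) ^ j" for j :: nat
    by (rule cauchy) simp
  then obtain N where N: "\<And>j m n. N j \<le> m \<Longrightarrow> N j \<le> n \<Longrightarrow> dist_sq (S m) (S n) \<le> (1/4) ^ j"
    by metis
  define r where "r j = (MAX i\<in>{..j}. N i) + j" for j
  have r: "N j \<le> r j" "r j \<le> r (Suc j)" "j \<le> r j" for j
  proof -
    have "N j \<le> (MAX i\<in>{..j}. N i)" by (rule Max_ge) auto
    then show "N j \<le> r j" unfolding r_def by (rule trans_le_add1)
    have "(MAX i\<in>{..j}. N i) \<le> (MAX i\<in>{..Suc j}. N i)" by (rule Max_mono) auto
    then show "r j \<le> r (Suc j)" unfolding r_def by linarith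
    show "j \<le> r j" by (simp add: r_def)
  qed
  define D where "D j x = \<bar>S (r (Suc j)) x - S (r j) x\<bar>" for j x
  have [measurable]: "D j \<in> borel_measurable circ" for j unfolding D_def by measurable
  have Dint: "(\<integral>\<^sup>+x. ennreal (D j x) \<partial>circ) \<le> ennreal ((1/2) ^ j)" for j
  proof -
    \<comment> \<open>Weighted AM-GM in place of Cauchy-Schwarz to pass from L2 to L1.\<close>
    have p: "D j x \<le> 1/2 * (1/2) ^ j + 1/2 * 2 ^ j * (D j x)\<^sup>2" for x
    proof -
      have "0 \<le> 2 ^ j * (D j x - (1/2) ^ j)\<^sup>2" by simp
      also have "\<dots> = 2 ^ j * (D j x)\<^sup>2 - 2 * ((2 * (1/2)) ^ j) * D j x + (2 * (1/2)) ^ j * (1/2) ^ j"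
        unfolding power_mult_distrib by (simp add: power2_eq_square algebra_simps)
      also have "\<dots> = 2 ^ j * (D j x)\<^sup>2 - 2 * D j x + (1/2) ^ j" by simp
      finally show ?thesis by simp
    qed
    have "(\<integral>\<^sup>+x. ennreal (D j x) \<partial>circ) \<le> (\<integral>\<^sup>+x. ennreal (1/2 * (1/2) ^ j) + ennreal (1/2 * 2 ^ j) * ennreal ((D j x)\<^sup>2) \<partial>circ)"
    proof (rule nn_integral_mono)
      fix x
      have "ennreal (D j x) \<le> ennreal (1/2 * (1/2) ^ j + 1/2 * 2 ^ j * (D j x)\<^sup>2)" by (rule ennreal_leI[OF p])
      also have "\<dots> = ennreal (1/2 * (1/2) ^ j) + ennreal (1/2 * 2 ^ j) * ennreal ((D j x)\<^sup>2)"
        by (subst ennreal_plus) (simp_all add: ennreal_mult[symmetric])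
      finally show "ennreal (D j x) \<le> ennreal (1/2 * (1/2) ^ j) + ennreal (1/2 * 2 ^ j) * ennreal ((D j x)\<^sup>2)" .
    qed
    also have "\<dots> = (\<integral>\<^sup>+x. ennreal (1/2 * (1/2) ^ j) \<partial>circ) + ennreal (1/2 * 2 ^ j) * (\<integral>\<^sup>+x. ennreal ((D j x)\<^sup>2) \<partial>circ)"
      by (subst nn_integral_add) (simp_all add: nn_integral_cmult)
    also have "(\<integral>\<^sup>+x. ennreal (1/2 * (1/2) ^ j) \<partial>circ) = ennreal (1/2 * (1/2) ^ j)"
      by (simp add: circ.emeasure_space_1)
    also have "(\<integral>\<^sup>+x. ennreal ((D j x)\<^sup>2) \<partial>circ) \<le> ennreal ((1/4) ^ j)"
    proof -
      have "(\<integral>\<^sup>+x. ennreal ((D j x)\<^sup>2) \<partial>circ) = ennreal (ip (\<lambda>x. S (r (Suc j)) x - S (r j) x) (\<lambda>x. S (r (Suc j)) x - S (r j) x))"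
        unfolding D_def power2_abs by (rule sq[OF L2_diff[OF S S]])
      also have "\<dots> \<le> ennreal ((1/4) ^ j)"
        using r(1)[of j] r(2)[of j] by (intro ennreal_leI N) auto
      finally show ?thesis .
    qed
    finally have "(\<integral>\<^sup>+x. ennreal (D j x) \<partial>circ) \<le> ennreal (1/2 * (1/2) ^ j) + ennreal (1/2 * 2 ^ j) * ennreal ((1/4) ^ j)"
      by (simp add: mult_left_mono)
    also have "\<dots> = ennreal (1/2 * (1/2) ^ j + 1/2 * 2 ^ j * (1/4) ^ j)"
      by (subst ennreal_plus) (simp_all add: ennreal_mult[symmetric])
    also have "1/2 * (1/2) ^ j + 1/2 * 2 ^ j * (1/4) ^ j = (1/2 :: real) ^ j"
      using power_mult_distrib[of "2::real" "1/4" j] by simp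
    finally show ?thesis .
  qed
  have "(\<integral>\<^sup>+x. (\<Sum>j. ennreal (D j x)) \<partial>circ) = (\<Sum>j. \<integral>\<^sup>+x. ennreal (D j x) \<partial>circ)"
    by (rule nn_integral_suminf) simp
  also have "\<dots> \<le> (\<Sum>j. ennreal ((1/2) ^ j))"
    by (rule suminf_le[OF Dint]) auto
  also have "\<dots> = ennreal (\<Sum>j. (1/2) ^ j)"
    by (rule suminf_ennreal2) auto
  also have "\<dots> < \<infinity>" by simp
  finally have "AE x in circ. (\<Sum>j. ennreal (D j x)) \<noteq> \<infinity>"
    by (intro nn_integral_noteq_infinite) auto
  then have conv: "AE x in circ. convergent (\<lambda>j. S (r j) x)"
  proof eventually_elim
    case (elim x)
    have "summable (\<lambda>j. D j x)"
      using elim by (intro summable_suminf_not_top) (auto simp: D_def)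
    then have "summable (\<lambda>j. S (r (Suc j)) x - S (r j) x)"
      unfolding D_def by (rule summable_rabs_cancel)
    then have "convergent (\<lambda>n. \<Sum>j<n. S (r (Suc j)) x - S (r j) x)" by (simp add: summable_iff_convergent)
    then have "convergent (\<lambda>n. S (r n) x - S (r 0) x)"
      by (simp add: sum_lessThan_telescope[of "\<lambda>j. S (r j) x"])
    then show "convergent (\<lambda>j. S (r j) x)"
      using convergent_add[OF _ convergent_const[of "S (r 0) x"], of "\<lambda>n. S (r n) x - S (r 0) x"] by simp
  qed
  define v where "v x = lim (\<lambda>j. S (r j) x)" for x
  have [measurable]: "v \<in> borel_measurable circ" unfolding v_def by measurable
  have lim: "AE x in circ. (\<lambda>j. S (r j) x) \<longlonglongrightarrow> v x"
    using conv by eventually_elim (simp add: v_def convergent_LIMSEQ_iff)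
  have fatou: "(\<integral>\<^sup>+x. ennreal ((S n x - v x)\<^sup>2) \<partial>circ) \<le> ennreal e"
    if "0 \<le> e" and M: "\<And>m. M \<le> m \<Longrightarrow> dist_sq (S n) (S m) \<le> e" for n M e
  proof -
    have "(\<integral>\<^sup>+x. ennreal ((S n x - v x)\<^sup>2) \<partial>circ) = (\<integral>\<^sup>+x. liminf (\<lambda>j. ennreal ((S n x - S (r j) x)\<^sup>2)) \<partial>circ)"
    proof (rule nn_integral_cong_AE)
      show "AE x in circ. ennreal ((S n x - v x)\<^sup>2) = liminf (\<lambda>j. ennreal ((S n x - S (r j) x)\<^sup>2))"
        using lim
      proof eventually_elim
        case (elim x)
        have "(\<lambda>j. ennreal ((S n x - S (r j) x)\<^sup>2)) \<longlonglongrightarrow> ennreal ((S n x - v x)\<^sup>2)"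
          by (intro tendsto_ennrealI tendsto_power tendsto_diff tendsto_const elim)
        then show ?case by (intro lim_imp_Liminf[symmetric]) auto
      qed
    qed
    also have "\<dots> \<le> liminf (\<lambda>j. \<integral>\<^sup>+x. ennreal ((S n x - S (r j) x)\<^sup>2) \<partial>circ)"
      by (rule nn_integral_liminf) simp
    also have "\<dots> \<le> ennreal e"
    proof (rule Liminf_le)
      show "\<forall>\<^sub>F j in sequentially. (\<integral>\<^sup>+x. ennreal ((S n x - S (r j) x)\<^sup>2) \<partial>circ) \<le> ennreal e"
        using eventually_ge_at_top[of M]
      proof eventually_elim
        case (elim j)
        then have "M \<le> r j" using r(3)[of j] by simp
        then show ?case unfolding sq[OF L2_diff[OF S S]] by (intro ennreal_leI M)
      qed
    qed simp
    finally show ?thesis .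
  qed
  have SvL: "(\<lambda>x. S n x - v x) \<in> L2" if "n \<ge> N 0" for n
  proof -
    have "(\<integral>\<^sup>+x. ennreal ((S n x - v x)\<^sup>2) \<partial>circ) \<le> ennreal 1"
      by (rule fatou[of 1 "N 0"]) (use N[of 0 n] that in auto)
    then have "(\<integral>\<^sup>+x. ennreal ((S n x - v x)\<^sup>2) \<partial>circ) < \<infinity>" by (rule le_less_trans) simp
    then have "integrable circ (\<lambda>x. (S n x - v x)\<^sup>2)"
      by (intro integrableI_nonneg) auto
    then show ?thesis by (simp add: L2_def)
  qed
  have vL: "v \<in> L2"
    using L2_diff[OF S[of "N 0"] SvL[of "N 0"]] by simp
  have "(\<lambda>n. dist_sq (S n) v) \<longlonglongrightarrow> 0"
  proof (rule LIMSEQ_I)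
    fix e :: real assume e: "0 < e"
    obtain M where M: "\<And>m n. M \<le> m \<Longrightarrow> M \<le> n \<Longrightarrow> dist_sq (S m) (S n) \<le> e / 2"
      using cauchy[of "e / 2"] e by auto
    show "\<exists>no. \<forall>n\<ge>no. norm (dist_sq (S n) v - 0) < e"
    proof (intro exI[of _ M] allI impI)
      fix n assume n: "M \<le> n"
      have "ennreal (dist_sq (S n) v) \<le> ennreal (e / 2)"
        unfolding sq[OF L2_diff[OF S vL], symmetric] by (rule fatou[of _ M]) (use e M n in auto)
      then have "dist_sq (S n) v \<le> e / 2" using e by (simp add: ennreal_le_iff)
      then show "norm (dist_sq (S n) v - 0) < e"
        using e ip_self_nonneg[of "\<lambda>x. S n x - v x"] by simp
    qed
  qed
  with vL show thesis by (rule that)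
qed

lemma ip_tendsto:
  assumes S: "\<And>n. S n \<in> L2" "v \<in> L2" "\<phi> \<in> L2"
    and lim: "(\<lambda>n. dist_sq (S n) v) \<longlonglongrightarrow> 0"
  shows "(\<lambda>n. ip (S n) \<phi>) \<longlonglongrightarrow> ip v \<phi>"
proof -
  have "(\<lambda>n. sqrt (dist_sq (S n) v * ip \<phi> \<phi>)) \<longlonglongrightarrow> sqrt (0 * ip \<phi> \<phi>)"
    by (intro tendsto_real_sqrt tendsto_mult lim tendsto_const)
  then have "(\<lambda>n. sqrt (dist_sq (S n) v * ip \<phi> \<phi>)) \<longlonglongrightarrow> 0" by simp
  then have "(\<lambda>n. ip (S n) \<phi> - ip v \<phi>) \<longlonglongrightarrow> 0"
  proof (rule Lim_null_comparison[rotated])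
    show "\<forall>\<^sub>F n in sequentially. norm (ip (S n) \<phi> - ip v \<phi>) \<le> sqrt (dist_sq (S n) v * ip \<phi> \<phi>)"
    proof (rule always_eventually, rule allI)
      fix n
      have "(ip (S n) \<phi> - ip v \<phi>)\<^sup>2 \<le> dist_sq (S n) v * ip \<phi> \<phi>"
        using ip_Cauchy_Schwarz[OF L2_diff[OF S(1) S(2)] S(3)] unfolding ip_diff[OF S(1) S(2) S(3)] .
      then show "norm (ip (S n) \<phi> - ip v \<phi>) \<le> sqrt (dist_sq (S n) v * ip \<phi> \<phi>)"
        using real_sqrt_le_mono real_sqrt_abs by fastforce
    qed
  qed
  then show ?thesis by (rule LIM_zero_cancel)
qed

text \<open>
  The first order Sobolev norm controls the sum of the absolute coefficients, as \<open>2 * \<bar>a k\<bar>\<close> is at most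
  \<open>1 / k\<^sup>2 + k\<^sup>2 * (a k)\<^sup>2\<close>.
\<close>

lemma hsq_1_summable:
  assumes "hsq 1 a < \<infinity>"
  shows "summable (\<lambda>k. (real k * a k)\<^sup>2)" "summable (\<lambda>k. \<bar>a k\<bar>)"
proof -
  define b where "b k = real (max k 1) powr 2 * (a k)\<^sup>2" for k
  have "(\<Sum>k. ennreal (b k)) \<noteq> \<top>" using assms by (simp add: hsq_def b_def)
  then have b: "summable b"
    by (intro summable_suminf_not_top) (simp_all add: b_def)
  have bk: "(real k * a k)\<^sup>2 \<le> b k" for k
  proof -
    have "(real k * a k)\<^sup>2 \<le> (real (max k 1))\<^sup>2 * (a k)\<^sup>2"
      unfolding power_mult_distrib by (intro mult_right_mono power_mono) auto
    also have "\<dots> = b k" by (simp add: b_def powr_numeral)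
    finally show ?thesis .
  qed
  show "summable (\<lambda>k. (real k * a k)\<^sup>2)"
    by (rule summable_comparison_test_ev[OF _ b]) (use bk in simp)
  have inv: "summable (\<lambda>k. inverse ((real k)\<^sup>2))"
    by (rule inverse_power_summable) simp
  show "summable (\<lambda>k. \<bar>a k\<bar>)"
  proof (rule summable_comparison_test_ev[OF _ summable_add[OF inv b]])
    show "\<forall>\<^sub>F k in sequentially. norm \<bar>a k\<bar> \<le> inverse ((real k)\<^sup>2) + b k"
      using eventually_gt_at_top[of 0]
    proof eventually_elim
      case (elim k)
      have "2 * (1 / real k) * (real k * \<bar>a k\<bar>) \<le> (1 / real k)\<^sup>2 + (real k * \<bar>a k\<bar>)\<^sup>2"
        by (rule sum_squares_bound)
      moreover have "2 * (1 / real k) * (real k * \<bar>a k\<bar>) = 2 * \<bar>a k\<bar>" using elim by simp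
      moreover have "(real k * \<bar>a k\<bar>)\<^sup>2 \<le> b k" using bk[of k] by (simp add: power_mult_distrib)
      moreover have "(1 / real k)\<^sup>2 = inverse ((real k)\<^sup>2)" by (simp add: power_divide inverse_eq_divide)
      ultimately have "2 * \<bar>a k\<bar> \<le> inverse ((real k)\<^sup>2) + b k" by simp
      then show ?case by simp
    qed
  qed
qed

definition ecos' :: "nat \<Rightarrow> real \<Rightarrow> real" where
  "ecos' k x = - (if k = 0 then 0 else sqrt 2 * (2 * pi * real k) * sinn k x)"

lemma ecos_deriv: "(ecos k has_real_derivative ecos' k x) (at x)"
  unfolding ecos_def[abs_def] ecos'_def by (cases "k = 0") (auto intro!: derivative_eq_intros)

lemma ecos'_deriv: "(ecos' k has_real_derivative - (2 * pi * real k)\<^sup>2 * ecos k x) (at x)"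
  unfolding ecos_def ecos'_def[abs_def] by (cases "k = 0") (auto intro!: derivative_eq_intros simp: power2_eq_square)

lemma ecos_periodic: "ecos k (1/2) = ecos k (-1/2)" "ecos' k (1/2) = ecos' k (-1/2)"
proof -
  have "sin (pi * real k) = 0" using sin_npi[of k] by (simp add: mult.commute)
  then show "ecos k (1/2) = ecos k (-1/2)" "ecos' k (1/2) = ecos' k (-1/2)"
    by (simp_all add: ecos_def ecos'_def)
qed

lemma continuous_ecos': "continuous_on A (ecos' k)"
  unfolding ecos'_def[abs_def] by (cases "k = 0") (auto intro!: continuous_intros)

lemma ecos'_L2: "ecos' k \<in> L2"
  by (rule continuous_L2[OF continuous_ecos'])

text \<open>
  Integrating by parts moves both derivatives to one factor, an eigenfunction of the second derivative.
\<close>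

lemma ip_ecos': "ip (ecos' k) (ecos' l) = (if k = l then (2 * pi * real k)\<^sup>2 else 0)"
proof -
  have "ip (ecos' k) (ecos' l) = - ip (ecos k) (\<lambda>x. - (2 * pi * real l)\<^sup>2 * ecos l x)"
    by (rule integration_by_parts_circ[OF ecos_deriv continuous_ecos' ecos_periodic(1) ecos'_deriv _ ecos_periodic(2)])
      (intro continuous_on_mult continuous_on_const continuous_ecos)
  then show ?thesis unfolding ip_mult_right ip_ecos by simp
qed

text \<open>
  The partial sums \<open>S n\<close> of the differentiated cosine series are orthogonal sums with square-summable
  coefficients and converge in \<open>L2\<close> to some \<open>v\<close>. The partial sums \<open>fn n\<close> of the series itself converge
  uniformly to an even function \<open>ft\<close> with the same cosine coefficients as \<open>f\<close>, hence equal to \<open>f\<close>. Passing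
  to the limit in the integration by parts between \<open>S n\<close> and \<open>fn n\<close> shows that \<open>v\<close> is a weak derivative.
\<close>

lemma has_weak_deriv_of_hsq:
  assumes f: "f \<in> L2" and ev: "AE x in circ. f (- x) = f x" and h: "hsq 1 (coef f) < \<infinity>"
  shows "\<exists>v. has_weak_deriv f v"
proof -
  define a where "a = coef f"
  have sum1: "summable (\<lambda>k. (real k * a k)\<^sup>2)" and sum2: "summable (\<lambda>k. \<bar>a k\<bar>)"
    using hsq_1_summable[OF h] by (simp_all add: a_def)
  define fn where "fn n x = (\<Sum>k<n. a k * ecos k x)" for n x
  define S where "S n x = (\<Sum>k<n. a k * ecos' k x)" for n x
  have SL: "S n \<in> L2" for n unfolding S_def[abs_def] by (intro L2_sum ecos'_L2) simp
  have cauchy: "\<exists>N. \<forall>m\<ge>N. \<forall>n\<ge>N. dist_sq (S m) (S n) \<le> e" if e: "0 < e" for e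
  proof -
    have orth: "ip_self (\<lambda>x. \<Sum>k\<in>A. a k * ecos' k x) = (2 * pi)\<^sup>2 * (\<Sum>k\<in>A. (real k * a k)\<^sup>2)"
      if A: "finite A" for A
    proof -
      have L: "(\<lambda>x. \<Sum>k\<in>A. a k * ecos' k x) \<in> L2" by (intro L2_sum A ecos'_L2)
      have "ip_self (\<lambda>x. \<Sum>k\<in>A. a k * ecos' k x) =
        (\<Sum>k\<in>A. a k * ip (ecos' k) (\<lambda>x. \<Sum>k\<in>A. a k * ecos' k x))"
        by (rule ip_sum[OF A ecos'_L2 L])
      also have "\<dots> = (\<Sum>k\<in>A. a k * (\<Sum>l\<in>A. a l * ip (ecos' l) (ecos' k)))"
      proof (rule sum.cong[OF refl])
        fix k
        have "ip (ecos' k) (\<lambda>x. \<Sum>k\<in>A. a k * ecos' k x) = (\<Sum>l\<in>A. a l * ip (ecos' l) (ecos' k))"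
          unfolding ip_commute[of "ecos' k"] by (rule ip_sum[OF A ecos'_L2 ecos'_L2])
        then show "a k * ip (ecos' k) (\<lambda>x. \<Sum>k\<in>A. a k * ecos' k x) = a k * (\<Sum>l\<in>A. a l * ip (ecos' l) (ecos' k))"
          by simp
      qed
      also have "\<dots> = (\<Sum>k\<in>A. a k * (a k * (2 * pi * real k)\<^sup>2))"
      proof (rule sum.cong[OF refl])
        fix k assume k: "k \<in> A"
        have "(\<Sum>l\<in>A. a l * ip (ecos' l) (ecos' k)) = (\<Sum>l\<in>A. if l = k then a k * (2 * pi * real k)\<^sup>2 else 0)"
          by (rule sum.cong) (auto simp: ip_ecos')
        also have "\<dots> = a k * (2 * pi * real k)\<^sup>2" using A k by simp
        finally show "a k * (\<Sum>l\<in>A. a l * ip (ecos' l) (ecos' k)) = a k * (a k * (2 * pi * real k)\<^sup>2)" by simp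
      qed
      also have "\<dots> = (2 * pi)\<^sup>2 * (\<Sum>k\<in>A. (real k * a k)\<^sup>2)"
        unfolding sum_distrib_left by (intro sum.cong) (auto simp: power2_eq_square)
      finally show ?thesis .
    qed
    have "e / (2 * pi)\<^sup>2 > 0" using e by simp
    then obtain N where N: "\<And>m n. N \<le> m \<Longrightarrow> norm (\<Sum>k=m..<n. (real k * a k)\<^sup>2) < e / (2 * pi)\<^sup>2"
      using sum1[unfolded summable_Cauchy, rule_format, of "e / (2 * pi)\<^sup>2"] by auto
    have le: "dist_sq (S m) (S n) \<le> e" if "N \<le> n" "n \<le> m" for m n
    proof -
      have "S m x - S n x = (\<Sum>k=n..<m. a k * ecos' k x)" for x
        unfolding S_def using sum_diff_nat_ivl[of 0 n m "\<lambda>k. a k * ecos' k x"] that by (simp add: lessThan_atLeast0)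
      then have "dist_sq (S m) (S n) = (2 * pi)\<^sup>2 * (\<Sum>k=n..<m. (real k * a k)\<^sup>2)"
        by (simp add: orth)
      also have "\<dots> \<le> (2 * pi)\<^sup>2 * (e / (2 * pi)\<^sup>2)"
        using N[OF that(1), of m] by (intro mult_left_mono) auto
      also have "\<dots> = e" by simp
      finally show ?thesis .
    qed
    have sym: "dist_sq (S m) (S n) = dist_sq (S n) (S m)" for m n
      unfolding ip_def by (intro Bochner_Integration.integral_cong) (simp_all add: algebra_simps)
    show ?thesis
    proof (intro exI[of _ N] allI impI)
      fix m n assume "N \<le> m" "N \<le> n"
      then show "dist_sq (S m) (S n) \<le> e"
        using le[of n m] le[of m n] sym[of m n] by (cases "n \<le> m") auto
    qed
  qed
  obtain v where v: "v \<in> L2" "(\<lambda>n. dist_sq (S n) v) \<longlonglongrightarrow> 0"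
    by (rule Riesz_Fischer[OF SL cauchy]) (assumption, rule that)
  define ft where "ft x = (\<Sum>k. a k * ecos k x)" for x
  define C where "C = sqrt 2 * (\<Sum>k. \<bar>a k\<bar>)"
  have eb: "\<bar>ecos k x\<bar> \<le> sqrt 2" for k x
    unfolding ecos_def by (auto simp: abs_mult mult_left_le)
  have bnd: "norm (a k * ecos k x) \<le> sqrt 2 * \<bar>a k\<bar>" for k x
    using mult_left_mono[OF eb[of k x], of "\<bar>a k\<bar>"] by (simp add: abs_mult mult.commute)
  have fn_lim: "(\<lambda>n. fn n x) \<longlonglongrightarrow> ft x" for x
  proof -
    have "summable (\<lambda>k. a k * ecos k x)"
      by (rule summable_comparison_test_ev[OF _ summable_mult[OF sum2, of "sqrt 2"]]) (use bnd in simp)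
    then show ?thesis unfolding fn_def ft_def by (rule summable_LIMSEQ)
  qed
  have fn_bound: "\<bar>fn n x\<bar> \<le> C" for n x
  proof -
    have "\<bar>fn n x\<bar> \<le> (\<Sum>k<n. sqrt 2 * \<bar>a k\<bar>)"
      unfolding fn_def by (rule order_trans[OF sum_abs]) (intro sum_mono, use bnd in simp)
    also have "\<dots> = sqrt 2 * (\<Sum>k<n. \<bar>a k\<bar>)" by (simp add: sum_distrib_left)
    also have "\<dots> \<le> C"
      unfolding C_def by (intro mult_left_mono sum_le_suminf sum2) auto
    finally show ?thesis .
  qed
  have cfn: "continuous_on UNIV (fn n)" for n
    unfolding fn_def[abs_def] by (intro continuous_on_sum continuous_on_mult continuous_on_const continuous_ecos)
  have [measurable]: "fn n \<in> borel_measurable circ" for n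
    by (intro borel_measurable_circ borel_measurable_continuous_onI cfn)
  have [measurable]: "ft \<in> borel_measurable circ"
    by (rule borel_measurable_LIMSEQ_real[OF fn_lim]) simp
  interpret circ: prob_space circ by (rule prob_space_circ)
  have ft_bound: "\<bar>ft x\<bar> \<le> C" for x
    by (rule LIMSEQ_le_const2[OF tendsto_rabs[OF fn_lim]]) (use fn_bound in auto)
  have "integrable circ (\<lambda>x. (ft x)\<^sup>2)"
  proof (rule circ.integrable_const_bound[where B = "C\<^sup>2"])
    show "AE x in circ. norm ((ft x)\<^sup>2) \<le> C\<^sup>2"
    proof (rule AE_I2)
      fix x
      have "\<bar>ft x\<bar>\<^sup>2 \<le> C\<^sup>2" by (rule power_mono[OF ft_bound]) simp
      then show "norm ((ft x)\<^sup>2) \<le> C\<^sup>2" by simp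
    qed
  qed simp
  then have ftL: "ft \<in> L2" by (simp add: L2_def)
  have fnL: "fn n \<in> L2" for n by (rule continuous_L2[OF cfn])
  have ip_lim: "(\<lambda>n. ip (fn n) \<psi>) \<longlonglongrightarrow> ip ft \<psi>" if psi: "\<psi> \<in> L2" for \<psi>
    unfolding ip_def
  proof (rule integral_dominated_convergence[where w = "\<lambda>x. C * \<bar>\<psi> x\<bar>"])
    have [measurable]: "\<psi> \<in> borel_measurable circ" using psi by (simp add: L2_def)
    show "(\<lambda>x. ft x * \<psi> x) \<in> borel_measurable circ" "\<And>n. (\<lambda>x. fn n x * \<psi> x) \<in> borel_measurable circ"
      by simp_all
    show "integrable circ (\<lambda>x. C * \<bar>\<psi> x\<bar>)" by (intro integrable_mult_right integrable_abs L2_integrable psi)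
    show "AE x in circ. (\<lambda>n. fn n x * \<psi> x) \<longlonglongrightarrow> ft x * \<psi> x"
      by (intro AE_I2 tendsto_mult fn_lim tendsto_const)
    show "AE x in circ. norm (fn n x * \<psi> x) \<le> C * \<bar>\<psi> x\<bar>" for n
      by (intro AE_I2) (simp add: abs_mult mult_right_mono fn_bound)
  qed
  have coef_ft: "ip ft (ecos l) = a l" for l
  proof (rule LIMSEQ_unique[OF ip_lim[OF ecos_L2]])
    show "(\<lambda>n. ip (fn n) (ecos l)) \<longlonglongrightarrow> a l"
    proof (rule tendsto_eventually)
      show "\<forall>\<^sub>F n in sequentially. ip (fn n) (ecos l) = a l"
        using eventually_gt_at_top[of l]
      proof eventually_elim
        case (elim n)
        have "ip (fn n) (ecos l) = (\<Sum>k<n. a k * ip (ecos k) (ecos l))"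
          unfolding fn_def[abs_def] by (rule ip_sum[OF _ ecos_L2 ecos_L2]) simp
        also have "\<dots> = (\<Sum>k<n. if k = l then a l else 0)" by (rule sum.cong) (auto simp: ip_ecos)
        also have "\<dots> = a l" using elim by simp
        finally show ?case .
      qed
    qed
  qed
  have eq: "AE x in circ. f x = ft x"
  proof -
    have "AE x in circ. (f x - ft x) + (f (- x) - ft (- x)) = 0"
    proof (rule AE_odd_of_cosine_orthogonal)
      show "integrable circ (\<lambda>x. f x - ft x)" by (rule L2_integrable[OF L2_diff[OF f ftL]])
      fix k
      have "ip (\<lambda>x. f x - ft x) (ecos k) = 0"
        unfolding ip_diff[OF f ftL ecos_L2] coef_ft by (simp add: a_def coef_def)
      moreover have "ecos k = (\<lambda>x. (if k = 0 then 1 else sqrt 2) * cosn k x)"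
        by (auto simp: ecos_def)
      ultimately have "(if k = 0 then 1 else sqrt 2) * ip (\<lambda>x. f x - ft x) (\<lambda>x. cosn k x) = 0"
        by (simp only: ip_mult_right)
      then show "(LINT x|circ. (f x - ft x) * cosn k x) = 0"
        by (simp add: ip_def split: if_splits)
    qed
    then show ?thesis using ev
    proof eventually_elim
      case (elim x)
      have "ecos k (- x) = ecos k x" for k by (simp add: ecos_def)
      then have "ft (- x) = ft x" by (simp add: ft_def)
      then show ?case using elim by simp
    qed
  qed
  have "has_weak_deriv f v"
    unfolding has_weak_deriv_def
  proof (intro conjI allI impI v(1))
    fix \<phi> assume "smooth_periodic \<phi>"
    note p = smooth_periodic_C1[OF this]
    have pL: "\<phi> \<in> L2" "deriv \<phi> \<in> L2" by (intro continuous_L2 p)+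
    have parts: "ip (S n) \<phi> = - ip (fn n) (deriv \<phi>)" for n
    proof (rule integration_by_parts_circ[OF _ _ _ p(1,3,4)])
      show "(fn n has_real_derivative S n x) (at x)" for x
        unfolding fn_def[abs_def] S_def by (intro DERIV_sum DERIV_cmult ecos_deriv)
      show "continuous_on UNIV (S n)"
        unfolding S_def[abs_def] by (intro continuous_on_sum continuous_on_mult continuous_on_const continuous_ecos')
      show "fn n (1/2) = fn n (-1/2)" unfolding fn_def ecos_periodic(1) ..
    qed
    have "(\<lambda>n. ip (S n) \<phi>) \<longlonglongrightarrow> ip v \<phi>" by (rule ip_tendsto[OF SL v(1) pL(1) v(2)])
    moreover have "(\<lambda>n. ip (S n) \<phi>) \<longlonglongrightarrow> - ip ft (deriv \<phi>)"
      unfolding parts by (intro tendsto_minus ip_lim pL)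
    ultimately have "ip v \<phi> = - ip ft (deriv \<phi>)" by (rule LIMSEQ_unique)
    moreover have "ip f (deriv \<phi>) = ip ft (deriv \<phi>)"
      unfolding ip_def
    proof (rule integral_cong_AE)
      show "AE x in circ. f x * deriv \<phi> x = ft x * deriv \<phi> x" using eq by eventually_elim simp
      show "(\<lambda>x. f x * deriv \<phi> x) \<in> borel_measurable circ" "(\<lambda>x. ft x * deriv \<phi> x) \<in> borel_measurable circ"
        using L2_integrable_mult[OF f pL(2)] L2_integrable_mult[OF ftL pL(2)] by auto
    qed
    ultimately show "ip f (deriv \<phi>) = - ip v \<phi>" by simp
  qed
  then show ?thesis by blast
qed

section \<open>Regularity of almost every path at almost every time\<close>

lemma nn_integral_cmult_ge: "c * integral\<^sup>N M f \<le> (\<integral>\<^sup>+x. c * f x \<partial>M)"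
proof -
  have "c * integral\<^sup>N M f = (SUP g\<in>{g. simple_function M g \<and> g \<le> f}. c * integral\<^sup>S M g)"
    unfolding nn_integral_def by (rule SUP_mult_left_ennreal)
  also have "\<dots> \<le> (\<integral>\<^sup>+x. c * f x \<partial>M)"
  proof (rule SUP_least)
    fix g assume "g \<in> {g. simple_function M g \<and> g \<le> f}"
    then have g: "simple_function M g" "\<And>x. g x \<le> f x" by (auto simp: le_fun_def)
    have "c * integral\<^sup>S M g = (\<integral>\<^sup>Sx. c * g x \<partial>M)" by (rule simple_integral_mult[OF g(1), symmetric])
    also have "\<dots> = (\<integral>\<^sup>+x. c * g x \<partial>M)" using g(1) by (intro nn_integral_eq_simple_integral[symmetric]) simp
    also have "\<dots> \<le> (\<integral>\<^sup>+x. c * f x \<partial>M)" using g(2) by (intro nn_integral_mono mult_left_mono) auto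
    finally show "c * integral\<^sup>S M g \<le> (\<integral>\<^sup>+x. c * f x \<partial>M)" .
  qed
  finally show ?thesis .
qed

text \<open>
  Multiplication by a positive finite constant permutes the simple functions, so it commutes with the
  integral of an arbitrary integrand. This lets identities between path functionals be integrated
  whether or not these functionals are measurable.
\<close>

lemma nn_integral_cmult_nonmeasurable:
  assumes r: "0 < r"
  shows "(\<integral>\<^sup>+x. ennreal r * f x \<partial>M) = ennreal r * integral\<^sup>N M f"
proof (rule antisym)
  have inv: "ennreal r * ennreal (1 / r) = 1"
    using r by (simp add: ennreal_mult[symmetric])
  have "ennreal (1 / r) * (\<integral>\<^sup>+x. ennreal r * f x \<partial>M) \<le> (\<integral>\<^sup>+x. ennreal (1 / r) * (ennreal r * f x) \<partial>M)"
    by (rule nn_integral_cmult_ge)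
  also have "\<dots> = integral\<^sup>N M f"
    using inv by (simp add: mult.assoc[symmetric] mult.commute[of "ennreal (1 / r)"])
  finally have "ennreal r * (ennreal (1 / r) * (\<integral>\<^sup>+x. ennreal r * f x \<partial>M)) \<le> ennreal r * integral\<^sup>N M f"
    by (rule mult_left_mono) simp
  then show "(\<integral>\<^sup>+x. ennreal r * f x \<partial>M) \<le> ennreal r * integral\<^sup>N M f"
    using inv by (simp add: mult.assoc[symmetric])
qed (rule nn_integral_cmult_ge)

text \<open>
  For functions without a weak derivative the right-hand side is infinite.
\<close>

lemma SUP_inv_energy_le:
  assumes f: "f \<in> U2"
  shows "(SUP m. inv_energy m f) \<le> inv_deriv f"
proof (cases "\<exists>g. has_weak_deriv f g")
  case True
  obtain w d where w: "profile w" "AE x in circ. f x = profile.G w d \<bar>x\<bar>" "inv_deriv f = 2 * inv_half w"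
    by (rule weak_deriv_profile[OF f True]) (rule that)
  interpret profile w d by (rule w(1))
  have "(SUP m. inv_energy m f) \<le> inv_half w"
    using f w(2) by (intro SUP_least inv_energy_le) (auto simp: U2_def)
  also have "\<dots> \<le> inv_deriv f"
    unfolding w(3) using mult_right_mono[of 1 "2::ennreal"] by simp
  finally show ?thesis .
next
  case False
  then show ?thesis using no_weak_deriv_infinite by simp
qed

lemma finite_of_inv_energy:
  assumes f: "f \<in> U2" and h: "hsq 1 (coef f) < \<infinity>" and e: "(SUP m. inv_energy m f) < \<infinity>"
  shows "inv_deriv f < \<infinity>"
proof -
  have fL: "f \<in> L2" using f by (simp add: U2_def)
  obtain w d where w: "profile w" "AE x in circ. f x = profile.G w d \<bar>x\<bar>" "inv_deriv f = 2 * inv_half w"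
    by (rule weak_deriv_profile[OF f has_weak_deriv_of_hsq[OF fL U2_even[OF f] h]]) (rule that)
  interpret profile w d by (rule w(1))
  have "inv_deriv f \<le> 2 * (SUP m. inv_energy m f)"
    unfolding w(3) by (intro mult_left_mono le_inv_energy fL w(2)) simp
  also have "\<dots> < \<infinity>" using e by (simp add: ennreal_mult_less_top)
  finally show ?thesis .
qed

lemma L2_zero: "(\<lambda>_. 0) \<in> L2"
  by (intro continuous_L2 continuous_intros)

lemma l2norm_sq: "(l2norm f)\<^sup>2 = ip f f"
  by (simp add: l2norm_def ip_self_nonneg)

text \<open>
  Polarisation: measurability of distances to fixed elements yields measurability of inner products. The
  difference with 0 is kept to display such a distance.
\<close>

lemma ip_eq_l2norm:
  assumes "f \<in> L2" "g \<in> L2"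
  shows "ip f g = ((l2norm (\<lambda>x. f x - 0))\<^sup>2 + ip g g - (l2norm (\<lambda>x. f x - g x))\<^sup>2) / 2"
  unfolding l2norm_sq ip_diff_self[OF assms] by simp

text \<open>
  Inner products are measurable in \<open>\<omega>\<close> and continuous in time, so they are limits of the processes frozen at
  the left points of grids of mesh \<open>1 / (n + 1)\<close>, which are jointly measurable.
\<close>

lemma ip_measurable_pair:
  fixes X :: "real \<Rightarrow> 'w \<Rightarrow> real \<Rightarrow> real"
  assumes L2: "\<And>t \<omega>. 0 \<le> t \<Longrightarrow> \<omega> \<in> space M \<Longrightarrow> X t \<omega> \<in> L2"
    and cont: "\<And>t \<omega>. 0 \<le> t \<Longrightarrow> \<omega> \<in> space M \<Longrightarrow>
      ((\<lambda>s. l2norm (\<lambda>x. X s \<omega> x - X t \<omega> x)) \<longlongrightarrow> 0) (at t within {0..})"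
    and meas: "\<And>t. 0 \<le> t \<Longrightarrow> L2_measurable M (X t)" and psi: "\<psi> \<in> L2"
  shows "(\<lambda>(\<omega>, t). ip (X (max 0 t) \<omega>) \<psi>) \<in> borel_measurable (M \<Otimes>\<^sub>M lborel)"
proof -
  have Y: "(\<lambda>\<omega>. ip (X t \<omega>) \<psi>) \<in> borel_measurable M" if t: "0 \<le> t" for t
  proof (rule measurable_cong[THEN iffD1])
    show "(\<lambda>\<omega>. ((l2norm (\<lambda>x. X t \<omega> x - 0))\<^sup>2 + ip \<psi> \<psi> - (l2norm (\<lambda>x. X t \<omega> x - \<psi> x))\<^sup>2) / 2) \<in> borel_measurable M"
      using meas[OF t] psi L2_zero unfolding L2_measurable_def
      by (intro borel_measurable_divide borel_measurable_diff borel_measurable_add borel_measurable_power borel_measurable_const) auto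
    show "((l2norm (\<lambda>x. X t \<omega> x - 0))\<^sup>2 + ip \<psi> \<psi> - (l2norm (\<lambda>x. X t \<omega> x - \<psi> x))\<^sup>2) / 2 = ip (X t \<omega>) \<psi>"
      if "\<omega> \<in> space M" for \<omega>
      using ip_eq_l2norm[OF L2[OF t that] psi] by simp
  qed
  have C: "continuous_on {0..} (\<lambda>t. ip (X t \<omega>) \<psi>)" if w: "\<omega> \<in> space M" for \<omega>
    unfolding continuous_on_def
  proof
    fix t :: real assume "t \<in> {0..}"
    then have t: "0 \<le> t" by simp
    have "((\<lambda>s. l2norm (\<lambda>x. X s \<omega> x - X t \<omega> x) * l2norm \<psi>) \<longlongrightarrow> 0 * l2norm \<psi>) (at t within {0..})"
      by (intro tendsto_mult cont t w tendsto_const)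
    then have "((\<lambda>s. l2norm (\<lambda>x. X s \<omega> x - X t \<omega> x) * l2norm \<psi>) \<longlongrightarrow> 0) (at t within {0..})" by simp
    then have "((\<lambda>s. ip (X s \<omega>) \<psi> - ip (X t \<omega>) \<psi>) \<longlongrightarrow> 0) (at t within {0..})"
    proof (rule Lim_null_comparison[rotated])
      show "\<forall>\<^sub>F s in at t within {0..}. norm (ip (X s \<omega>) \<psi> - ip (X t \<omega>) \<psi>) \<le> l2norm (\<lambda>x. X s \<omega> x - X t \<omega> x) * l2norm \<psi>"
        unfolding eventually_at_filter
      proof (intro always_eventually allI impI)
        fix s :: real assume "s \<in> {0..}"
        then have s: "0 \<le> s" by simp
        have "(ip (X s \<omega>) \<psi> - ip (X t \<omega>) \<psi>)\<^sup>2 \<le> (l2norm (\<lambda>x. X s \<omega> x - X t \<omega> x) * l2norm \<psi>)\<^sup>2"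
          using ip_Cauchy_Schwarz[OF L2_diff[OF L2[OF s w] L2[OF t w]] psi]
          unfolding ip_diff[OF L2[OF s w] L2[OF t w] psi] by (simp add: power_mult_distrib l2norm_sq)
        moreover have "0 \<le> l2norm (\<lambda>x. X s \<omega> x - X t \<omega> x) * l2norm \<psi>"
          by (simp add: l2norm_def ip_self_nonneg)
        ultimately show "norm (ip (X s \<omega>) \<psi> - ip (X t \<omega>) \<psi>) \<le> l2norm (\<lambda>x. X s \<omega> x - X t \<omega> x) * l2norm \<psi>"
          unfolding abs_le_square_iff[symmetric] by simp
      qed
    qed
    then show "((\<lambda>t. ip (X t \<omega>) \<psi>) \<longlongrightarrow> ip (X t \<omega>) \<psi>) (at t within {0..})" by (rule LIM_zero_cancel)
  qed
  define s where "s n t = real (nat \<lfloor>real (Suc n) * max 0 t\<rfloor>) / real (Suc n)" for n and t :: real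
  have s0: "s n t \<in> {0..}" for n t by (simp add: s_def)
  have slim: "(\<lambda>n. s n t) \<longlonglongrightarrow> max 0 t" for t
  proof (rule tendsto_sandwich[of "\<lambda>n. max 0 t - 1 / real (Suc n)" _ _ "\<lambda>n. max 0 t"])
    have "(\<lambda>n. max 0 t - 1 / real (Suc n)) \<longlonglongrightarrow> max 0 t - 0"
      by (intro tendsto_diff tendsto_const LIMSEQ_Suc[OF lim_const_over_n])
    then show "(\<lambda>n. max 0 t - 1 / real (Suc n)) \<longlonglongrightarrow> max 0 t" by simp
    have b: "real (Suc n) * max 0 t - 1 \<le> real (nat \<lfloor>real (Suc n) * max 0 t\<rfloor>)"
      "real (nat \<lfloor>real (Suc n) * max 0 t\<rfloor>) \<le> real (Suc n) * max 0 t" for n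
    proof -
      have "0 \<le> real (Suc n) * max 0 t" by simp
      then have "real (nat \<lfloor>real (Suc n) * max 0 t\<rfloor>) = of_int \<lfloor>real (Suc n) * max 0 t\<rfloor>"
        by (simp only: of_nat_nat zero_le_floor)
      then show "real (Suc n) * max 0 t - 1 \<le> real (nat \<lfloor>real (Suc n) * max 0 t\<rfloor>)"
        "real (nat \<lfloor>real (Suc n) * max 0 t\<rfloor>) \<le> real (Suc n) * max 0 t" by linarith+
    qed
    have "max 0 t - 1 / real (Suc n) \<le> s n t" for n
    proof -
      have "max 0 t - 1 / real (Suc n) = (real (Suc n) * max 0 t - 1) / real (Suc n)"
        by (simp add: diff_divide_distrib)
      also have "\<dots> \<le> s n t" unfolding s_def by (rule divide_right_mono[OF b(1)]) simp
      finally show ?thesis .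
    qed
    then show "\<forall>\<^sub>F n in sequentially. max 0 t - 1 / real (Suc n) \<le> s n t" by simp
    have "s n t \<le> max 0 t" for n
    proof -
      have "s n t \<le> (real (Suc n) * max 0 t) / real (Suc n)" unfolding s_def by (rule divide_right_mono[OF b(2)]) simp
      then show ?thesis by simp
    qed
    then show "\<forall>\<^sub>F n in sequentially. s n t \<le> max 0 t" by simp
  qed simp
  show ?thesis
  proof (rule borel_measurable_LIMSEQ_metric)
    show "(\<lambda>(\<omega>, t). ip (X (s n t) \<omega>) \<psi>) \<in> borel_measurable (M \<Otimes>\<^sub>M lborel)" for n
    proof -
      have "(\<lambda>p. (\<lambda>k p. ip (X (real k / real (Suc n)) (fst p)) \<psi>) (nat \<lfloor>real (Suc n) * max 0 (snd p)\<rfloor>) p) \<in> borel_measurable (M \<Otimes>\<^sub>M lborel)"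
      proof (rule measurable_compose_countable[where f = "\<lambda>k p. ip (X (real k / real (Suc n)) (fst p)) \<psi>"
            and g = "\<lambda>p. nat \<lfloor>real (Suc n) * max 0 (snd p)\<rfloor>"])
        show "(\<lambda>p. ip (X (real k / real (Suc n)) (fst p)) \<psi>) \<in> borel_measurable (M \<Otimes>\<^sub>M lborel)" for k
          by (rule measurable_compose[OF measurable_fst Y]) simp
        show "(\<lambda>p. nat \<lfloor>real (Suc n) * max 0 (snd p)\<rfloor>) \<in> measurable (M \<Otimes>\<^sub>M lborel) (count_space UNIV)"
          by measurable
      qed
      then show ?thesis by (simp add: s_def case_prod_unfold)
    qed
    show "(\<lambda>n. case p of (\<omega>, t) \<Rightarrow> ip (X (s n t) \<omega>) \<psi>) \<longlonglongrightarrow> (case p of (\<omega>, t) \<Rightarrow> ip (X (max 0 t) \<omega>) \<psi>)"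
      if "p \<in> space (M \<Otimes>\<^sub>M lborel)" for p
    proof -
      obtain \<omega> t where p: "p = (\<omega>, t)" by (cases p)
      then have "\<omega> \<in> space M" using that by (simp add: space_pair_measure)
      then show ?thesis unfolding p
        using continuous_on_tendsto_compose[OF C slim[of t]] s0 by simp
    qed
  qed
qed

lemma path_functionals_measurable:
  fixes X :: "real \<Rightarrow> 'w \<Rightarrow> real \<Rightarrow> real"
  assumes L2: "\<And>t \<omega>. 0 \<le> t \<Longrightarrow> \<omega> \<in> space M \<Longrightarrow> X t \<omega> \<in> L2"
    and cont: "\<And>t \<omega>. 0 \<le> t \<Longrightarrow> \<omega> \<in> space M \<Longrightarrow>
      ((\<lambda>s. l2norm (\<lambda>x. X s \<omega> x - X t \<omega> x)) \<longlongrightarrow> 0) (at t within {0..})"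
    and meas: "\<And>t. 0 \<le> t \<Longrightarrow> L2_measurable M (X t)"
  shows "(\<lambda>(\<omega>, t). hsq 1 (coef (X (max 0 t) \<omega>))) \<in> borel_measurable (M \<Otimes>\<^sub>M lborel)"
    and "(\<lambda>(\<omega>, t). SUP m. inv_energy m (X (max 0 t) \<omega>)) \<in> borel_measurable (M \<Otimes>\<^sub>M lborel)"
proof -
  have ip_meas: "(\<lambda>p. ip (X (max 0 (snd p)) (fst p)) \<psi>) \<in> borel_measurable (M \<Otimes>\<^sub>M lborel)" if "\<psi> \<in> L2" for \<psi>
    using ip_measurable_pair[OF L2 cont meas that] by (simp add: case_prod_unfold)
  have [measurable]: "(\<lambda>p. ip (X (max 0 (snd p)) (fst p)) (ecos k)) \<in> borel_measurable (M \<Otimes>\<^sub>M lborel)" for k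
    by (rule ip_meas[OF ecos_L2])
  show "(\<lambda>(\<omega>, t). hsq 1 (coef (X (max 0 t) \<omega>))) \<in> borel_measurable (M \<Otimes>\<^sub>M lborel)"
    unfolding hsq_def coef_def case_prod_unfold by measurable
  have [measurable]: "(\<lambda>p. left_mean (X (max 0 (snd p)) (fst p)) b n) \<in> borel_measurable (M \<Otimes>\<^sub>M lborel)" for b n
    unfolding left_mean_def by (rule ip_meas[OF indicator_L2])
  have [measurable]: "(\<lambda>p. endpoint (X (max 0 (snd p)) (fst p)) b) \<in> borel_measurable (M \<Otimes>\<^sub>M lborel)" for b
    unfolding endpoint_def by measurable
  show "(\<lambda>(\<omega>, t). SUP m. inv_energy m (X (max 0 t) \<omega>)) \<in> borel_measurable (M \<Otimes>\<^sub>M lborel)"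
    unfolding inv_energy_def slope_def case_prod_unfold by measurable
qed

lemma AE_section_finite:
  fixes h :: "real \<Rightarrow> ennreal"
  assumes [measurable]: "h \<in> borel_measurable lborel"
    and fin: "\<And>n. (\<integral>\<^sup>+t\<in>{0..real (Suc n)}. h t \<partial>lborel) < \<infinity>"
  shows "AE t in lborel. 0 \<le> t \<longrightarrow> h t < \<infinity>"
proof -
  have "AE t in lborel. h t * indicator {0..real (Suc n)} t \<noteq> \<infinity>" for n
    by (rule nn_integral_noteq_infinite) (use fin[of n] in auto)
  then have "AE t in lborel. \<forall>n. h t * indicator {0..real (Suc n)} t \<noteq> \<infinity>"
    by (simp add: AE_all_countable)
  then show ?thesis
  proof eventually_elim
    case (elim t)
    show ?case
    proof
      assume t: "0 \<le> t"
      obtain n where "t \<le> real n" using real_arch_simple by blast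
      then have "t \<in> {0..real (Suc n)}" using t by simp
      then show "h t < \<infinity>" using elim[rule_format, of n] by (simp add: less_top)
    qed
  qed
qed

text \<open>
  \<open>E\<close> is jointly measurable and lies below the integral of the inverse derivative, whose double integral is
  finite; Tonelli makes \<open>E\<close> finite almost everywhere. Together with the finiteness of the Sobolev norm
  \<open>K\<close>, this bounds the integral of the inverse derivative itself.
\<close>

lemma solution_path_regular:
  fixes X :: "real \<Rightarrow> 'w \<Rightarrow> real \<Rightarrow> real"
  assumes M: "prob_space M" and F: "usual_conditions M F" and X: "sol_path M F X"
  shows "AE \<omega> in M. AE t in lborel. t > 0 \<longrightarrow>
    X t \<omega> \<in> U2 \<and> inv_deriv (X t \<omega>) < \<infinity>"
proof -
  interpret M: prob_space M by (rule M)
  note X' = X[unfolded sol_path_def]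
  have U2: "X t \<omega> \<in> U2" if "0 \<le> t" "\<omega> \<in> space M" for t \<omega>
    using X'[THEN conjunct1] that by simp
  then have L2: "X t \<omega> \<in> L2" if "0 \<le> t" "\<omega> \<in> space M" for t \<omega>
    using that by (simp add: U2_def)
  have cont: "((\<lambda>s. l2norm (\<lambda>x. X s \<omega> x - X t \<omega> x)) \<longlongrightarrow> 0) (at t within {0..})" if "0 \<le> t" "\<omega> \<in> space M" for t \<omega>
    using X'[THEN conjunct2, THEN conjunct1] that by simp
  have meas: "L2_measurable M (X t)" if t: "0 \<le> t" for t
  proof -
    have "subalgebra M (F t)" using F[unfolded usual_conditions_def, THEN conjunct1] t by simp
    moreover have "L2_measurable (F t) (X t)" using X'[THEN conjunct2, THEN conjunct2, THEN conjunct1] t by simp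
    ultimately show ?thesis
      unfolding L2_measurable_def by (intro ballI measurable_from_subalg[of M "F t"]) auto
  qed
  have hsq_fin: "AE \<omega> in M. \<forall>T>0. (\<integral>\<^sup>+t\<in>{0..T}. hsq 1 (coef (X t \<omega>)) \<partial>lborel) < \<infinity>"
    by (rule X'[THEN conjunct2, THEN conjunct2, THEN conjunct2, THEN conjunct1])
  have inv_fin: "(\<integral>\<^sup>+\<omega>. (\<integral>\<^sup>+t\<in>{0..T}. inv_deriv (X t \<omega>) \<partial>lborel) \<partial>M) < \<infinity>" if "0 < T" for T
    using X'[THEN conjunct2, THEN conjunct2, THEN conjunct2, THEN conjunct2, THEN conjunct2] that by blast
  \<comment> \<open>The hypotheses concern non-negative times; max 0 extends the process to a measurable map on the line.\<close>
  define E where "E \<omega> t = (SUP m. inv_energy m (X (max 0 t) \<omega>))" for \<omega> t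
  define K where "K \<omega> t = hsq 1 (coef (X (max 0 t) \<omega>))" for \<omega> t
  have Em: "(\<lambda>(\<omega>, t). E \<omega> t) \<in> borel_measurable (M \<Otimes>\<^sub>M lborel)"
    unfolding E_def by (rule path_functionals_measurable(2)[OF L2 cont meas])
  have Km: "(\<lambda>(\<omega>, t). K \<omega> t) \<in> borel_measurable (M \<Otimes>\<^sub>M lborel)"
    unfolding K_def by (rule path_functionals_measurable(1)[OF L2 cont meas])
  have sec: "E \<omega> \<in> borel_measurable lborel" "K \<omega> \<in> borel_measurable lborel" if "\<omega> \<in> space M" for \<omega>
    using measurable_compose[OF measurable_Pair1'[OF that] Em] measurable_compose[OF measurable_Pair1'[OF that] Km]
    by simp_all
  have Efin: "AE \<omega> in M. (\<integral>\<^sup>+t\<in>{0..real (Suc n)}. E \<omega> t \<partial>lborel) \<noteq> \<infinity>" for n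
  proof (rule nn_integral_noteq_infinite)
    have "(\<lambda>(\<omega>, t). E \<omega> t * indicator {0..real (Suc n)} t) \<in> borel_measurable (M \<Otimes>\<^sub>M lborel)"
      using Em unfolding case_prod_unfold by measurable
    then show "(\<lambda>\<omega>. \<integral>\<^sup>+t\<in>{0..real (Suc n)}. E \<omega> t \<partial>lborel) \<in> borel_measurable M"
      by (rule lborel.borel_measurable_nn_integral)
    have "(\<integral>\<^sup>+\<omega>. (\<integral>\<^sup>+t\<in>{0..real (Suc n)}. E \<omega> t \<partial>lborel) \<partial>M)
      \<le> (\<integral>\<^sup>+\<omega>. (\<integral>\<^sup>+t\<in>{0..real (Suc n)}. inv_deriv (X t \<omega>) \<partial>lborel) \<partial>M)"
    proof (intro nn_integral_mono)
      fix \<omega> and t :: real assume "\<omega> \<in> space M"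
      then show "E \<omega> t * indicator {0..real (Suc n)} t \<le> inv_deriv (X t \<omega>) * indicator {0..real (Suc n)} t"
        using SUP_inv_energy_le[OF U2[of t \<omega>]] by (simp add: E_def indicator_def)
    qed
    also have "\<dots> < \<infinity>" by (rule inv_fin) simp
    finally show "(\<integral>\<^sup>+\<omega>. (\<integral>\<^sup>+t\<in>{0..real (Suc n)}. E \<omega> t \<partial>lborel) \<partial>M) \<noteq> \<infinity>" by simp
  qed
  then have Efin': "AE \<omega> in M. \<forall>n. (\<integral>\<^sup>+t\<in>{0..real (Suc n)}. E \<omega> t \<partial>lborel) \<noteq> \<infinity>"
    by (simp add: AE_all_countable)
  show ?thesis
    using Efin' hsq_fin AE_space
  proof eventually_elim
    case (elim \<omega>)
    have "AE t in lborel. 0 \<le> t \<longrightarrow> E \<omega> t < \<infinity>"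
      by (rule AE_section_finite[OF sec(1)[OF elim(3)]]) (use elim(1) in \<open>simp add: less_top\<close>)
    moreover have "AE t in lborel. 0 \<le> t \<longrightarrow> K \<omega> t < \<infinity>"
    proof (rule AE_section_finite[OF sec(2)[OF elim(3)]])
      fix n
      have "(\<integral>\<^sup>+t\<in>{0..real (Suc n)}. K \<omega> t \<partial>lborel) = (\<integral>\<^sup>+t\<in>{0..real (Suc n)}. hsq 1 (coef (X t \<omega>)) \<partial>lborel)"
        by (rule nn_integral_cong) (simp add: K_def indicator_def)
      also have "\<dots> < \<infinity>" using elim(2) by simp
      finally show "(\<integral>\<^sup>+t\<in>{0..real (Suc n)}. K \<omega> t \<partial>lborel) < \<infinity>" .
    qed
    ultimately show ?case
    proof eventually_elim
      case (elim t)
      show ?case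
      proof
        assume t: "0 < t"
        then have "X t \<omega> \<in> U2" using U2 \<open>\<omega> \<in> space M\<close> by simp
        moreover have "hsq 1 (coef (X t \<omega>)) < \<infinity>" "(SUP m. inv_energy m (X t \<omega>)) < \<infinity>"
          using elim t by (simp_all add: E_def K_def)
        ultimately show "X t \<omega> \<in> U2 \<and> inv_deriv (X t \<omega>) < \<infinity>"
          using finite_of_inv_energy by blast
      qed
    qed
  qed
qed

lemma nn_integral_path_cmult:
  fixes T :: real
  assumes r: "0 < r" and eq: "AE \<omega> in M. AE t in lborel. t > 0 \<longrightarrow> f t \<omega> = ennreal r * g t \<omega>"
  shows "(\<integral>\<^sup>+\<omega>. (\<integral>\<^sup>+t\<in>{0..T}. f t \<omega> \<partial>lborel) \<partial>M) = ennreal r * (\<integral>\<^sup>+\<omega>. (\<integral>\<^sup>+t\<in>{0..T}. g t \<omega> \<partial>lborel) \<partial>M)"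
proof -
  have "(\<integral>\<^sup>+\<omega>. (\<integral>\<^sup>+t\<in>{0..T}. f t \<omega> \<partial>lborel) \<partial>M) = (\<integral>\<^sup>+\<omega>. ennreal r * (\<integral>\<^sup>+t\<in>{0..T::real}. g t \<omega> \<partial>lborel) \<partial>M)"
  proof (rule nn_integral_cong_AE)
    show "AE \<omega> in M. (\<integral>\<^sup>+t\<in>{0..T}. f t \<omega> \<partial>lborel) = ennreal r * (\<integral>\<^sup>+t\<in>{0..T}. g t \<omega> \<partial>lborel)"
      using eq
    proof eventually_elim
      case (elim \<omega>)
      have "(\<integral>\<^sup>+t\<in>{0..T}. f t \<omega> \<partial>lborel) = (\<integral>\<^sup>+t. ennreal r * (g t \<omega> * indicator {0..T} t) \<partial>lborel)"
      proof (rule nn_integral_cong_AE)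
        show "AE t in lborel. f t \<omega> * indicator {0..T} t = ennreal r * (g t \<omega> * indicator {0..T} t)"
          using elim AE_lborel_singleton[of 0]
          by eventually_elim (auto simp: indicator_def)
      qed
      then show ?case by (simp add: nn_integral_cmult_nonmeasurable[OF r])
    qed
  qed
  then show ?thesis by (simp add: nn_integral_cmult_nonmeasurable[OF r])
qed

section \<open>Density, derivative and inverse of the path\<close>

theorem theorem7p1:
  fixes M :: "'w measure" and F :: "real \<Rightarrow> 'w measure"
    and B :: "nat \<Rightarrow> real \<Rightarrow> 'w \<Rightarrow> real" and lam :: real
    and X0 :: "'w \<Rightarrow> real \<Rightarrow> real" and X :: "real \<Rightarrow> 'w \<Rightarrow> real \<Rightarrow> real"
    and \<eta> :: "real \<Rightarrow> 'w \<Rightarrow> distrib"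
  assumes "prob_space M" and "usual_conditions M F"
    and "independent_brownians M F B" and "lam > 1/2"
    and "initial_condition M F X0"
    and "is_solution M F lam B X0 X \<eta>"
  defines "\<mu> \<equiv> \<lambda>t \<omega>. law (X t \<omega>)"
  defines "p \<equiv> \<lambda>t \<omega>. dens (\<mu> t \<omega>)"
  defines "x \<equiv> \<lambda>t \<omega>. crep (X t \<omega>)"
  shows
    "(AE \<omega> in M. AE t in lborel. t > 0 \<longrightarrow>
        \<mu> t \<omega> = density lborel (\<lambda>z. ennreal (p t \<omega> z)) \<and>
        (\<integral>\<^sup>+z. ennreal ((p t \<omega> z)\<^sup>2) \<partial>lborel) < \<infinity>) \<and>
     (\<forall>T>0. (\<integral>\<^sup>+\<omega>. (\<integral>\<^sup>+t\<in>{0..T}. (\<integral>\<^sup>+z. ennreal ((p t \<omega> z)\<^sup>2) \<partial>lborel) \<partial>lborel) \<partial>M) < \<infinity>) \<and>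
     (AE \<omega> in M. AE t in lborel. t > 0 \<longrightarrow>
        (AE z in lborel. z \<notin> {x t \<omega> 0..x t \<omega> (1/2)} \<longrightarrow> p t \<omega> z = 0) \<and>
        (AE z in lborel. z \<in> {x t \<omega> 0<..<x t \<omega> (1/2)} \<longrightarrow> p t \<omega> z > 0) \<and>
        (AE z in lborel. 1/2 * cdf (\<mu> t \<omega>) z \<notin> {0, 1/2} \<longrightarrow>
           x t \<omega> differentiable (at (1/2 * cdf (\<mu> t \<omega>) z))) \<and>
        (AE z in lborel. z \<in> {x t \<omega> 0<..<x t \<omega> (1/2)} \<longrightarrow>
           (x t \<omega> has_real_derivative 2 / p t \<omega> z) (at (1/2 * cdf (\<mu> t \<omega>) z)))) \<and>
     (\<forall>T>0.
        (\<integral>\<^sup>+\<omega>. (\<integral>\<^sup>+t\<in>{0..T}.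
           (\<integral>\<^sup>+z\<in>{x t \<omega> 0<..<x t \<omega> (1/2)}. 1 / ennreal (p t \<omega> z) \<partial>lborel) \<partial>lborel) \<partial>M) =
          1/4 * (\<integral>\<^sup>+\<omega>. (\<integral>\<^sup>+t\<in>{0..T}.
             (\<integral>\<^sup>+y. ennreal ((wD (X t \<omega>) y)\<^sup>2) \<partial>circ) \<partial>lborel) \<partial>M) \<and>
        1/4 * (\<integral>\<^sup>+\<omega>. (\<integral>\<^sup>+t\<in>{0..T}.
             (\<integral>\<^sup>+y. ennreal ((wD (X t \<omega>) y)\<^sup>2) \<partial>circ) \<partial>lborel) \<partial>M) < \<infinity>) \<and>
     (AE \<omega> in M. AE t in lborel. t > 0 \<longrightarrow>
        continuous_on {0<..<1} (\<lambda>u. x t \<omega> (u / 2)) \<and>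
        bij_betw (\<lambda>u. x t \<omega> (u / 2)) {0<..<1} {x t \<omega> 0<..<x t \<omega> (1/2)} \<and>
        (\<forall>u\<in>{0<..<1}. cdf (\<mu> t \<omega>) (x t \<omega> (u / 2)) = u) \<and>
        (\<forall>z\<in>{x t \<omega> 0<..<x t \<omega> (1/2)}. x t \<omega> (cdf (\<mu> t \<omega>) z / 2) = z))"
proof -
  have X: "sol_path M F X" using assms(6) by (simp add: is_solution_def)
  have reg: "AE \<omega> in M. AE t in lborel. t > 0 \<longrightarrow> X t \<omega> \<in> U2 \<and> inv_deriv (X t \<omega>) < \<infinity>"
    by (rule solution_path_regular[OF assms(1,2) X])
  have path: "AE \<omega> in M. AE t in lborel. t > 0 \<longrightarrow> Q t \<omega>"
    if "\<And>t \<omega>. X t \<omega> \<in> U2 \<Longrightarrow> inv_deriv (X t \<omega>) < \<infinity> \<Longrightarrow> Q t \<omega>" for Q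
    using reg
  proof eventually_elim
    case (elim \<omega>)
    then show ?case by eventually_elim (use that in blast)
  qed
  show ?thesis
  proof (intro conjI allI impI)
    show "AE \<omega> in M. AE t in lborel. t > 0 \<longrightarrow>
        \<mu> t \<omega> = density lborel (\<lambda>z. ennreal (p t \<omega> z)) \<and> (\<integral>\<^sup>+z. ennreal ((p t \<omega> z)\<^sup>2) \<partial>lborel) < \<infinity>"
    proof (rule path, intro conjI)
      fix t \<omega> assume a: "X t \<omega> \<in> U2" "inv_deriv (X t \<omega>) < \<infinity>"
      show "\<mu> t \<omega> = density lborel (\<lambda>z. ennreal (p t \<omega> z))"
        unfolding p_def \<mu>_def by (rule regular_path_law(1)[OF a])
      show "(\<integral>\<^sup>+z. ennreal ((p t \<omega> z)\<^sup>2) \<partial>lborel) < \<infinity>"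
        unfolding p_def \<mu>_def regular_path_law(2)[OF a] using a(2) by (simp add: ennreal_mult_less_top)
    qed
    show "(\<integral>\<^sup>+\<omega>. (\<integral>\<^sup>+t\<in>{0..T}. (\<integral>\<^sup>+z. ennreal ((p t \<omega> z)\<^sup>2) \<partial>lborel) \<partial>lborel) \<partial>M) < \<infinity>" if T: "0 < T" for T
    proof -
      have eq: "(\<integral>\<^sup>+\<omega>. (\<integral>\<^sup>+t\<in>{0..T}. (\<integral>\<^sup>+z. ennreal ((p t \<omega> z)\<^sup>2) \<partial>lborel) \<partial>lborel) \<partial>M) =
        ennreal 2 * (\<integral>\<^sup>+\<omega>. (\<integral>\<^sup>+t\<in>{0..T}. inv_deriv (X t \<omega>) \<partial>lborel) \<partial>M)"
        by (rule nn_integral_path_cmult, simp, rule path) (simp add: p_def \<mu>_def regular_path_law(2))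
      have "(\<integral>\<^sup>+\<omega>. (\<integral>\<^sup>+t\<in>{0..T}. inv_deriv (X t \<omega>) \<partial>lborel) \<partial>M) < \<infinity>"
        using X[unfolded sol_path_def, THEN conjunct2, THEN conjunct2, THEN conjunct2, THEN conjunct2, THEN conjunct2] T by blast
      then show ?thesis unfolding eq by (simp add: ennreal_mult_less_top)
    qed
    show "(\<integral>\<^sup>+\<omega>. (\<integral>\<^sup>+t\<in>{0..T}.
           (\<integral>\<^sup>+z\<in>{x t \<omega> 0<..<x t \<omega> (1/2)}. 1 / ennreal (p t \<omega> z) \<partial>lborel) \<partial>lborel) \<partial>M) =
          1/4 * (\<integral>\<^sup>+\<omega>. (\<integral>\<^sup>+t\<in>{0..T}.
             (\<integral>\<^sup>+y. ennreal ((wD (X t \<omega>) y)\<^sup>2) \<partial>circ) \<partial>lborel) \<partial>M)" for T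
    proof -
      have quarter: "ennreal (1/4) = 1/4" using divide_ennreal[of 1 4] by simp
      show ?thesis
        unfolding quarter[symmetric]
        by (rule nn_integral_path_cmult, simp, rule path)
          (simp only: quarter p_def \<mu>_def x_def regular_path_law(7))
    qed
    show "1/4 * (\<integral>\<^sup>+\<omega>. (\<integral>\<^sup>+t\<in>{0..T}.
             (\<integral>\<^sup>+y. ennreal ((wD (X t \<omega>) y)\<^sup>2) \<partial>circ) \<partial>lborel) \<partial>M) < \<infinity>" if T: "0 < T" for T
    proof -
      have "(\<integral>\<^sup>+\<omega>. (\<integral>\<^sup>+t\<in>{0..T}. (\<integral>\<^sup>+y. ennreal ((wD (X t \<omega>) y)\<^sup>2) \<partial>circ) \<partial>lborel) \<partial>M) < \<infinity>"
        using X[unfolded sol_path_def, THEN conjunct2, THEN conjunct2, THEN conjunct2, THEN conjunct2, THEN conjunct1] T by blast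
      moreover have "(1/4 :: ennreal) < \<infinity>" using divide_ennreal[of 1 4] ennreal_less_top[of "1/4"] by simp
      ultimately show ?thesis by (simp add: ennreal_mult_less_top)
    qed
  \<comment> \<open>The two remaining conjuncts hold separately at each regular time.\<close>
  qed (unfold p_def \<mu>_def x_def, (rule path, intro conjI; rule regular_path_law; assumption)+)
qed

end
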